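(* Let $1<p<\frac73$ and assume that the well-posedness assumption (WP) described in the context holds for the equation $$i\partial_t\psi+\partial_{xx}\psi-|D_y|\psi+|\psi|^{p-1}\psi=0\quad\text{in }\mathbb{R}\times\mathbb{R}^2.$$ Then for each $\mu>0$ the set $\Sigma(\mu)$ is non-empty and stable under the flow of this equation.
   Context: Functions are complex-valued on $\mathbb{R}^2$ with variables $(x,y)$; $|D_y|^{a}$ is the Fourier multiplier in $y$ with symbol $|\eta|^a$. $X=H^1_xL^2_y(\mathbb{R}^2)\cap L^2_xH^{1/2}_y(\mathbb{R}^2)$ with norm $\|u\|_X=(\|\partial_xu\|_{L^2}^2+\||D_y|^{1/2}u\|_{L^2}^2+\|u\|_{L^2}^2)^{1/2}$. Define $$\mathcal{M}(u)=\tfrac12\|u\|_{L^2}^2,\qquad \mathcal{H}(u)=\tfrac12\left(\|\partial_xu\|_{L^2}^2+\||D_y|^{1/2}u\|_{L^2}^2\right)-\tfrac1{p+1}\|u\|_{L^{p+1}}^{p+1}.$$ Assumption (WP): for any $\psi_0\in X$ there exist $T=T(\|\psi_0\|_X)>0$ and a unique local solution $\psi\in C([0,T),X)$ of the equation with $\psi|_{t=0}=\psi_0$; moreover, as long as the solution exists, $\mathcal{H}(\psi(t))=\mathcal{H}(\psi_0)$ and $\mathcal{M}(\psi(t))=\mathcal{M}(\psi_0)$ for all $t\in I_{\max}$, the maximal existence interval. (Solutions for negative times are obtained through the symmetry $\psi(t)\mapsto\overline{\psi(-t)}$ of the equation.) For $\mu>0$, $I(\mu)=\inf\{\mathcal{H}(u)\mid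 u\in X,\ \mathcal{M}(u)=\mu\}$ and $\Sigma(\mu)=\{u\in X\mid\mathcal{H}(u)=I(\mu),\ \mathcal{M}(u)=\mu\}$. A set $\Sigma\subset X$ is stable if for any $\varepsilon>0$ there exists $\delta>0$ such that whenever $\psi_0\in X$ satisfies $\inf_{u\in\Sigma}\|\psi_0-u\|_X<\delta$, the solution $\psi(t)$ with $\psi|_{t=0}=\psi_0$ exists for all $t\in\mathbb{R}$ and satisfies $\sup_{t\in\mathbb{R}}\inf_{u\in\Sigma}\|\psi(t)-u\|_X<\varepsilon$. *)

theory Defs
  imports "HOL-Analysis.Analysis"
begin

text \<open>
  Elements of \<open>L\<^sup>2\<close> and of \<open>X\<close> are represented by Borel functions on the plane; two
  representatives of the same element agree almost everywhere.
\<close>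

type_synonym plane = "real \<times> real"

definition ae_eq :: "(plane \<Rightarrow> complex) \<Rightarrow> (plane \<Rightarrow> complex) \<Rightarrow> bool" where
  "ae_eq u v \<longleftrightarrow> (AE z in lborel. u z = v z)"

definition L2 :: "(plane \<Rightarrow> complex) set" where
  "L2 = {u. u \<in> borel_measurable lborel \<and> integrable lborel (\<lambda>z. (cmod (u z))\<^sup>2)}"

definition Lnorm :: "real \<Rightarrow> (plane \<Rightarrow> complex) \<Rightarrow> real" where
  "Lnorm q u = (LINT z|lborel. cmod (u z) powr q) powr (1 / q)"

definition L2_inner :: "(plane \<Rightarrow> complex) \<Rightarrow> (plane \<Rightarrow> complex) \<Rightarrow> complex" where
  "L2_inner u v = (LINT z|lborel. u z * cnj (v z))"

subsection \<open>Fourier transform and Fourier multipliers on \<open>L\<^sup>2\<close>\<close>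

definition fourier_integral :: "(plane \<Rightarrow> complex) \<Rightarrow> plane \<Rightarrow> complex" where
  "fourier_integral f \<zeta> = (LINT z|lborel. cis (- (z \<bullet> \<zeta>)) * f z)"

text \<open>
  The Fourier transform of \<open>f \<in> L\<^sup>2\<close> is the limit in the mean of the transforms of the
  truncations of \<open>f\<close> to balls (which are in \<open>L\<^sup>1 \<inter> L\<^sup>2\<close>). The missing factor \<open>1 / (2 * pi)\<close>
  has no influence on multipliers.
\<close>

definition has_fourier :: "(plane \<Rightarrow> complex) \<Rightarrow> (plane \<Rightarrow> complex) \<Rightarrow> bool" where
  "has_fourier f g \<longleftrightarrow> f \<in> L2 \<and> g \<in> L2 \<and>
     ((\<lambda>R. \<integral>\<^sup>+ \<zeta>. ennreal ((cmod (g \<zeta> -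
         fourier_integral (\<lambda>z. indicator (cball 0 R) z * f z) \<zeta>))\<^sup>2) \<partial>lborel) \<longlongrightarrow> 0) at_top"

definition has_multiplier ::
  "(plane \<Rightarrow> complex) \<Rightarrow> (plane \<Rightarrow> complex) \<Rightarrow> (plane \<Rightarrow> complex) \<Rightarrow> bool" where
  "has_multiplier m u v \<longleftrightarrow>
     (\<exists>g h. has_fourier u g \<and> has_fourier v h \<and> (AE \<zeta> in lborel. h \<zeta> = m \<zeta> * g \<zeta>))"

text \<open>The value is only determined almost everywhere, and only if \<open>u\<close> is in the \<open>L\<^sup>2\<close> domain.\<close>

definition multiplier :: "(plane \<Rightarrow> complex) \<Rightarrow> (plane \<Rightarrow> complex) \<Rightarrow> plane \<Rightarrow> complex" where
  "multiplier m u = (SOME v. has_multiplier m u v)"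

definition dx_symbol :: "plane \<Rightarrow> complex" where
  "dx_symbol = (\<lambda>(\<xi>, \<eta>). \<i> * complex_of_real \<xi>)"

definition Dy_symbol :: "real \<Rightarrow> plane \<Rightarrow> complex" where
  "Dy_symbol a = (\<lambda>(\<xi>, \<eta>). complex_of_real (\<bar>\<eta>\<bar> powr a))"

abbreviation dx :: "(plane \<Rightarrow> complex) \<Rightarrow> plane \<Rightarrow> complex" where
  "dx \<equiv> multiplier dx_symbol"

abbreviation Dy :: "real \<Rightarrow> (plane \<Rightarrow> complex) \<Rightarrow> plane \<Rightarrow> complex" where
  "Dy a \<equiv> multiplier (Dy_symbol a)"

subsection \<open>The energy space\<close>

definition X :: "(plane \<Rightarrow> complex) set" where
  "X = {u \<in> L2. (\<exists>v. has_multiplier dx_symbol u v) \<and> (\<exists>v. has_multiplier (Dy_symbol (1/2)) u v)}"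

definition X_norm :: "(plane \<Rightarrow> complex) \<Rightarrow> real" where
  "X_norm u = sqrt ((Lnorm 2 (dx u))\<^sup>2 + (Lnorm 2 (Dy (1/2) u))\<^sup>2 + (Lnorm 2 u)\<^sup>2)"

text \<open>Distance from a set, with value \<open>\<infinity>\<close> for the empty set.\<close>

definition X_infdist :: "(plane \<Rightarrow> complex) \<Rightarrow> (plane \<Rightarrow> complex) set \<Rightarrow> ennreal" where
  "X_infdist w S = (INF u\<in>S. ennreal (X_norm (\<lambda>z. w z - u z)))"

definition mass :: "(plane \<Rightarrow> complex) \<Rightarrow> real" where
  "mass u = 1/2 * (Lnorm 2 u)\<^sup>2"

text \<open>For \<open>1 < p < 7/3\<close> the space \<open>X\<close> embeds into \<open>L\<^bsup>p+1\<^esup>\<close>, so the last term is finite on \<open>X\<close>.\<close>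

definition energy :: "real \<Rightarrow> (plane \<Rightarrow> complex) \<Rightarrow> real" where
  "energy p u = 1/2 * ((Lnorm 2 (dx u))\<^sup>2 + (Lnorm 2 (Dy (1/2) u))\<^sup>2)
     - 1 / (p + 1) * Lnorm (p + 1) u powr (p + 1)"

definition min_energy :: "real \<Rightarrow> real \<Rightarrow> ereal" where
  "min_energy p \<mu> = Inf {ereal (energy p u) | u. u \<in> X \<and> mass u = \<mu>}"

definition ground_states :: "real \<Rightarrow> real \<Rightarrow> (plane \<Rightarrow> complex) set" where
  "ground_states p \<mu> = {u \<in> X. ereal (energy p u) = min_energy p \<mu> \<and> mass u = \<mu>}"

subsection \<open>The equation\<close>

definition nonlinearity :: "real \<Rightarrow> (plane \<Rightarrow> complex) \<Rightarrow> plane \<Rightarrow> complex" where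
  "nonlinearity p u = (\<lambda>z. complex_of_real (cmod (u z) powr (p - 1)) * u z)"

text \<open>
  \<open>\<psi> \<in> C(I, X)\<close> solves the equation in the dual space of \<open>X\<close> at every time \<open>t \<in> I\<close>: after
  pairing with any \<open>v \<in> X\<close>, the operators \<open>\<partial>\<^sub>x\<^sub>x\<close> and \<open>- |D\<^sub>y|\<close> become minus the forms
  \<open>\<langle>\<partial>\<^sub>x \<psi>, \<partial>\<^sub>x v\<rangle>\<close> and \<open>\<langle>|D\<^sub>y|\<^bsup>1/2\<^esup> \<psi>, |D\<^sub>y|\<^bsup>1/2\<^esup> v\<rangle>\<close>. The time derivative is one-sided
  at an endpoint of \<open>I\<close> that belongs to \<open>I\<close>.
\<close>

definition solution_on :: "real \<Rightarrow> real set \<Rightarrow> (real \<Rightarrow> plane \<Rightarrow> complex) \<Rightarrow> bool" where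
  "solution_on p I \<psi> \<longleftrightarrow>
     (\<forall>t\<in>I. \<psi> t \<in> X) \<and>
     (\<forall>t\<in>I. ((\<lambda>s. X_norm (\<lambda>z. \<psi> s z - \<psi> t z)) \<longlongrightarrow> 0) (at t within I)) \<and>
     (\<forall>v\<in>X. \<forall>t\<in>I. \<exists>d. ((\<lambda>s. L2_inner (\<psi> s) v) has_vector_derivative d) (at t within I) \<and>
        \<i> * d - L2_inner (dx (\<psi> t)) (dx v) - L2_inner (Dy (1/2) (\<psi> t)) (Dy (1/2) v)
          + L2_inner (nonlinearity p (\<psi> t)) v = 0)"

text \<open>
  Assumption (WP). The lifespan \<open>T\<close> is a function of the norm of the datum alone. Conservation
  on the maximal existence interval is expressed as conservation along every solution on an
  interval \<open>[0, S)\<close>; negative times are covered by the symmetry \<open>\<psi>(t) \<mapsto> cnj (\<psi>(-t))\<close>.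
\<close>

definition well_posed :: "real \<Rightarrow> bool" where
  "well_posed p \<longleftrightarrow>
     (\<exists>T :: real \<Rightarrow> real. (\<forall>r\<ge>0. T r > 0) \<and>
       (\<forall>\<psi>0\<in>X.
         (\<exists>\<psi>. solution_on p {0..<T (X_norm \<psi>0)} \<psi> \<and> ae_eq (\<psi> 0) \<psi>0) \<and>
         (\<forall>\<psi> \<phi>. solution_on p {0..<T (X_norm \<psi>0)} \<psi> \<and> ae_eq (\<psi> 0) \<psi>0 \<and>
                solution_on p {0..<T (X_norm \<psi>0)} \<phi> \<and> ae_eq (\<phi> 0) \<psi>0 \<longrightarrow>
            (\<forall>t\<in>{0..<T (X_norm \<psi>0)}. ae_eq (\<psi> t) (\<phi> t))))) \<and>
     (\<forall>\<psi>0\<in>X. \<forall>S>0. \<forall>\<psi>. solution_on p {0..<S} \<psi> \<and> ae_eq (\<psi> 0) \<psi>0 \<longrightarrow>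
        (\<forall>t\<in>{0..<S}. energy p (\<psi> t) = energy p \<psi>0 \<and> mass (\<psi> t) = mass \<psi>0))"

definition flow_stable :: "real \<Rightarrow> (plane \<Rightarrow> complex) set \<Rightarrow> bool" where
  "flow_stable p S \<longleftrightarrow>
     (\<forall>\<epsilon>::real. \<epsilon> > 0 \<longrightarrow> (\<exists>\<delta>::real. \<delta> > 0 \<and>
       (\<forall>\<psi>0\<in>X. X_infdist \<psi>0 S < ennreal \<delta> \<longrightarrow>
          (\<exists>\<psi>. solution_on p UNIV \<psi> \<and> ae_eq (\<psi> 0) \<psi>0) \<and>
          (\<forall>\<psi>. solution_on p UNIV \<psi> \<and> ae_eq (\<psi> 0) \<psi>0 \<longrightarrow>
             (SUP t. X_infdist (\<psi> t) S) < ennreal \<epsilon>))))"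

end

theory Submission
  imports Defs "HOL-Probability.Characteristic_Functions" "HOL-Library.Diagonal_Subsequence"
begin

text \<open>
  The energy is \<open>kin u / 2 - pot (p + 1) u / (p + 1)\<close>, where \<open>kin\<close> is the quadratic form of the
  symbol \<open>\<xi>\<^sup>2 + \<bar>\<eta>\<bar>\<close> and \<open>pot (p + 1)\<close> is the integral of \<open>\<bar>u\<bar>\<^bsup>p+1\<^esup>\<close>. The symbol is homogeneous of
  degree 2 under the parabolic dilations \<open>(x, y) \<mapsto> (l x, l\<^sup>2 y)\<close>. These multiply areas by \<open>l\<^sup>3\<close>, so
  the plane behaves like a space of dimension 3, and \<open>7/3 = 1 + 4/3\<close> is the mass-critical power.
  Below it the energy controls \<open>kin\<close> at fixed mass (\<open>coercivity\<close>), and ground states can be found by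
  minimization.

  Multipliers are defined through limits in the mean, so everything about \<open>kin\<close> rests on the
  Plancherel theorem and on surjectivity of the Fourier transform (\<open>Plancherel_integrable\<close>,
  \<open>FT_surj\<close>). Their main use is one estimate: translating \<open>u\<close> by \<open>h\<close> changes it in \<open>L\<^sup>2\<close> by at most
  \<open>(4 (h\<^sub>1\<^sup>2 + \<bar>h\<^sub>2\<bar>) kin u)\<^bsup>1/2\<^esup>\<close>. Hence \<open>u\<close> is close in \<open>L\<^sup>2\<close> to its averages over boxes of sides
  \<open>e\<close> and \<open>e\<^sup>2\<close> (\<open>box_avg_error\<close>), while the averages are bounded by \<open>e\<^bsup>-3/2\<^esup>\<close> times the \<open>L\<^sup>2\<close> norm.
  Where \<open>\<bar>u\<bar>\<close> is twice as large as its averages can be, it is at most twice the error of averaging.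
  Applied level by level this gives the Gagliardo-Nirenberg inequality for exponents between 2 and
  10/3 (\<open>Gagliardo_Nirenberg\<close>). Applied at a single scale it shows that a function whose potential
  energy is not small has an average that is not small (\<open>nonvanishing\<close>).

  Scaling gives \<open>I(\<mu>) = \<mu>\<^bsup>\<kappa>\<^esup> I(1)\<close> for the minimal energy, with \<open>\<kappa> > 1\<close> and \<open>I(1) < 0\<close>, and so
  \<open>I(a + b) < I(a) + I(b)\<close> (\<open>level_strict\<close>). Let \<open>u\<^sub>n\<close> be a minimizing sequence. By non-vanishing it
  has translates with a non-zero weak limit \<open>v\<close>, which is also a limit almost everywhere along a
  subsequence (\<open>X_compactness\<close>). Mass and kinetic energy then split into the parts of \<open>v\<close> and of the
  remainder because the cross terms vanish in the limit, and the potential energy splits by the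
  Brezis-Lieb lemma. Strict subadditivity leaves no mass for the remainder, so the convergence is
  strong and \<open>v\<close> is a ground state (\<open>minimizing_compact\<close>).

  It follows by contradiction that every function whose mass and energy are close to those of the
  ground states is close to a ground state (\<open>near_ground_states\<close>). Mass and energy are conserved,
  so stability follows once solutions are global. Conservation and coercivity bound the X-norm along
  a solution, but the lifespan in \<open>well_posed\<close> is an arbitrary positive function of the norm and may
  have infimum zero on a bounded set of norms. The scaling of the equation removes this obstacle:
  every datum can be dilated to norm 1, and the dilation factor is bounded below when the norm is
  bounded. So data of bounded norm live for a common time (\<open>uniform_lifespan\<close>), and solutions
  are continued in steps of fixed length.
\<close>

section \<open>Square-integrable functions on the plane\<close>

definition L2sq :: "(plane \<Rightarrow> complex) \<Rightarrow> real" where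
  "L2sq u = (LINT z|lborel. (cmod (u z))\<^sup>2)"

definition L2norm :: "(plane \<Rightarrow> complex) \<Rightarrow> real" where
  "L2norm u = sqrt (L2sq u)"

lemma borel_measurable_cnj [measurable (raw)]:
  "f \<in> borel_measurable M \<Longrightarrow> (\<lambda>x. cnj (f x)) \<in> borel_measurable M"
  using measurable_compose[of f M borel cnj borel]
  by (simp add: borel_measurable_continuous_onI continuous_on_cnj continuous_on_id)

lemma borel_measurable_indicator_cball [measurable]:
  "(\<lambda>z. indicator (cball (0::plane) R) z :: complex) \<in> borel_measurable borel"
  by (intro borel_measurable_indicator) simp

lemma L2_measurable [measurable_dest]: "u \<in> L2 \<Longrightarrow> u \<in> borel_measurable borel"
  by (simp add: L2_def)

lemma L2_iff: "u \<in> L2 \<longleftrightarrow> u \<in> borel_measurable borel \<and> integrable lborel (\<lambda>z. (cmod (u z))\<^sup>2)"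
  by (simp add: L2_def)

lemma L2_integrable: "u \<in> L2 \<Longrightarrow> integrable lborel (\<lambda>z. (cmod (u z))\<^sup>2)"
  by (simp add: L2_def)

lemma L2sq_nonneg [simp]: "L2sq u \<ge> 0"
  by (simp add: L2sq_def)

lemma L2norm_nonneg [simp]: "L2norm u \<ge> 0"
  by (simp add: L2norm_def)

lemma L2norm_power2 [simp]: "(L2norm u)\<^sup>2 = L2sq u"
  by (simp add: L2norm_def)

lemma L2sq_cong_AE:
  assumes "AE z in lborel. u z = v z" "u \<in> borel_measurable borel" "v \<in> borel_measurable borel"
  shows "L2sq u = L2sq v"
  unfolding L2sq_def using assms by (intro integral_cong_AE) auto

lemma nn_integral_L2sq: "u \<in> L2 \<Longrightarrow> (\<integral>\<^sup>+ z. ennreal ((cmod (u z))\<^sup>2) \<partial>lborel) = ennreal (L2sq u)"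
  unfolding L2sq_def by (intro nn_integral_eq_integral) (auto simp: L2_iff)

lemma L2_if_nn_integral:
  assumes [measurable]: "u \<in> borel_measurable borel"
    and "(\<integral>\<^sup>+ z. ennreal ((cmod (u z))\<^sup>2) \<partial>lborel) \<le> ennreal c" "0 \<le> c"
  shows "u \<in> L2" "L2sq u \<le> c"
proof -
  show L: "u \<in> L2"
    unfolding L2_iff integrable_iff_bounded using assms(2)
    by (auto intro: le_less_trans[OF _ ennreal_less_top])
  show "L2sq u \<le> c"
    using assms(2,3) nn_integral_L2sq[OF L] by simp
qed

lemma L2_bound:
  assumes "u \<in> L2" and [measurable]: "v \<in> borel_measurable borel"
    and "\<And>z. cmod (v z) \<le> B * cmod (u z)"
  shows "v \<in> L2" "L2sq v \<le> B\<^sup>2 * L2sq u"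
proof -
  have le: "(cmod (v z))\<^sup>2 \<le> B\<^sup>2 * (cmod (u z))\<^sup>2" for z
    using power_mono[OF assms(3)[of z], of 2] by (simp add: power_mult_distrib)
  have i: "integrable lborel (\<lambda>z. B\<^sup>2 * (cmod (u z))\<^sup>2)"
    using assms(1) by (simp add: L2_iff)
  have "integrable lborel (\<lambda>z. (cmod (v z))\<^sup>2)"
    by (rule Bochner_Integration.integrable_bound[OF i]) (use le in auto)
  then show "v \<in> L2" by (simp add: L2_iff)
  then have "L2sq v \<le> (LINT z|lborel. B\<^sup>2 * (cmod (u z))\<^sup>2)"
    unfolding L2sq_def by (intro integral_mono i le) (simp add: L2_iff)
  then show "L2sq v \<le> B\<^sup>2 * L2sq u" by (simp add: L2sq_def)
qed

lemma L2_scale: "u \<in> L2 \<Longrightarrow> (\<lambda>z. c * u z) \<in> L2"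
  by (rule L2_bound(1)[where B="cmod c"]) (auto simp: norm_mult)

lemma L2sq_scale: "L2sq (\<lambda>z. c * u z) = (cmod c)\<^sup>2 * L2sq u"
  by (simp add: L2sq_def norm_mult power_mult_distrib)

lemma L2_cnj: "u \<in> L2 \<Longrightarrow> (\<lambda>z. cnj (u z)) \<in> L2"
  by (rule L2_bound(1)[where B=1]) auto

lemma L2sq_cnj: "L2sq (\<lambda>z. cnj (u z)) = L2sq u"
  by (simp add: L2sq_def)

lemma L2_indicator: "u \<in> L2 \<Longrightarrow> S \<in> sets borel \<Longrightarrow> (\<lambda>z. indicator S z * u z) \<in> L2"
  by (rule L2_bound(1)[where B=1]) (auto simp: indicator_def)

lemma L2_add:
  assumes "u \<in> L2" "v \<in> L2"
  shows "(\<lambda>z. u z + v z) \<in> L2"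
proof -
  note [measurable] = L2_measurable[OF assms(1)] L2_measurable[OF assms(2)]
  have le: "(cmod (u z + v z))\<^sup>2 \<le> 2 * (cmod (u z))\<^sup>2 + 2 * (cmod (v z))\<^sup>2" for z
  proof -
    have "(cmod (u z + v z))\<^sup>2 \<le> (cmod (u z) + cmod (v z))\<^sup>2"
      by (intro power_mono norm_triangle_ineq) auto
    also have "\<dots> \<le> 2 * (cmod (u z))\<^sup>2 + 2 * (cmod (v z))\<^sup>2"
      using sum_squares_bound[of "cmod (u z)" "cmod (v z)"] by (simp add: power2_sum)
    finally show ?thesis .
  qed
  have i: "integrable lborel (\<lambda>z. 2 * (cmod (u z))\<^sup>2 + 2 * (cmod (v z))\<^sup>2)"
    using assms by (simp add: L2_iff)
  have "integrable lborel (\<lambda>z. (cmod (u z + v z))\<^sup>2)"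
  proof (rule Bochner_Integration.integrable_bound[OF i])
    show "AE z in lborel. norm ((cmod (u z + v z))\<^sup>2) \<le> norm (2 * (cmod (u z))\<^sup>2 + 2 * (cmod (v z))\<^sup>2)"
      using le by (intro AE_I2) (simp add: abs_of_nonneg)
  qed simp
  then show ?thesis by (simp add: L2_iff)
qed

lemma L2_diff: "u \<in> L2 \<Longrightarrow> v \<in> L2 \<Longrightarrow> (\<lambda>z. u z - v z) \<in> L2"
  using L2_add[of u "\<lambda>z. - v z"] L2_scale[of v "-1"] by simp

lemma L2_prod_integrable:
  assumes "u \<in> L2" "v \<in> L2"
  shows "integrable lborel (\<lambda>z. cmod (u z) * cmod (v z))"
    and "integrable lborel (\<lambda>z. u z * v z)"
    and "integrable lborel (\<lambda>z. u z * cnj (v z))"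
proof -
  note [measurable] = L2_measurable[OF assms(1)] L2_measurable[OF assms(2)]
  have le: "cmod (u z) * cmod (v z) \<le> (cmod (u z))\<^sup>2 + (cmod (v z))\<^sup>2" for z
    using sum_squares_bound[of "cmod (u z)" "cmod (v z)"]
      mult_nonneg_nonneg[OF norm_ge_zero[of "u z"] norm_ge_zero[of "v z"]] by linarith
  have i: "integrable lborel (\<lambda>z. (cmod (u z))\<^sup>2 + (cmod (v z))\<^sup>2)"
    using assms by (simp add: L2_iff)
  show "integrable lborel (\<lambda>z. cmod (u z) * cmod (v z))"
    "integrable lborel (\<lambda>z. u z * v z)" "integrable lborel (\<lambda>z. u z * cnj (v z))"
    by (rule Bochner_Integration.integrable_bound[OF i], simp, simp add: le norm_mult abs_of_nonneg)+
qed

lemma L2_Cauchy_Schwarz: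
  assumes "u \<in> L2" "v \<in> L2"
  shows "(LINT z|lborel. cmod (u z) * cmod (v z)) \<le> L2norm u * L2norm v"
proof -
  note [measurable] = L2_measurable[OF assms(1)] L2_measurable[OF assms(2)]
  let ?I = "LINT z|lborel. cmod (u z) * cmod (v z)"
  have "(\<integral>\<^sup>+z. ennreal (cmod (u z)) * ennreal (cmod (v z)) \<partial>lborel) = ennreal ?I"
    by (subst nn_integral_eq_integral[symmetric])
       (auto simp: ennreal_mult L2_prod_integrable[OF assms])
  then have "(ennreal ?I)\<^sup>2 \<le> ennreal (L2sq u) * ennreal (L2sq v)"
    using Cauchy_Schwarz_nn_integral[of "\<lambda>z. ennreal (cmod (u z))" lborel "\<lambda>z. ennreal (cmod (v z))"]
    by (simp add: nn_integral_L2sq assms ennreal_power)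
  then have "?I\<^sup>2 \<le> L2sq u * L2sq v"
    by (simp add: ennreal_power ennreal_mult[symmetric])
  then have "?I \<le> sqrt (L2sq u * L2sq v)"
    by (rule real_le_rsqrt)
  then show ?thesis by (simp add: L2norm_def real_sqrt_mult)
qed

lemma L2_inner_bound:
  assumes "u \<in> L2" "v \<in> L2"
  shows "cmod (L2_inner u v) \<le> L2norm u * L2norm v"
proof -
  have "cmod (L2_inner u v) \<le> (LINT z|lborel. cmod (u z * cnj (v z)))"
    unfolding L2_inner_def by (rule integral_norm_bound)
  then show ?thesis using L2_Cauchy_Schwarz[OF assms] by (simp add: norm_mult)
qed

lemma L2_inner_diff_left: "u \<in> L2 \<Longrightarrow> v \<in> L2 \<Longrightarrow> w \<in> L2 \<Longrightarrow>
    L2_inner (\<lambda>z. u z - v z) w = L2_inner u w - L2_inner v w"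
  unfolding L2_inner_def using L2_prod_integrable(3)[of u w] L2_prod_integrable(3)[of v w]
  by (simp add: left_diff_distrib)

lemma L2_inner_diff_right: "u \<in> L2 \<Longrightarrow> v \<in> L2 \<Longrightarrow> w \<in> L2 \<Longrightarrow>
    L2_inner w (\<lambda>z. u z - v z) = L2_inner w u - L2_inner w v"
  unfolding L2_inner_def using L2_prod_integrable(3)[of w u] L2_prod_integrable(3)[of w v]
  by (simp add: right_diff_distrib)

lemma L2_inner_scale_left: "L2_inner (\<lambda>z. c * u z) v = c * L2_inner u v"
  by (simp add: L2_inner_def mult.assoc)

lemma L2_inner_scale_right: "L2_inner u (\<lambda>z. c * v z) = cnj c * L2_inner u v"
  by (simp add: L2_inner_def mult.left_commute)

lemma L2_inner_cnj: "cnj (L2_inner u v) = L2_inner v u"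
proof -
  have "cnj (L2_inner u v) = (LINT z|lborel. cnj (u z * cnj (v z)))"
    unfolding L2_inner_def by (rule Bochner_Integration.integral_cnj[symmetric])
  then show ?thesis by (simp add: L2_inner_def mult.commute)
qed

lemma L2_inner_self: "L2_inner u u = complex_of_real (L2sq u)"
proof -
  have "L2_inner u u = (LINT z|lborel. complex_of_real ((cmod (u z))\<^sup>2))"
    unfolding L2_inner_def by (simp only: complex_norm_square)
  also have "\<dots> = complex_of_real (L2sq u)"
    unfolding L2sq_def by (rule integral_complex_of_real)
  finally show ?thesis .
qed

lemma L2_inner_cong_AE:
  assumes "AE z in lborel. u z = u' z" "AE z in lborel. v z = v' z"
    "u \<in> borel_measurable borel" "u' \<in> borel_measurable borel"
    "v \<in> borel_measurable borel" "v' \<in> borel_measurable borel"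
  shows "L2_inner u v = L2_inner u' v'"
  unfolding L2_inner_def using assms by (intro integral_cong_AE) auto

lemma L2sq_add:
  assumes "u \<in> L2" "v \<in> L2"
  shows "L2sq (\<lambda>z. u z + v z) = L2sq u + L2sq v + 2 * Re (L2_inner u v)"
proof -
  have "(cmod (u z + v z))\<^sup>2 = (cmod (u z))\<^sup>2 + (cmod (v z))\<^sup>2 + 2 * Re (u z * cnj (v z))" for z
    unfolding cmod_power2 by (simp add: power2_eq_square algebra_simps)
  then have "L2sq (\<lambda>z. u z + v z) =
      (LINT z|lborel. (cmod (u z))\<^sup>2 + (cmod (v z))\<^sup>2 + 2 * Re (u z * cnj (v z)))"
    by (simp only: L2sq_def)
  also have "\<dots> = L2sq u + L2sq v + 2 * (LINT z|lborel. Re (u z * cnj (v z)))"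
    unfolding L2sq_def using L2_integrable[OF assms(1)] L2_integrable[OF assms(2)]
      integrable_Re[OF L2_prod_integrable(3)[OF assms]]
    by (simp del: times_complex.sel complex_cnj)
  also have "(LINT z|lborel. Re (u z * cnj (v z))) = Re (L2_inner u v)"
    unfolding L2_inner_def by (rule integral_Re[OF L2_prod_integrable(3)[OF assms]])
  finally show ?thesis .
qed

lemma L2sq_diff:
  assumes "u \<in> L2" "v \<in> L2"
  shows "L2sq (\<lambda>z. u z - v z) = L2sq u + L2sq v - 2 * Re (L2_inner u v)"
  using L2sq_add[OF assms(1) L2_scale[OF assms(2), of "-1"]] L2sq_scale[of "-1" v]
    L2_inner_scale_right[of u "-1" v] by simp

lemma L2norm_triangle:
  assumes "u \<in> L2" "v \<in> L2"
  shows "L2norm (\<lambda>z. u z + v z) \<le> L2norm u + L2norm v"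
proof -
  have "Re (L2_inner u v) \<le> L2norm u * L2norm v"
    using L2_inner_bound[OF assms] complex_Re_le_cmod[of "L2_inner u v"] by linarith
  then have "L2sq (\<lambda>z. u z + v z) \<le> (L2norm u + L2norm v)\<^sup>2"
    unfolding L2sq_add[OF assms] power2_sum by simp
  then show ?thesis
    by (metis L2norm_def L2norm_nonneg add_nonneg_nonneg real_le_lsqrt)
qed

lemma L2norm_diff_commute: "L2norm (\<lambda>z. u z - v z) = L2norm (\<lambda>z. v z - u z)"
  by (simp add: L2norm_def L2sq_def norm_minus_commute)

lemma L2norm_triangle_diff:
  assumes "u \<in> L2" "v \<in> L2" "w \<in> L2"
  shows "L2norm (\<lambda>z. u z - w z) \<le> L2norm (\<lambda>z. u z - v z) + L2norm (\<lambda>z. v z - w z)"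
  using L2norm_triangle[OF L2_diff[OF assms(1,2)] L2_diff[OF assms(2,3)]] by simp

lemma L2norm_le_add_diff:
  assumes "u \<in> L2" "v \<in> L2"
  shows "L2norm u \<le> L2norm v + L2norm (\<lambda>z. u z - v z)"
  using L2norm_triangle[OF assms(2) L2_diff[OF assms]] by simp

lemma L2norm_abs_diff:
  assumes "u \<in> L2" "v \<in> L2"
  shows "\<bar>L2norm u - L2norm v\<bar> \<le> L2norm (\<lambda>z. u z - v z)"
  using L2norm_le_add_diff[OF assms] L2norm_le_add_diff[OF assms(2,1)] L2norm_diff_commute[of u v]
  by linarith

lemma L2sq_eq_0_iff: "u \<in> L2 \<Longrightarrow> L2sq u = 0 \<longleftrightarrow> (AE z in lborel. u z = 0)"
  unfolding L2sq_def by (subst integral_nonneg_eq_0_iff_AE) (auto simp: L2_iff)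

lemma L2norm_tendsto_0_iff: "((\<lambda>n. L2norm (f n)) \<longlongrightarrow> 0) F \<longleftrightarrow> ((\<lambda>n. L2sq (f n)) \<longlongrightarrow> 0) F"
proof
  assume "((\<lambda>n. L2norm (f n)) \<longlongrightarrow> 0) F"
  from tendsto_power[OF this, of 2] show "((\<lambda>n. L2sq (f n)) \<longlongrightarrow> 0) F" by simp
next
  assume "((\<lambda>n. L2sq (f n)) \<longlongrightarrow> 0) F"
  from tendsto_real_sqrt[OF this] show "((\<lambda>n. L2norm (f n)) \<longlongrightarrow> 0) F" by (simp add: L2norm_def)
qed

lemma L2norm_tendsto:
  assumes "\<And>n. f n \<in> L2" "g \<in> L2" "((\<lambda>n. L2sq (\<lambda>z. f n z - g z)) \<longlongrightarrow> 0) F"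
  shows "((\<lambda>n. L2norm (f n)) \<longlongrightarrow> L2norm g) F" "((\<lambda>n. L2sq (f n)) \<longlongrightarrow> L2sq g) F"
proof -
  have "((\<lambda>n. L2norm (\<lambda>z. f n z - g z)) \<longlongrightarrow> 0) F"
    using assms(3) by (simp add: L2norm_tendsto_0_iff)
  then have "((\<lambda>n. L2norm (f n) - L2norm g) \<longlongrightarrow> 0) F"
    by (rule Lim_null_comparison[rotated]) (use L2norm_abs_diff[OF assms(1,2)] in auto)
  then show *: "((\<lambda>n. L2norm (f n)) \<longlongrightarrow> L2norm g) F"
    by (simp add: LIM_zero_iff)
  from tendsto_power[OF *, of 2] show "((\<lambda>n. L2sq (f n)) \<longlongrightarrow> L2sq g) F" by simp
qed

lemma L2_inner_tendsto:
  assumes "\<And>n. f n \<in> L2" "g \<in> L2" "h \<in> L2" "((\<lambda>n. L2sq (\<lambda>z. f n z - g z)) \<longlongrightarrow> 0) F"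
  shows "((\<lambda>n. L2_inner (f n) h) \<longlongrightarrow> L2_inner g h) F"
proof -
  have "((\<lambda>n. L2norm (\<lambda>z. f n z - g z) * L2norm h) \<longlongrightarrow> 0 * L2norm h) F"
    using assms(4) by (intro tendsto_intros) (simp add: L2norm_tendsto_0_iff)
  then have l: "((\<lambda>n. L2norm (\<lambda>z. f n z - g z) * L2norm h) \<longlongrightarrow> 0) F" by simp
  have "cmod (L2_inner (f n) h - L2_inner g h) \<le> L2norm (\<lambda>z. f n z - g z) * L2norm h" for n
    using L2_inner_bound[OF L2_diff[OF assms(1,2)] assms(3)] by (simp only: L2_inner_diff_left[OF assms(1-3)])
  then have "((\<lambda>n. L2_inner (f n) h - L2_inner g h) \<longlongrightarrow> 0) F"
    by (intro Lim_null_comparison[OF _ l] always_eventually allI)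
  then show ?thesis by (simp add: LIM_zero_iff)
qed

text \<open>
  Besides passing to limits, this is used with constant sequences, to transfer square integrability
  between functions that agree almost everywhere.
\<close>

lemma L2_Fatou:
  assumes "\<And>n::nat. f n \<in> L2" and "\<And>n. L2sq (f n) \<le> c"
    and [measurable]: "g \<in> borel_measurable borel"
    and lim: "AE z in lborel. (\<lambda>n. f n z) \<longlonglongrightarrow> g z"
  shows "g \<in> L2" "L2sq g \<le> c"
proof -
  note [measurable] = L2_measurable[OF assms(1)]
  have c: "0 \<le> c" using assms(2)[of 0] L2sq_nonneg[of "f 0"] by linarith
  have "AE z in lborel. ennreal ((cmod (g z))\<^sup>2) = liminf (\<lambda>n. ennreal ((cmod (f n z))\<^sup>2))"
    using lim
  proof eventually_elim
    case (elim z)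
    then have "(\<lambda>n. ennreal ((cmod (f n z))\<^sup>2)) \<longlonglongrightarrow> ennreal ((cmod (g z))\<^sup>2)"
      by (intro tendsto_intros tendsto_ennrealI)
    then show ?case by (metis lim_imp_Liminf trivial_limit_sequentially)
  qed
  then have "(\<integral>\<^sup>+z. ennreal ((cmod (g z))\<^sup>2) \<partial>lborel) = (\<integral>\<^sup>+z. liminf (\<lambda>n. ennreal ((cmod (f n z))\<^sup>2)) \<partial>lborel)"
    by (rule nn_integral_cong_AE)
  also have "\<dots> \<le> liminf (\<lambda>n. \<integral>\<^sup>+z. ennreal ((cmod (f n z))\<^sup>2) \<partial>lborel)"
    by (intro nn_integral_liminf) auto
  also have "\<dots> \<le> liminf (\<lambda>n. ennreal c)"
    by (intro Liminf_mono always_eventually allI)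
       (use assms(2) c in \<open>auto simp: nn_integral_L2sq[OF assms(1)] intro!: ennreal_leI\<close>)
  also have "\<dots> = ennreal c" by (simp add: Liminf_const)
  finally show "g \<in> L2" "L2sq g \<le> c"
    using L2_if_nn_integral[of g c] c by auto
qed

lemma L2_dominated:
  assumes f: "\<And>n. f n \<in> borel_measurable borel" and w: "w \<in> L2"
    and g [measurable]: "g \<in> borel_measurable borel"
    and le: "\<And>n z. cmod (f n z) \<le> cmod (w z)"
    and lim: "AE z in lborel. (\<lambda>n::nat. f n z) \<longlonglongrightarrow> g z"
  shows "g \<in> L2" "(\<lambda>n. L2sq (\<lambda>z. f n z - g z)) \<longlonglongrightarrow> 0"
proof -
  note [measurable] = f
  have fL: "f n \<in> L2" for n
    by (rule L2_bound(1)[OF w, where B=1]) (use le in auto)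
  have fb: "L2sq (f n) \<le> L2sq w" for n
    using L2_bound(2)[OF w, where B=1, of "f n"] le by auto
  show gL: "g \<in> L2" by (rule L2_Fatou(1)[OF fL fb g lim])
  have gle: "AE z in lborel. cmod (g z) \<le> cmod (w z)"
    using lim
  proof eventually_elim
    case (elim z)
    show ?case by (rule Lim_bounded[OF tendsto_norm[OF elim], of 0]) (simp add: le)
  qed
  have "(\<lambda>n. LINT z|lborel. (cmod (f n z - g z))\<^sup>2) \<longlonglongrightarrow> (LINT z|(lborel::plane measure). 0)"
  proof (rule integral_dominated_convergence[where w="\<lambda>z. 4 * (cmod (w z))\<^sup>2"])
    show "integrable lborel (\<lambda>z. 4 * (cmod (w z))\<^sup>2)" using w by (simp add: L2_iff)
    show "AE z in lborel. (\<lambda>n. (cmod (f n z - g z))\<^sup>2) \<longlonglongrightarrow> 0"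
      using lim
    proof eventually_elim
      case (elim z)
      then have "(\<lambda>n. (cmod (f n z - g z))\<^sup>2) \<longlonglongrightarrow> (cmod (g z - g z))\<^sup>2"
        by (intro tendsto_intros)
      then show ?case by simp
    qed
    show "AE z in lborel. norm ((cmod (f n z - g z))\<^sup>2) \<le> 4 * (cmod (w z))\<^sup>2" for n
      using gle
    proof eventually_elim
      case (elim z)
      have "cmod (f n z - g z) \<le> 2 * cmod (w z)"
        using norm_triangle_ineq4[of "f n z" "g z"] le[of n z] elim by linarith
      from power_mono[OF this, of 2] show ?case by (simp add: power_mult_distrib)
    qed
  qed auto
  then show "(\<lambda>n. L2sq (\<lambda>z. f n z - g z)) \<longlonglongrightarrow> 0" by (simp add: L2sq_def)
qed

text \<open>
  Along a subsequence the increments have squared norm at most \<open>4\<^bsup>-k\<^esup>\<close>. With the weights \<open>2\<^sup>k\<close> the sum of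
  their squares still has a finite integral, so almost everywhere the increments are \<open>O(2\<^bsup>-k/2\<^esup>)\<close> and
  the subsequence converges. Fatou's lemma turns this into convergence of the whole sequence in \<open>L\<^sup>2\<close>.
\<close>

theorem Riesz_Fischer:
  assumes f: "\<And>n::nat. f n \<in> L2"
    and Cau: "\<And>e. e > 0 \<Longrightarrow> \<exists>N. \<forall>m\<ge>N. \<forall>n\<ge>N. L2sq (\<lambda>z. f m z - f n z) \<le> e"
  obtains g r where "g \<in> L2" "strict_mono r" "AE z in lborel. (\<lambda>n. f (r n) z) \<longlonglongrightarrow> g z"
    "(\<lambda>n. L2sq (\<lambda>z. f n z - g z)) \<longlonglongrightarrow> 0"
proof -
  note [measurable] = L2_measurable[OF f]
  have "\<exists>N. \<forall>k. \<forall>m\<ge>N k. \<forall>n\<ge>N k. L2sq (\<lambda>z. f m z - f n z) \<le> (1/4)^k"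
    by (intro choice allI Cau) simp
  then obtain N where N: "\<And>k m n. m \<ge> N k \<Longrightarrow> n \<ge> N k \<Longrightarrow> L2sq (\<lambda>z. f m z - f n z) \<le> (1/4)^k"
    by blast
  define r where "r k = (\<Sum>i\<le>k. N i) + k" for k
  have rm: "strict_mono r" by (auto simp: strict_mono_Suc_iff r_def)
  have rN: "r k \<ge> N k" for k
    using sum_nonneg_leq_bound[of "{..k}" N] member_le_sum[of k "{..k}" N] by (simp add: r_def trans_le_add1)
  have rN': "r (Suc k) \<ge> N k" for k
    using rN[of k] strict_mono_less_eq[OF rm, of k "Suc k"] by simp
  define d where "d k z = f (r (Suc k)) z - f (r k) z" for k z
  have [measurable]: "d k \<in> borel_measurable borel" for k unfolding d_def by simp
  have dL: "d k \<in> L2" for k unfolding d_def by (intro L2_diff f)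
  have dk: "L2sq (d k) \<le> (1/4)^k" for k unfolding d_def by (intro N rN rN')
  have "(\<integral>\<^sup>+z. (\<Sum>k. ennreal (2^k * (cmod (d k z))\<^sup>2)) \<partial>lborel) = (\<Sum>k. \<integral>\<^sup>+z. ennreal (2^k * (cmod (d k z))\<^sup>2) \<partial>lborel)"
    by (intro nn_integral_suminf) simp
  also have "\<dots> \<le> (\<Sum>k. ennreal ((1/2)^k))"
  proof (intro suminf_le allI)
    fix k
    have "(\<integral>\<^sup>+z. ennreal (2^k * (cmod (d k z))\<^sup>2) \<partial>lborel) = ennreal (2^k) * ennreal (L2sq (d k))"
      by (simp add: ennreal_mult' nn_integral_cmult nn_integral_L2sq[OF dL])
    also have "\<dots> \<le> ennreal (2^k) * ennreal ((1/4)^k)"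
      by (intro mult_left_mono ennreal_leI dk) auto
    also have "\<dots> = ennreal ((1/2)^k)"
      by (simp add: ennreal_mult'[symmetric] power_mult_distrib[symmetric])
    finally show "(\<integral>\<^sup>+z. ennreal (2^k * (cmod (d k z))\<^sup>2) \<partial>lborel) \<le> ennreal ((1/2)^k)" .
  qed auto
  also have "\<dots> < \<infinity>"
    by (subst suminf_ennreal2) (auto simp: ennreal_less_top)
  finally have fin: "(\<integral>\<^sup>+z. (\<Sum>k. ennreal (2^k * (cmod (d k z))\<^sup>2)) \<partial>lborel) \<noteq> \<infinity>" by simp
  have "AE z in lborel. (\<Sum>k. ennreal (2^k * (cmod (d k z))\<^sup>2)) \<noteq> \<infinity>"
    by (rule nn_integral_PInf_AE[OF _ fin]) simp
  then have conv: "AE z in lborel. convergent (\<lambda>k. f (r k) z)"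
  proof eventually_elim
    case (elim z)
    define b where "b k = ennreal (2^k * (cmod (d k z))\<^sup>2)" for k
    have "suminf b \<noteq> \<infinity>" using elim unfolding b_def .
    then obtain c where c: "c \<ge> 0" "suminf b = ennreal c"
      by (cases "suminf b" rule: ennreal_cases) auto
    have "2^k * (cmod (d k z))\<^sup>2 \<le> c" for k
    proof -
      have "sum b {k} \<le> suminf b" by (rule sum_le_suminf) auto
      then have "ennreal (2^k * (cmod (d k z))\<^sup>2) \<le> ennreal c"
        by (simp add: c b_def)
      then show ?thesis using c(1) by simp
    qed
    then have "(cmod (d k z))\<^sup>2 \<le> c * (1/2)^k" for k
      by (simp add: field_simps power_divide)
    then have "cmod (d k z) \<le> sqrt (c * (1/2)^k)" for k
      by (rule real_le_rsqrt)
    then have b: "cmod (d k z) \<le> sqrt c * (sqrt (1/2))^k" for k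
      by (simp add: real_sqrt_mult real_sqrt_power)
    have "summable (\<lambda>k. sqrt c * (sqrt (1/2))^k)"
      by (intro summable_mult summable_geometric) (simp add: real_sqrt_divide)
    then have "summable (\<lambda>k. d k z)"
      by (rule summable_comparison_test[rotated]) (use b in auto)
    then have "convergent (\<lambda>n. f (r 0) z + (\<Sum>k<n. d k z))"
      by (intro convergent_add convergent_const) (simp add: summable_iff_convergent)
    moreover have "f (r 0) z + (\<Sum>k<n. d k z) = f (r n) z" for n
      unfolding d_def using sum_lessThan_telescope[of "\<lambda>k. f (r k) z" n] by simp
    ultimately show ?case by simp
  qed
  define g where "g z = lim (\<lambda>k. f (r k) z)" for z
  have g [measurable]: "g \<in> borel_measurable borel" unfolding g_def by measurable
  have lim: "AE z in lborel. (\<lambda>k. f (r k) z) \<longlonglongrightarrow> g z"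
    using conv by eventually_elim (simp add: g_def convergent_LIMSEQ_iff)
  have tail: "(\<lambda>z. f m z - g z) \<in> L2 \<and> L2sq (\<lambda>z. f m z - g z) \<le> e"
    if "\<And>n. n \<ge> M \<Longrightarrow> L2sq (\<lambda>z. f m z - f n z) \<le> e" for m M e
  proof -
    have l: "AE z in lborel. (\<lambda>k. f m z - f (r (k + M)) z) \<longlonglongrightarrow> f m z - g z"
      using lim by eventually_elim (intro tendsto_intros LIMSEQ_ignore_initial_segment)
    have b: "L2sq (\<lambda>z. f m z - f (r (k + M)) z) \<le> e" for k
      by (rule that) (use seq_suble[OF rm, of "k + M"] in linarith)
    show ?thesis
      using L2_Fatou[OF L2_diff[OF f f] b _ l] by simp
  qed
  obtain N1 where N1: "\<And>m n. m \<ge> N1 \<Longrightarrow> n \<ge> N1 \<Longrightarrow> L2sq (\<lambda>z. f m z - f n z) \<le> 1"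
    using Cau[of 1] by auto
  have "(\<lambda>z. f N1 z - g z) \<in> L2" using tail[of N1 N1 1] N1 by blast
  from L2_diff[OF f[of N1] this] have gL: "g \<in> L2" by simp
  have "(\<lambda>n. L2sq (\<lambda>z. f n z - g z)) \<longlonglongrightarrow> 0"
  proof (rule LIMSEQ_I)
    fix e :: real assume "e > 0"
    then obtain K where "\<forall>m\<ge>K. \<forall>n\<ge>K. L2sq (\<lambda>z. f m z - f n z) \<le> e/2" using Cau[of "e/2"] by auto
    then have "L2sq (\<lambda>z. f m z - g z) \<le> e/2" if "m \<ge> K" for m
      using tail[of K m "e/2"] that by blast
    then have "norm (L2sq (\<lambda>z. f m z - g z) - 0) < e" if "m \<ge> K" for m
      using \<open>e > 0\<close> that by (fastforce intro: le_less_trans)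
    then show "\<exists>no. \<forall>n\<ge>no. norm (L2sq (\<lambda>z. f n z - g z) - 0) < e" by blast
  qed
  then show ?thesis using that gL rm lim by blast
qed

lemma L2_truncate_tendsto:
  assumes u: "u \<in> L2"
  shows "((\<lambda>R. L2sq (\<lambda>z. indicator (cball 0 R) z * u z - u z)) \<longlongrightarrow> 0) at_top"
proof -
  note [measurable] = L2_measurable[OF u]
  have "((\<lambda>R. LINT z|lborel. (cmod (indicator (cball 0 R) z * u z - u z))\<^sup>2) \<longlongrightarrow> (LINT z|(lborel::plane measure). 0)) at_top"
  proof (rule integral_dominated_convergence_at_top[where w="\<lambda>z. (cmod (u z))\<^sup>2"])
    show "integrable lborel (\<lambda>z. (cmod (u z))\<^sup>2)" using u by (simp add: L2_iff)
    show "AE z in lborel. ((\<lambda>R. (cmod (indicator (cball 0 R) z * u z - u z))\<^sup>2) \<longlongrightarrow> 0) at_top"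
    proof (intro AE_I2 tendsto_eventually)
      fix z :: plane
      show "\<forall>\<^sub>F R in at_top. (cmod (indicator (cball 0 R) z * u z - u z))\<^sup>2 = 0"
        using eventually_ge_at_top[of "norm z"] by eventually_elim simp
    qed
    show "\<forall>\<^sub>F R in at_top. AE z in lborel. norm ((cmod (indicator (cball 0 R) z * u z - u z))\<^sup>2) \<le> (cmod (u z))\<^sup>2"
      by (intro always_eventually allI AE_I2) (auto simp: indicator_def)
  qed auto
  then show ?thesis by (simp add: L2sq_def)
qed

lemma L2_truncate_tendsto_nat:
  assumes u: "u \<in> L2"
  shows "(\<lambda>n. L2sq (\<lambda>z. indicator (cball 0 (real n)) z * u z - u z)) \<longlonglongrightarrow> 0"
  by (rule filterlim_compose[OF L2_truncate_tendsto[OF u] filterlim_real_sequentially])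

lemma L2_truncate_integrable:
  assumes u: "u \<in> L2"
  shows "integrable lborel (\<lambda>z. indicator (cball 0 R) z * u z)"
proof -
  have "(cmod (indicator (cball 0 R) z))\<^sup>2 = indicator (cball 0 R) z" for z :: plane
    by (simp split: split_indicator)
  moreover have "integrable lborel (indicator (cball (0::plane) R) :: plane \<Rightarrow> real)"
    by (intro integrable_real_indicator emeasure_bounded_finite) auto
  ultimately have "(\<lambda>z. indicator (cball (0::plane) R) z :: complex) \<in> L2"
    by (simp add: L2_iff)
  from L2_prod_integrable(2)[OF this u] show ?thesis .
qed

section \<open>Diagonal affine changes of variables\<close>

text \<open>
  One family covers the translations (\<open>\<alpha> = \<beta> = 1\<close>), the parabolic dilations (\<open>\<beta> = \<alpha>\<^sup>2\<close>, \<open>h = 0\<close>) and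
  the reflection at the origin (\<open>\<alpha> = \<beta> = -1\<close>, \<open>h = 0\<close>).
\<close>

definition aff :: "real \<Rightarrow> real \<Rightarrow> plane \<Rightarrow> plane \<Rightarrow> plane" where
  "aff \<alpha> \<beta> h z = (\<alpha> * fst z + fst h, \<beta> * snd z + snd h)"

lemma aff_measurable [measurable]: "aff \<alpha> \<beta> h \<in> borel_measurable borel"
  unfolding aff_def by (intro borel_measurable_continuous_onI continuous_intros)

lemma lborel_aff:
  assumes "\<alpha> \<noteq> 0" "\<beta> \<noteq> 0"
  shows "lborel = density (distr lborel borel (aff \<alpha> \<beta> h)) (\<lambda>_. ennreal \<bar>\<alpha> * \<beta>\<bar>)"
proof -
  define c where "c = (\<lambda>j::plane. if j = (1,0) then \<alpha> else \<beta>)"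
  have B: "(Basis::plane set) = {(1,0),(0,1)}" by (auto simp: Basis_prod_def)
  have "aff \<alpha> \<beta> h = (\<lambda>z. h + (\<Sum>j\<in>Basis. (c j * (z \<bullet> j)) *\<^sub>R j))"
    by (auto simp: fun_eq_iff aff_def B c_def prod_eq_iff)
  moreover have "(\<Prod>j\<in>Basis. \<bar>c j\<bar>) = \<bar>\<alpha> * \<beta>\<bar>" by (simp add: B c_def abs_mult)
  ultimately show ?thesis
    using lborel_affine_euclidean[of c h] assms by (simp add: c_def)
qed

lemma nn_integral_aff:
  assumes "\<alpha> \<noteq> 0" "\<beta> \<noteq> 0" and [measurable]: "f \<in> borel_measurable borel"
  shows "(\<integral>\<^sup>+z. f z \<partial>lborel) = ennreal \<bar>\<alpha> * \<beta>\<bar> * (\<integral>\<^sup>+z. f (aff \<alpha> \<beta> h z) \<partial>lborel)"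
  by (subst lborel_aff[OF assms(1,2), of h])
     (simp add: nn_integral_density nn_integral_distr nn_integral_cmult)

lemma integrable_aff:
  fixes f :: "plane \<Rightarrow> 'a::{banach, second_countable_topology}"
  assumes "\<alpha> \<noteq> 0" "\<beta> \<noteq> 0" and f: "integrable lborel f"
  shows "integrable lborel (\<lambda>z. f (aff \<alpha> \<beta> h z))"
proof -
  have [measurable]: "f \<in> borel_measurable borel" using f by simp
  have "ennreal \<bar>\<alpha> * \<beta>\<bar> * (\<integral>\<^sup>+z. ennreal (norm (f (aff \<alpha> \<beta> h z))) \<partial>lborel) < \<infinity>"
    using f nn_integral_aff[OF assms(1,2), of "\<lambda>z. ennreal (norm (f z))" h]
    by (simp add: integrable_iff_bounded)
  then have "(\<integral>\<^sup>+z. ennreal (norm (f (aff \<alpha> \<beta> h z))) \<partial>lborel) < \<infinity>"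
    using assms(1,2) by (auto simp: ennreal_mult_less_top)
  then show ?thesis by (simp add: integrable_iff_bounded)
qed

lemma aff_inverse:
  assumes "\<alpha> \<noteq> 0" "\<beta> \<noteq> 0"
  shows "aff \<alpha> \<beta> h (aff (1/\<alpha>) (1/\<beta>) (- (fst h/\<alpha>), - (snd h/\<beta>)) z) = z"
  using assms by (simp add: aff_def field_simps)

lemma integral_aff:
  fixes f :: "plane \<Rightarrow> 'a::{banach, second_countable_topology}"
  assumes "\<alpha> \<noteq> 0" "\<beta> \<noteq> 0"
  shows "(LINT z|lborel. f (aff \<alpha> \<beta> h z)) = (1 / \<bar>\<alpha> * \<beta>\<bar>) *\<^sub>R (LINT z|lborel. f z)"
proof (cases "integrable lborel f")
  case True
  then have [measurable]: "f \<in> borel_measurable borel" by simp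
  have "(LINT z|lborel. f z) = \<bar>\<alpha> * \<beta>\<bar> *\<^sub>R (LINT z|lborel. f (aff \<alpha> \<beta> h z))"
    by (subst lborel_aff[OF assms, of h]) (simp add: integral_density integral_distr)
  then show ?thesis using assms by simp
next
  case False
  have "\<not> integrable lborel (\<lambda>z. f (aff \<alpha> \<beta> h z))"
    using integrable_aff[of "1/\<alpha>" "1/\<beta>" "\<lambda>z. f (aff \<alpha> \<beta> h z)" "(- (fst h/\<alpha>), - (snd h/\<beta>))"] assms False
    by (auto simp: aff_inverse simp del: minus_divide_left)
  then show ?thesis using False by (simp add: not_integrable_integral_eq)
qed

lemma AE_aff:
  assumes "\<alpha> \<noteq> 0" "\<beta> \<noteq> 0" "AE z in lborel. P z"
  shows "AE z in lborel. P (aff \<alpha> \<beta> h z)"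
proof -
  obtain S where S: "S \<in> sets borel" "emeasure lborel S = 0" "{z. \<not> P z} \<subseteq> S"
    using assms(3) by (auto elim!: AE_E)
  have [measurable]: "S \<in> sets borel" by fact
  have "AE z in lborel. z \<notin> S" using S by (intro AE_not_in) (auto simp: null_sets_def)
  then have "AE z in density (distr lborel borel (aff \<alpha> \<beta> h)) (\<lambda>_. ennreal \<bar>\<alpha> * \<beta>\<bar>). z \<notin> S"
    by (subst lborel_aff[OF assms(1,2), of h, symmetric])
  then have "AE z in lborel. aff \<alpha> \<beta> h z \<notin> S"
    using assms(1,2) by (simp add: AE_density AE_distr_iff)
  then show ?thesis by eventually_elim (use S(3) in auto)
qed

lemma L2_aff:
  assumes "\<alpha> \<noteq> 0" "\<beta> \<noteq> 0" "u \<in> L2"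
  shows "(\<lambda>z. u (aff \<alpha> \<beta> h z)) \<in> L2"
proof -
  note [measurable] = L2_measurable[OF assms(3)]
  show ?thesis using integrable_aff[OF assms(1,2) L2_integrable[OF assms(3)], of h] by (simp add: L2_iff)
qed

lemma L2sq_aff: "\<alpha> \<noteq> 0 \<Longrightarrow> \<beta> \<noteq> 0 \<Longrightarrow> L2sq (\<lambda>z. u (aff \<alpha> \<beta> h z)) = L2sq u / \<bar>\<alpha> * \<beta>\<bar>"
  unfolding L2sq_def using integral_aff[of \<alpha> \<beta> "\<lambda>z. (cmod (u z))\<^sup>2" h] by simp

lemma aff_translate: "aff 1 1 h z = z + h"
  by (simp add: aff_def prod_eq_iff)

lemma L2_translate: "u \<in> L2 \<Longrightarrow> (\<lambda>z. u (z + h)) \<in> L2"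
  using L2_aff[of 1 1 u h] by (simp add: aff_translate)

lemma L2sq_translate: "L2sq (\<lambda>z. u (z + h)) = L2sq u"
  using L2sq_aff[of 1 1 u h] by (simp add: aff_translate)

section \<open>Continuity of translations\<close>

lemma lborel_Fubini_dominated:
  fixes f :: "plane \<Rightarrow> plane \<Rightarrow> complex" and a b :: "plane \<Rightarrow> real"
  assumes f [measurable]: "case_prod f \<in> borel_measurable (borel \<Otimes>\<^sub>M borel)"
    and a: "integrable lborel a" and b: "integrable lborel b"
    and le: "\<And>x y. cmod (f x y) \<le> a x * b y"
  shows "(LINT y|lborel. LINT x|lborel. f x y) = (LINT x|lborel. LINT y|lborel. f x y)"
proof (rule lborel_pair.Fubini_integral)
  have [measurable]: "a \<in> borel_measurable borel" "b \<in> borel_measurable borel"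
    using a b by simp_all
  have "integrable (lborel \<Otimes>\<^sub>M lborel) (\<lambda>(x, y). a x * b y)"
    by (rule lborel_pair.Fubini_integrable) (use a b in \<open>auto simp: abs_mult\<close>)
  then show "integrable (lborel \<Otimes>\<^sub>M lborel) (case_prod f)"
  proof (rule Bochner_Integration.integrable_bound)
    show "AE z in lborel \<Otimes>\<^sub>M lborel. norm (case_prod f z) \<le> norm (case z of (x, y) \<Rightarrow> a x * b y)"
      using le by (intro AE_I2) (auto intro: order_trans[OF _ abs_ge_self])
  qed (use f in simp)
qed

lemma borel_measurable_cis [measurable (raw)]:
  "f \<in> borel_measurable M \<Longrightarrow> (\<lambda>x. cis (f x)) \<in> borel_measurable M"
  using measurable_compose[of f M borel cis borel]
  by (simp add: borel_measurable_continuous_onI continuous_on_cis continuous_on_id)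

lemma norm_indicator_complex: "cmod (indicator S z) = indicator S z"
  by (simp split: split_indicator)

text \<open>
  For continuous functions of compact support this is dominated convergence. The general case follows
  by approximation: a bounded measurable function is almost everywhere a limit of continuous ones,
  which can be clamped and cut off, and square-integrable functions are limits of their truncations.
\<close>

lemma L2_translate_continuous:
  assumes u: "u \<in> L2" and h: "h \<longlonglongrightarrow> (0::plane)"
  shows "(\<lambda>k. L2sq (\<lambda>z. u (z + h k) - u z)) \<longlonglongrightarrow> 0"
proof -
  \<comment> \<open>Translations are isometries, so the property passes to limits in L2.\<close>
  have closed: "(\<lambda>k. L2norm (\<lambda>z. w (z + h k) - w z)) \<longlonglongrightarrow> 0"
    if f: "\<And>n::nat. f n \<in> L2" "\<And>n. (\<lambda>k. L2norm (\<lambda>z. f n (z + h k) - f n z)) \<longlonglongrightarrow> 0"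
      and w: "w \<in> L2" "(\<lambda>n. L2sq (\<lambda>z. f n z - w z)) \<longlonglongrightarrow> 0" for f w
  proof (rule LIMSEQ_I)
    fix e :: real assume e: "e > 0"
    have "(\<lambda>n. L2norm (\<lambda>z. f n z - w z)) \<longlonglongrightarrow> 0" using w(2) by (simp add: L2norm_tendsto_0_iff)
    from LIMSEQ_D[OF this, of "e/3"] e obtain n where n: "L2norm (\<lambda>z. f n z - w z) < e/3" by auto
    from LIMSEQ_D[OF f(2)[of n], of "e/3"] e obtain K
      where K: "\<And>k. k \<ge> K \<Longrightarrow> L2norm (\<lambda>z. f n (z + h k) - f n z) < e/3" by auto
    have "L2norm (\<lambda>z. w (z + h k) - w z) < e" if "k \<ge> K" for k
    proof -
      have "L2norm (\<lambda>z. w (z + h k) - f n (z + h k)) = L2norm (\<lambda>z. w z - f n z)"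
        using L2sq_translate[of "\<lambda>z. w z - f n z" "h k"] by (simp add: L2norm_def)
      then have "L2norm (\<lambda>z. w (z + h k) - f n (z + h k)) < e/3"
        using n L2norm_diff_commute[of w "f n"] by simp
      moreover have "L2norm (\<lambda>z. w (z + h k) - w z) \<le> L2norm (\<lambda>z. w (z + h k) - f n (z + h k))
          + L2norm (\<lambda>z. f n (z + h k) - w z)"
        by (intro L2norm_triangle_diff L2_translate w f)
      moreover have "L2norm (\<lambda>z. f n (z + h k) - w z) \<le> L2norm (\<lambda>z. f n (z + h k) - f n z)
          + L2norm (\<lambda>z. f n z - w z)"
        by (intro L2norm_triangle_diff L2_translate w f)
      ultimately show ?thesis using n K[OF that] by linarith
    qed
    then show "\<exists>K. \<forall>k\<ge>K. norm (L2norm (\<lambda>z. w (z + h k) - w z) - 0) < e" by auto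
  qed
  have ind: "(\<lambda>z. complex_of_real B * indicator (cball 0 R) z) \<in> L2" for B R
  proof -
    have "integrable lborel (indicator (cball (0::plane) R) :: plane \<Rightarrow> real)"
      by (intro integrable_real_indicator emeasure_bounded_finite) auto
    moreover have "(cmod (indicator (cball 0 R) z))\<^sup>2 = indicator (cball 0 R) z" for z :: plane
      by (simp split: split_indicator)
    ultimately have "(\<lambda>z. indicator (cball (0::plane) R) z :: complex) \<in> L2"
      by (simp add: L2_iff)
    then show ?thesis by (rule L2_scale)
  qed
  have cont: "(\<lambda>k. L2norm (\<lambda>z. g (z + h k) - g z)) \<longlonglongrightarrow> 0"
    if g: "continuous_on UNIV g" "\<And>z. cmod (g z) \<le> B * indicator (cball 0 R) z" "0 \<le> B" for g B R
  proof -
    have [measurable]: "g \<in> borel_measurable borel" using g(1) by (rule borel_measurable_continuous_onI)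
    obtain H where H: "\<And>k. norm (h k) \<le> H"
      using convergent_imp_Bseq[OF convergentI[OF h]] by (auto simp: Bseq_def)
    have "(\<lambda>k. L2sq (\<lambda>z. g (z + h k) - g z)) \<longlonglongrightarrow> 0"
    proof (rule L2_dominated(2)[OF _ ind[of B "R + H"]])
      show "cmod (g (z + h k)) \<le> cmod (complex_of_real B * indicator (cball 0 (R + H)) z)" for k z
      proof (cases "norm (z + h k) \<le> R")
        case True
        have "norm z \<le> norm (z + h k) + norm (h k)" using norm_triangle_ineq4[of "z + h k" "h k"] by simp
        then have "norm z \<le> R + H" using True H[of k] by linarith
        then show ?thesis using g(2)[of "z + h k"] g(3) True by (simp add: norm_mult)
      next
        case False
        then show ?thesis using g(2)[of "z + h k"] by simp
      qed
      show "AE z in lborel. (\<lambda>k. g (z + h k)) \<longlonglongrightarrow> g z"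
      proof (intro AE_I2)
        fix z
        have "(\<lambda>k. z + h k) \<longlonglongrightarrow> z + 0" by (intro tendsto_intros h)
        then show "(\<lambda>k. g (z + h k)) \<longlonglongrightarrow> g z"
          using continuous_on_tendsto_compose[OF g(1), of "\<lambda>k. z + h k" z sequentially] by simp
      qed
    qed measurable
    then show ?thesis by (simp add: L2norm_tendsto_0_iff)
  qed
  \<comment> \<open>Continuous approximations become dominated after clamping the values and cutting off.\<close>
  have bdd: "(\<lambda>k. L2norm (\<lambda>z. w (z + h k) - w z)) \<longlonglongrightarrow> 0"
    if [measurable]: "w \<in> borel_measurable borel"
      and w: "\<And>z. cmod (w z) \<le> B * indicator (cball 0 R) z" and B: "0 < B" for w B R
  proof -
    have wm: "w \<in> borel_measurable lebesgue" by (simp add: measurable_completion)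
    obtain N g where N: "negligible N" and gc: "\<And>n. continuous_on UNIV (g n)"
      and gl: "\<And>z. z \<notin> N \<Longrightarrow> (\<lambda>n::nat. g n z) \<longlonglongrightarrow> w z"
      using lebesgue_measurable_imp_measurable_on[OF wm, of UNIV] by (auto simp: measurable_on_def)
    have ae: "AE z in lborel. (\<lambda>n. g n z) \<longlonglongrightarrow> w z"
    proof -
      have "AE z in lebesgue. z \<notin> N" using N by (intro AE_not_in) (simp add: negligible_iff_null_sets)
      then have "AE z in lborel. z \<notin> N" by (simp add: AE_completion_iff)
      then show ?thesis by eventually_elim (rule gl)
    qed
    define bump where "bump z = complex_of_real (max 0 (min 1 (R + 1 - norm z)))" for z :: plane
    define clamp where "clamp c = complex_of_real (B / max B (cmod c)) * c" for c
    define G where "G n z = bump z * clamp (g n z)" for n z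
    have cc: "continuous_on UNIV clamp"
      unfolding clamp_def using B by (intro continuous_intros) (auto simp: max_def)
    have bc: "continuous_on UNIV bump"
      unfolding bump_def by (intro continuous_intros)
    have Gc: "continuous_on UNIV (G n)" for n
      unfolding G_def by (intro continuous_intros bc continuous_on_compose2[OF cc gc]) auto
    have cb: "cmod (clamp c) \<le> B" for c
    proof (cases "cmod c \<le> B")
      case False
      then show ?thesis using B by (simp add: clamp_def norm_mult norm_divide max_def)
    qed (use B in \<open>simp add: clamp_def max_def\<close>)
    have bb: "cmod (bump z) \<le> indicator (cball 0 (R+1)) z" for z
      by (auto simp: bump_def indicator_def)
    have Gb: "cmod (G n z) \<le> B * indicator (cball 0 (R+1)) z" for n z
      using mult_mono[OF cb[of "g n z"] bb[of z]] B by (simp add: G_def norm_mult mult.commute)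
    have cw: "bump z * clamp (w z) = w z" for z
    proof (cases "norm z \<le> R")
      case True
      then have "cmod (w z) \<le> B" using w[of z] by simp
      with True B show ?thesis by (simp add: bump_def clamp_def max_def)
    next
      case False
      then have "w z = 0" using w[of z] by simp
      then show ?thesis by (simp add: clamp_def)
    qed
    have [measurable]: "G n \<in> borel_measurable borel" for n
      using Gc by (rule borel_measurable_continuous_onI)
    have lim: "(\<lambda>n. L2sq (\<lambda>z. G n z - w z)) \<longlonglongrightarrow> 0"
    proof (rule L2_dominated(2)[OF _ ind[of B "R+1"]])
      show "cmod (G n z) \<le> cmod (complex_of_real B * indicator (cball 0 (R + 1)) z)" for n z
        using Gb[of n z] B by (auto simp: norm_mult split: split_indicator)
      show "AE z in lborel. (\<lambda>n. G n z) \<longlonglongrightarrow> w z"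
        using ae
      proof eventually_elim
        case (elim z)
        have "(\<lambda>n. bump z * clamp (g n z)) \<longlonglongrightarrow> bump z * clamp (w z)"
          by (intro tendsto_intros continuous_on_tendsto_compose[OF cc elim]) auto
        then show ?case by (simp add: G_def cw)
      qed
    qed simp_all
    have GL: "G n \<in> L2" for n
      by (rule L2_bound(1)[OF ind[of B "R+1"], where B=1])
         (use B Gb in \<open>simp_all add: norm_mult norm_indicator_complex\<close>)
    have wL: "w \<in> L2"
      by (rule L2_bound(1)[OF ind[of B R], where B=1])
         (use B w in \<open>simp_all add: norm_mult norm_indicator_complex\<close>)
    show ?thesis
      by (rule closed[OF GL cont[OF Gc Gb] wL lim]) (use B in simp)
  qed
  note [measurable] = L2_measurable[OF u]
  define f where "f n z = (if cmod (u z) \<le> real n \<and> norm z \<le> real n then u z else 0)" for n :: nat and z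
  have fm [measurable]: "f n \<in> borel_measurable borel" for n unfolding f_def by measurable
  have fle: "cmod (f n z) \<le> cmod (u z)" for n z by (simp add: f_def)
  have lim: "(\<lambda>n. L2sq (\<lambda>z. f n z - u z)) \<longlonglongrightarrow> 0"
  proof (rule L2_dominated(2)[OF fm u _ fle])
    show "AE z in lborel. (\<lambda>n. f n z) \<longlonglongrightarrow> u z"
    proof (intro AE_I2 tendsto_eventually)
      fix z
      obtain M :: nat where M: "max (cmod (u z)) (norm z) \<le> real M" using real_arch_simple by blast
      show "\<forall>\<^sub>F n in sequentially. f n z = u z"
        using eventually_ge_at_top[of M] by eventually_elim (use M in \<open>auto simp: f_def\<close>)
    qed
  qed simp
  have "(\<lambda>k. L2norm (\<lambda>z. u (z + h k) - u z)) \<longlonglongrightarrow> 0"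
  proof (rule closed[OF _ _ u lim])
    show "f n \<in> L2" for n by (rule L2_bound(1)[OF u, where B=1]) (use fle in auto)
    show "(\<lambda>k. L2norm (\<lambda>z. f n (z + h k) - f n z)) \<longlonglongrightarrow> 0" for n
      by (rule bdd[where B="real n + 1" and R="real n"]) (auto simp: f_def)
  qed
  then show ?thesis by (simp add: L2norm_tendsto_0_iff)
qed

section \<open>Gaussians\<close>

definition gauss :: "plane \<Rightarrow> real" where
  "gauss z = exp (- (z \<bullet> z) / 2)"

lemma gauss_measurable [measurable]: "gauss \<in> borel_measurable borel"
  unfolding gauss_def by measurable

lemma gauss_pos [simp]: "gauss z > 0" "gauss z \<ge> 0" "gauss z \<noteq> 0"
  by (simp_all add: gauss_def)

lemma gauss_le_1: "gauss z \<le> 1"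
  by (simp add: gauss_def)

text \<open>
  This is the characteristic function of the standard normal distribution, without the normalization.
\<close>

lemma Gauss_integral_real:
  fixes t :: real
  shows "integrable lborel (\<lambda>x::real. exp (- x\<^sup>2 / 2))"
    and "(LINT x|lborel. cis (t * x) * complex_of_real (exp (- x\<^sup>2 / 2))) = complex_of_real (sqrt (2 * pi) * exp (- t\<^sup>2 / 2))"
proof -
  have e: "exp (- x\<^sup>2 / 2) = sqrt (2 * pi) * std_normal_density x" for x :: real
    by (simp add: std_normal_density_def)
  show "integrable lborel (\<lambda>x::real. exp (- x\<^sup>2 / 2))"
    unfolding e by (intro integrable_mult_right integrable_normal_density) simp
  have "char std_normal_distribution t = complex_of_real (exp (- t\<^sup>2 / 2))"
    by (simp add: char_std_normal_distribution)
  moreover have "char std_normal_distribution t = (LINT x|lborel. complex_of_real (std_normal_density x) * cis (t * x))"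
    unfolding char_def by (subst integral_density) (auto simp: cis_conv_exp normal_density_nonneg scaleR_conv_of_real)
  moreover have "(LINT x|lborel. cis (t * x) * complex_of_real (exp (- x\<^sup>2 / 2))) =
      complex_of_real (sqrt (2 * pi)) * (LINT x|lborel. complex_of_real (std_normal_density x) * cis (t * x))"
    unfolding e integral_mult_right_zero[symmetric] by (simp add: mult_ac)
  ultimately show "(LINT x|lborel. cis (t * x) * complex_of_real (exp (- x\<^sup>2 / 2))) = complex_of_real (sqrt (2 * pi) * exp (- t\<^sup>2 / 2))"
    by simp
qed

lemma gauss_integrable: "integrable lborel gauss"
proof -
  have eq: "gauss = (\<lambda>(x, y). exp (- x\<^sup>2 / 2) * exp (- y\<^sup>2 / 2))"
    by (auto simp: gauss_def fun_eq_iff power2_eq_square exp_add[symmetric] add_divide_distrib)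
  have "integrable (lborel \<Otimes>\<^sub>M lborel) gauss"
    unfolding eq by (rule lborel_pair.Fubini_integrable)
      (simp_all add: abs_mult Gauss_integral_real(1) del: minus_divide_left divide_minus_left)
  then show ?thesis by (simp add: lborel_prod)
qed

lemma gauss_fourier: "(LINT z|lborel. cis (h \<bullet> z) * complex_of_real (gauss z)) = complex_of_real (2 * pi * gauss h)"
proof -
  obtain a b where h: "h = (a, b)" by (cases h)
  define e where "e t x = cis (t * x) * complex_of_real (exp (- x\<^sup>2 / 2))" for t x :: real
  have eq: "(\<lambda>z. cis (h \<bullet> z) * complex_of_real (gauss z)) = (\<lambda>(x, y). e a x * e b y)"
  proof (intro ext, clarify)
    fix x y :: real
    have "gauss (x, y) = exp (- x\<^sup>2 / 2) * exp (- y\<^sup>2 / 2)"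
      by (simp add: gauss_def power2_eq_square exp_add[symmetric] add_divide_distrib)
    moreover have "cis (h \<bullet> (x, y)) = cis (a * x) * cis (b * y)"
      by (simp add: h cis_mult)
    ultimately show "cis (h \<bullet> (x, y)) * complex_of_real (gauss (x, y)) = e a x * e b y"
      by (simp only: e_def of_real_mult mult_ac)
  qed
  have I: "integrable lborel (\<lambda>z. cis (h \<bullet> z) * complex_of_real (gauss z))"
    by (rule Bochner_Integration.integrable_bound[OF gauss_integrable]) (auto simp: norm_mult)
  have "(LINT z|lborel. cis (h \<bullet> z) * complex_of_real (gauss z)) = integral\<^sup>L (lborel \<Otimes>\<^sub>M lborel) (\<lambda>(x, y). e a x * e b y)"
    unfolding eq by (simp add: lborel_prod)
  also have "\<dots> = (LINT x|lborel. LINT y|lborel. e a x * e b y)"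
    using I unfolding eq by (subst lborel_pair.integral_fst[symmetric]) (auto simp: lborel_prod)
  also have "\<dots> = complex_of_real (sqrt (2 * pi) * exp (- a\<^sup>2 / 2)) * complex_of_real (sqrt (2 * pi) * exp (- b\<^sup>2 / 2))"
    using Gauss_integral_real(2)[of a] Gauss_integral_real(2)[of b] by (simp add: e_def)
  also have "\<dots> = complex_of_real ((sqrt (2 * pi) * sqrt (2 * pi)) * (exp (- a\<^sup>2 / 2) * exp (- b\<^sup>2 / 2)))"
    by (simp only: of_real_mult mult_ac)
  also have "exp (- a\<^sup>2 / 2) * exp (- b\<^sup>2 / 2) = gauss h"
    by (simp add: h gauss_def power2_eq_square exp_add[symmetric] add_divide_distrib)
  also have "sqrt (2 * pi) * sqrt (2 * pi) = 2 * pi" by simp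
  finally show ?thesis .
qed

lemma gauss_integral: "(LINT z|lborel. gauss z) = 2 * pi"
  using gauss_fourier[of 0] by (simp add: gauss_def integral_complex_of_real del: of_real_mult of_real_exp) 

lemma gauss_scale: "gauss (s *\<^sub>R z) = exp (- (s\<^sup>2 * (z \<bullet> z)) / 2)"
  by (simp add: gauss_def power2_eq_square)

lemma aff_scale: "aff s s h z = h + s *\<^sub>R z"
  by (simp add: aff_def prod_eq_iff)

lemma gauss_scale_integrable: "s \<noteq> 0 \<Longrightarrow> integrable lborel (\<lambda>z. gauss (s *\<^sub>R z))"
  using integrable_aff[of s s gauss 0] gauss_integrable by (simp add: aff_scale)

lemma gauss_scale_fourier:
  assumes s: "s > 0"
  shows "(LINT z|lborel. cis (h \<bullet> z) * complex_of_real (gauss (s *\<^sub>R z)))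
    = complex_of_real (2 * pi / s\<^sup>2 * gauss ((1/s) *\<^sub>R h))"
proof -
  have "(LINT z|lborel. cis (h \<bullet> z) * complex_of_real (gauss (s *\<^sub>R z))) =
    (LINT z|lborel. (\<lambda>w. cis (((1/s) *\<^sub>R h) \<bullet> w) * complex_of_real (gauss w)) (aff s s 0 z))"
    using s by (simp add: aff_scale)
  also have "\<dots> = (1 / \<bar>s * s\<bar>) *\<^sub>R complex_of_real (2 * pi * gauss ((1/s) *\<^sub>R h))"
    using s by (subst integral_aff) (simp_all only: gauss_fourier)
  finally show ?thesis using s by (simp add: scaleR_conv_of_real power2_eq_square)
qed

section \<open>The Plancherel identity for integrable functions\<close>

lemma fourier_integral_measurable [measurable]:
  assumes [measurable]: "f \<in> borel_measurable borel"
  shows "fourier_integral f \<in> borel_measurable borel"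
  unfolding fourier_integral_def by measurable

lemma fourier_integral_bound:
  shows "cmod (fourier_integral f \<zeta>) \<le> (LINT z|lborel. cmod (f z))"
  unfolding fourier_integral_def
  using integral_norm_bound[of lborel "\<lambda>z. cis (- (z \<bullet> \<zeta>)) * f z"] by (simp add: norm_mult)

lemma fourier_integrable: "integrable lborel f \<Longrightarrow> integrable lborel (\<lambda>z. cis (- (z \<bullet> \<zeta>)) * f z)"
  by (rule Bochner_Integration.integrable_bound[where f=f]) (auto simp: norm_mult)

lemma fourier_integral_diff:
  "integrable lborel f \<Longrightarrow> integrable lborel g \<Longrightarrow>
    fourier_integral (\<lambda>z. f z - g z) \<zeta> = fourier_integral f \<zeta> - fourier_integral g \<zeta>"
  unfolding fourier_integral_def
  using fourier_integrable[of f \<zeta>] fourier_integrable[of g \<zeta>] by (simp add: right_diff_distrib)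

lemma fourier_integral_add:
  "integrable lborel f \<Longrightarrow> integrable lborel g \<Longrightarrow>
    fourier_integral (\<lambda>z. f z + g z) \<zeta> = fourier_integral f \<zeta> + fourier_integral g \<zeta>"
  unfolding fourier_integral_def
  using fourier_integrable[of f \<zeta>] fourier_integrable[of g \<zeta>] by (simp add: distrib_left)

lemma fourier_integral_scale: "fourier_integral (\<lambda>z. c * f z) \<zeta> = c * fourier_integral f \<zeta>"
  unfolding fourier_integral_def integral_mult_right_zero[symmetric] by (simp add: mult_ac)

text \<open>
  By Fubini both sides are the double integral of \<open>cis (- (z \<bullet> \<zeta>)) * f z * k \<zeta>\<close>.
\<close>

lemma fourier_multiplication_formula:
  assumes f: "integrable lborel f" and k: "integrable lborel k"
  shows "(LINT \<zeta>|lborel. k \<zeta> * fourier_integral f \<zeta>) = (LINT z|lborel. f z * fourier_integral k z)"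
proof -
  have [measurable]: "f \<in> borel_measurable borel" "k \<in> borel_measurable borel"
    using f k by simp_all
  have "(LINT \<zeta>|lborel. LINT z|lborel. k \<zeta> * (cis (- (z \<bullet> \<zeta>)) * f z))
      = (LINT z|lborel. LINT \<zeta>|lborel. k \<zeta> * (cis (- (z \<bullet> \<zeta>)) * f z))"
  proof (rule lborel_Fubini_dominated[where a="\<lambda>z. cmod (f z)" and b="\<lambda>\<zeta>. cmod (k \<zeta>)"])
    show "integrable lborel (\<lambda>z. cmod (f z))" "integrable lborel (\<lambda>z. cmod (k z))" using f k by auto
  qed (measurable, simp add: norm_mult mult.commute)
  then show ?thesis
    unfolding fourier_integral_def by (simp add: inner_commute mult_ac flip: integral_mult_right_zero)
qed

text \<open>
  Gaussian damping makes the frequency integral absolutely convergent. As the transform of a Gaussian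
  is a Gaussian, Fubini turns the damped integral into an average of the autocorrelation of \<open>f\<close> over
  a region of diameter about \<open>s\<close>.
\<close>

lemma gauss_Plancherel_approx:
  assumes f: "integrable lborel f" "f \<in> L2" and s: "s > 0"
  shows "(LINT \<zeta>|lborel. complex_of_real (gauss (s *\<^sub>R \<zeta>) * (cmod (fourier_integral f \<zeta>))\<^sup>2))
    = (LINT k|lborel. complex_of_real (2 * pi * gauss k) * L2_inner f (\<lambda>z. f (z + s *\<^sub>R k)))"
proof -
  note [measurable] = L2_measurable[OF f(2)]
  let ?F = "fourier_integral f"
  define k where "k \<zeta> = complex_of_real (gauss (s *\<^sub>R \<zeta>)) * cnj (?F \<zeta>)" for \<zeta>
  have Gi: "integrable lborel (\<lambda>\<zeta>. gauss (s *\<^sub>R \<zeta>))" using s by (intro gauss_scale_integrable) simp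
  have ki: "integrable lborel k"
  proof (rule Bochner_Integration.integrable_bound)
    show "integrable lborel (\<lambda>\<zeta>. gauss (s *\<^sub>R \<zeta>) * (LINT z|lborel. cmod (f z)))" using Gi by simp
    show "AE \<zeta> in lborel. norm (k \<zeta>) \<le> norm (gauss (s *\<^sub>R \<zeta>) * (LINT z|lborel. cmod (f z)))"
      by (intro AE_I2) (auto simp: k_def norm_mult abs_mult intro!: mult_left_mono order_trans[OF fourier_integral_bound])
  qed (simp add: k_def[abs_def])
  have hat_k: "fourier_integral k z = (LINT \<kappa>|lborel. complex_of_real (2 * pi * gauss \<kappa>) * cnj (f (z + s *\<^sub>R \<kappa>)))" for z
  proof -
    define l where "l \<zeta> = cis (z \<bullet> \<zeta>) * complex_of_real (gauss (s *\<^sub>R \<zeta>))" for \<zeta>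
    have li: "integrable lborel l"
      by (rule Bochner_Integration.integrable_bound[OF Gi]) (auto simp: l_def[abs_def] norm_mult)
    have hl: "fourier_integral l w = complex_of_real (2 * pi / s\<^sup>2 * gauss ((1/s) *\<^sub>R (z - w)))" for w
      unfolding fourier_integral_def gauss_scale_fourier[OF s, symmetric] l_def
      by (simp add: mult.assoc[symmetric] cis_mult inner_diff_left inner_diff_right inner_commute)
    have "fourier_integral k z = (LINT \<zeta>|lborel. cnj (l \<zeta> * ?F \<zeta>))"
      unfolding fourier_integral_def[of k] by (simp add: l_def k_def cis_cnj mult_ac inner_commute)
    also have "\<dots> = cnj (LINT \<zeta>|lborel. l \<zeta> * ?F \<zeta>)" by (rule Bochner_Integration.integral_cnj)
    also have "(LINT \<zeta>|lborel. l \<zeta> * ?F \<zeta>) = (LINT w|lborel. f w * fourier_integral l w)"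
      by (rule fourier_multiplication_formula[OF f(1) li])
    also have "\<dots> = (LINT w|lborel. f w * complex_of_real (2 * pi / s\<^sup>2 * gauss ((1/s) *\<^sub>R (z - w))))"
      by (simp only: hl)
    also have "\<dots> =
        \<bar>s * s\<bar> *\<^sub>R (LINT \<kappa>|lborel. f (aff s s z \<kappa>) * complex_of_real (2 * pi / s\<^sup>2 * gauss ((1/s) *\<^sub>R (z - aff s s z \<kappa>))))"
      using s by (subst integral_aff) simp_all
    also have "\<dots> = (LINT \<kappa>|lborel. complex_of_real (2 * pi * gauss \<kappa>) * f (z + s *\<^sub>R \<kappa>))"
      using s unfolding scaleR_conv_of_real integral_mult_right_zero[symmetric]
      by (intro Bochner_Integration.integral_cong) (simp_all add: aff_scale gauss_def power2_eq_square mult_ac)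
    also have "cnj (LINT \<kappa>|lborel. complex_of_real (2 * pi * gauss \<kappa>) * f (z + s *\<^sub>R \<kappa>))
        = (LINT \<kappa>|lborel. complex_of_real (2 * pi * gauss \<kappa>) * cnj (f (z + s *\<^sub>R \<kappa>)))"
      by (subst Bochner_Integration.integral_cnj[symmetric]) simp
    finally show ?thesis .
  qed
  have "(LINT \<zeta>|lborel. complex_of_real (gauss (s *\<^sub>R \<zeta>) * (cmod (?F \<zeta>))\<^sup>2)) = (LINT \<zeta>|lborel. k \<zeta> * ?F \<zeta>)"
    by (intro Bochner_Integration.integral_cong) (simp_all only: k_def of_real_mult complex_norm_square mult_ac)
  also have "\<dots> = (LINT z|lborel. f z * fourier_integral k z)"
    by (rule fourier_multiplication_formula[OF f(1) ki])
  also have "\<dots> = (LINT z|lborel. LINT \<kappa>|lborel. f z * (complex_of_real (2 * pi * gauss \<kappa>) * cnj (f (z + s *\<^sub>R \<kappa>))))"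
    unfolding hat_k by simp
  also have "\<dots> = (LINT \<kappa>|lborel. LINT z|lborel. f z * (complex_of_real (2 * pi * gauss \<kappa>) * cnj (f (z + s *\<^sub>R \<kappa>))))"
  proof (rule lborel_pair.Fubini_integral, rule lborel_pair.Fubini_integrable)
    have I: "integrable lborel (\<lambda>z. f z * cnj (f (z + s *\<^sub>R \<kappa>)))" for \<kappa>
      by (rule L2_prod_integrable(3)[OF f(2) L2_translate[OF f(2)]])
    show "AE \<kappa> in lborel. integrable lborel (\<lambda>z. case (\<kappa>, z) of (\<kappa>, z) \<Rightarrow>
        f z * (complex_of_real (2 * pi * gauss \<kappa>) * cnj (f (z + s *\<^sub>R \<kappa>))))"
    proof (intro AE_I2)
      fix \<kappa>
      have "integrable lborel (\<lambda>z. complex_of_real (2 * pi * gauss \<kappa>) * (f z * cnj (f (z + s *\<^sub>R \<kappa>))))"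
        by (intro integrable_mult_right I)
      then show "integrable lborel (\<lambda>z. case (\<kappa>, z) of (\<kappa>, z) \<Rightarrow>
        f z * (complex_of_real (2 * pi * gauss \<kappa>) * cnj (f (z + s *\<^sub>R \<kappa>))))"
        by (simp only: prod.case mult.left_commute)
    qed
    show m: "(\<lambda>(\<kappa>, z). f z * (complex_of_real (2 * pi * gauss \<kappa>) * cnj (f (z + s *\<^sub>R \<kappa>))))
      \<in> borel_measurable (lborel \<Otimes>\<^sub>M lborel)"
      by measurable
    show "integrable lborel (\<lambda>\<kappa>. LINT z|lborel. norm (case (\<kappa>, z) of (\<kappa>, z) \<Rightarrow>
        f z * (complex_of_real (2 * pi * gauss \<kappa>) * cnj (f (z + s *\<^sub>R \<kappa>)))))"
    proof (rule Bochner_Integration.integrable_bound)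
      show "integrable lborel (\<lambda>\<kappa>. 2 * pi * gauss \<kappa> * L2sq f)"
        using gauss_integrable by simp
      show "AE \<kappa> in lborel. norm (LINT z|lborel. norm (case (\<kappa>, z) of (\<kappa>, z) \<Rightarrow>
        f z * (complex_of_real (2 * pi * gauss \<kappa>) * cnj (f (z + s *\<^sub>R \<kappa>))))) \<le> norm (2 * pi * gauss \<kappa> * L2sq f)"
      proof (intro AE_I2)
        fix \<kappa>
        have "(LINT z|lborel. cmod (f z) * cmod (f (z + s *\<^sub>R \<kappa>))) \<le> L2norm f * L2norm (\<lambda>z. f (z + s *\<^sub>R \<kappa>))"
          by (intro L2_Cauchy_Schwarz L2_translate f)
        also have "\<dots> = L2sq f"
          by (simp add: L2norm_def L2sq_translate)
        finally have le: "(LINT z|lborel. cmod (f z) * cmod (f (z + s *\<^sub>R \<kappa>))) \<le> L2sq f" .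
        have "(LINT z|lborel. norm (case (\<kappa>, z) of (\<kappa>, z) \<Rightarrow>
          f z * (complex_of_real (2 * pi * gauss \<kappa>) * cnj (f (z + s *\<^sub>R \<kappa>))))) =
          2 * pi * gauss \<kappa> * (LINT z|lborel. cmod (f z) * cmod (f (z + s *\<^sub>R \<kappa>)))"
          unfolding integral_mult_right_zero[symmetric] by (simp add: norm_mult mult_ac)
        also have "\<dots> \<le> 2 * pi * gauss \<kappa> * L2sq f"
          using le by (intro mult_left_mono) auto
        finally have le2: "(LINT z|lborel. norm (case (\<kappa>, z) of (\<kappa>, z) \<Rightarrow>
          f z * (complex_of_real (2 * pi * gauss \<kappa>) * cnj (f (z + s *\<^sub>R \<kappa>))))) \<le> 2 * pi * gauss \<kappa> * L2sq f" .
        have "0 \<le> (LINT z|lborel. norm (case (\<kappa>, z) of (\<kappa>, z) \<Rightarrow>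
          f z * (complex_of_real (2 * pi * gauss \<kappa>) * cnj (f (z + s *\<^sub>R \<kappa>)))))"
          by (rule Bochner_Integration.integral_nonneg) simp
        then show "norm (LINT z|lborel. norm (case (\<kappa>, z) of (\<kappa>, z) \<Rightarrow>
          f z * (complex_of_real (2 * pi * gauss \<kappa>) * cnj (f (z + s *\<^sub>R \<kappa>))))) \<le> norm (2 * pi * gauss \<kappa> * L2sq f)"
          using le2 by (simp only: real_norm_def abs_of_nonneg[OF \<open>0 \<le> _\<close>] order_trans[OF le2 abs_ge_self])
      qed
    qed (use m in measurable)
  qed
  also have "\<dots> = (LINT \<kappa>|lborel. complex_of_real (2 * pi * gauss \<kappa>) * L2_inner f (\<lambda>z. f (z + s *\<^sub>R \<kappa>)))"
    unfolding L2_inner_def integral_mult_right_zero[symmetric] by (simp add: mult_ac)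
  finally show ?thesis .
qed

text \<open>
  As \<open>s\<close> decreases to 0, the averages in \<open>gauss_Plancherel_approx\<close> tend to the autocorrelation at 0,
  which is \<open>L2sq f\<close>, because translations are continuous in \<open>L\<^sup>2\<close>; the damped integrals increase to
  \<open>L2sq (fourier_integral f)\<close>.
\<close>

theorem Plancherel_integrable:
  assumes f: "integrable lborel f" "f \<in> L2"
  shows "fourier_integral f \<in> L2" "L2sq (fourier_integral f) = 4 * pi\<^sup>2 * L2sq f"
proof -
  note [measurable] = L2_measurable[OF f(2)]
  let ?F = "fourier_integral f"
  define s where "s n = 1 / (real n + 1)" for n :: nat
  have sp: "s n > 0" for n by (simp add: s_def)
  have s0: "s \<longlonglongrightarrow> 0" unfolding s_def
    using LIMSEQ_inverse_real_of_nat by (simp add: inverse_eq_divide add.commute)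
  have dec: "s n \<le> s m" if "m \<le> n" for m n using that by (simp add: s_def frac_le)
  define J where "J n \<zeta> = gauss (s n *\<^sub>R \<zeta>) * (cmod (?F \<zeta>))\<^sup>2" for n \<zeta>
  define C where "C = (LINT z|lborel. cmod (f z))"
  have Ji: "integrable lborel (J n)" for n
  proof (rule Bochner_Integration.integrable_bound)
    show "integrable lborel (\<lambda>\<zeta>. gauss (s n *\<^sub>R \<zeta>) * C\<^sup>2)"
      using gauss_scale_integrable[of "s n"] sp[of n] by simp
    show "AE \<zeta> in lborel. norm (J n \<zeta>) \<le> norm (gauss (s n *\<^sub>R \<zeta>) * C\<^sup>2)"
      using fourier_integral_bound[of f]
      by (intro AE_I2) (auto simp: J_def abs_mult C_def intro!: mult_left_mono power_mono)
  qed (simp add: J_def[abs_def])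
  have lim: "(\<lambda>n. (LINT \<kappa>|lborel. complex_of_real (2 * pi * gauss \<kappa>) * L2_inner f (\<lambda>z. f (z + s n *\<^sub>R \<kappa>))))
    \<longlonglongrightarrow> (LINT \<kappa>|lborel. complex_of_real (2 * pi * gauss \<kappa>) * L2_inner f f)"
  proof (rule integral_dominated_convergence[where w="\<lambda>\<kappa>. 2 * pi * gauss \<kappa> * L2sq f"])
    show "integrable lborel (\<lambda>\<kappa>. 2 * pi * gauss \<kappa> * L2sq f)" using gauss_integrable by simp
    have lim1: "(\<lambda>n. L2_inner f (\<lambda>z. f (z + s n *\<^sub>R \<kappa>))) \<longlonglongrightarrow> L2_inner f f" for \<kappa>
    proof -
      have "(\<lambda>n. s n *\<^sub>R \<kappa>) \<longlonglongrightarrow> 0 *\<^sub>R \<kappa>" by (intro tendsto_intros s0)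
      then have "(\<lambda>n. L2_inner (\<lambda>z. f (z + s n *\<^sub>R \<kappa>)) f) \<longlonglongrightarrow> L2_inner f f"
        by (intro L2_inner_tendsto L2_translate f L2_translate_continuous) simp
      from tendsto_cnj[OF this] show ?thesis by (simp add: L2_inner_cnj)
    qed
    then show "AE \<kappa> in lborel. (\<lambda>n. complex_of_real (2 * pi * gauss \<kappa>) * L2_inner f (\<lambda>z. f (z + s n *\<^sub>R \<kappa>)))
        \<longlonglongrightarrow> complex_of_real (2 * pi * gauss \<kappa>) * L2_inner f f"
      by (intro AE_I2 tendsto_intros)
    have "cmod (L2_inner f (\<lambda>z. f (z + s n *\<^sub>R \<kappa>))) \<le> L2sq f" for n \<kappa>
      using L2_inner_bound[OF f(2) L2_translate[OF f(2)], of "s n *\<^sub>R \<kappa>"]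
      by (simp add: L2norm_def L2sq_translate)
    then show "AE \<kappa> in lborel. cmod (complex_of_real (2 * pi * gauss \<kappa>) * L2_inner f (\<lambda>z. f (z + s n *\<^sub>R \<kappa>)))
        \<le> 2 * pi * gauss \<kappa> * L2sq f" for n
      by (intro AE_I2) (auto simp: norm_mult intro!: mult_left_mono)
  qed (simp_all add: L2_inner_def)
  have "(LINT \<kappa>|lborel. complex_of_real (2 * pi * gauss \<kappa>) * L2_inner f f)
      = complex_of_real (LINT \<kappa>|lborel. 2 * pi * gauss \<kappa> * L2sq f)"
    unfolding L2_inner_self of_real_mult[symmetric] by (rule integral_complex_of_real)
  also have "\<dots> = complex_of_real (4 * pi\<^sup>2 * L2sq f)"
    by (simp add: gauss_integral power2_eq_square)
  finally have eq: "(LINT \<kappa>|lborel. complex_of_real (2 * pi * gauss \<kappa>) * L2_inner f f) = complex_of_real (4 * pi\<^sup>2 * L2sq f)" .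
  have lim2: "(\<lambda>n. complex_of_real (LINT \<zeta>|lborel. J n \<zeta>)) \<longlonglongrightarrow> complex_of_real (4 * pi\<^sup>2 * L2sq f)"
    using lim unfolding eq gauss_Plancherel_approx[OF f sp, symmetric] J_def[symmetric] integral_complex_of_real .
  then have ilim: "(\<lambda>n. (LINT \<zeta>|lborel. J n \<zeta>)) \<longlonglongrightarrow> 4 * pi\<^sup>2 * L2sq f"
    by (simp only: tendsto_of_real_iff)
  have mono: "mono (\<lambda>n. J n \<zeta>)" for \<zeta>
  proof (rule monoI)
    fix m n :: nat assume "m \<le> n"
    then have "(s n)\<^sup>2 \<le> (s m)\<^sup>2" using dec sp[of n] by (intro power_mono) auto
    then have "(s n)\<^sup>2 * (\<zeta> \<bullet> \<zeta>) \<le> (s m)\<^sup>2 * (\<zeta> \<bullet> \<zeta>)" by (intro mult_right_mono) auto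
    then show "J m \<zeta> \<le> J n \<zeta>" by (auto simp: J_def gauss_scale intro!: mult_right_mono)
  qed
  have ptw: "(\<lambda>n. J n \<zeta>) \<longlonglongrightarrow> (cmod (?F \<zeta>))\<^sup>2" for \<zeta>
  proof -
    have "(\<lambda>n. exp (- ((s n)\<^sup>2 * (\<zeta> \<bullet> \<zeta>)) / 2) * (cmod (?F \<zeta>))\<^sup>2) \<longlonglongrightarrow> exp (- (0\<^sup>2 * (\<zeta> \<bullet> \<zeta>)) / 2) * (cmod (?F \<zeta>))\<^sup>2"
      by (intro tendsto_intros s0) simp
    then show ?thesis by (simp add: J_def gauss_scale)
  qed
  have "integrable lborel (\<lambda>\<zeta>. (cmod (?F \<zeta>))\<^sup>2) \<and> (LINT \<zeta>|lborel. (cmod (?F \<zeta>))\<^sup>2) = 4 * pi\<^sup>2 * L2sq f"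
    using integral_monotone_convergence_nonneg[OF Ji _ _ _ ilim, of "\<lambda>\<zeta>. (cmod (?F \<zeta>))\<^sup>2"] mono ptw
    by (auto simp: J_def)
  then show "?F \<in> L2" "L2sq ?F = 4 * pi\<^sup>2 * L2sq f"
    by (auto simp: L2_iff L2sq_def)
qed

section \<open>The Fourier transform on \<open>L\<^sup>2\<close>\<close>

lemma has_fourier_iff:
  "has_fourier f g \<longleftrightarrow> f \<in> L2 \<and> g \<in> L2 \<and>
    ((\<lambda>R. L2sq (\<lambda>\<zeta>. fourier_integral (\<lambda>z. indicator (cball 0 R) z * f z) \<zeta> - g \<zeta>)) \<longlongrightarrow> 0) at_top"
proof (cases "f \<in> L2 \<and> g \<in> L2")
  case True
  have "(\<integral>\<^sup>+ \<zeta>. ennreal ((cmod (g \<zeta> - fourier_integral (\<lambda>z. indicator (cball 0 R) z * f z) \<zeta>))\<^sup>2) \<partial>lborel)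
      = ennreal (L2sq (\<lambda>\<zeta>. fourier_integral (\<lambda>z. indicator (cball 0 R) z * f z) \<zeta> - g \<zeta>))" for R
  proof -
    have "(\<lambda>\<zeta>. fourier_integral (\<lambda>z. indicator (cball 0 R) z * f z) \<zeta> - g \<zeta>) \<in> L2"
      using True by (intro L2_diff Plancherel_integrable L2_truncate_integrable L2_indicator) auto
    from nn_integral_L2sq[OF this] show ?thesis by (simp add: norm_minus_commute)
  qed
  moreover have "((\<lambda>R. ennreal (h R)) \<longlongrightarrow> 0) F \<longleftrightarrow> (h \<longlongrightarrow> 0) F" if "\<And>R. h R \<ge> 0" for h :: "real \<Rightarrow> real" and F
    using tendsto_ennreal_iff[of h F 0] that by simp
  ultimately show ?thesis using True by (simp add: has_fourier_def)
qed (auto simp: has_fourier_def)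

lemma has_fourier_L2: "has_fourier f g \<Longrightarrow> f \<in> L2" "has_fourier f g \<Longrightarrow> g \<in> L2"
  by (simp_all add: has_fourier_def)

lemma truncate_L2 [simp]: "f \<in> L2 \<Longrightarrow> (\<lambda>z. indicator (cball 0 R) z * f z) \<in> L2"
  by (rule L2_indicator) auto

lemma fourier_truncate_L2 [simp]: "f \<in> L2 \<Longrightarrow> fourier_integral (\<lambda>z. indicator (cball 0 R) z * f z) \<in> L2"
  by (intro Plancherel_integrable L2_truncate_integrable) auto

lemma fourier_integral_dist:
  assumes "integrable lborel f" "f \<in> L2" "integrable lborel g" "g \<in> L2"
  shows "L2sq (\<lambda>\<zeta>. fourier_integral f \<zeta> - fourier_integral g \<zeta>) = 4 * pi\<^sup>2 * L2sq (\<lambda>z. f z - g z)"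
proof -
  have "fourier_integral (\<lambda>z. f z - g z) = (\<lambda>\<zeta>. fourier_integral f \<zeta> - fourier_integral g \<zeta>)"
    by (intro ext fourier_integral_diff assms)
  then show ?thesis
    using Plancherel_integrable(2)[of "\<lambda>z. f z - g z"] assms by (simp add: L2_diff)
qed

lemma has_fourier_Plancherel:
  assumes "has_fourier f g"
  shows "L2sq g = 4 * pi\<^sup>2 * L2sq f"
proof (rule tendsto_unique[OF trivial_limit_at_top_linorder])
  note L = has_fourier_L2[OF assms]
  show "((\<lambda>R. L2sq (fourier_integral (\<lambda>z. indicator (cball 0 R) z * f z))) \<longlongrightarrow> L2sq g) at_top"
    by (rule L2norm_tendsto(2)) (use assms L in \<open>auto simp: has_fourier_iff\<close>)
  have "((\<lambda>R. 4 * pi\<^sup>2 * L2sq (\<lambda>z. indicator (cball 0 R) z * f z)) \<longlongrightarrow> 4 * pi\<^sup>2 * L2sq f) at_top"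
    by (intro tendsto_intros L2norm_tendsto(2) L2_truncate_tendsto) (use L in auto)
  moreover have "4 * pi\<^sup>2 * L2sq (\<lambda>z. indicator (cball 0 R) z * f z)
     = L2sq (fourier_integral (\<lambda>z. indicator (cball 0 R) z * f z))" for R
    using Plancherel_integrable(2)[OF L2_truncate_integrable[OF L(1)] truncate_L2[OF L(1)]] by simp
  ultimately show "((\<lambda>R. L2sq (fourier_integral (\<lambda>z. indicator (cball 0 R) z * f z))) \<longlongrightarrow> 4 * pi\<^sup>2 * L2sq f) at_top"
    by simp
qed

lemma L2sq_add_le:
  assumes "u \<in> L2" "v \<in> L2"
  shows "L2sq (\<lambda>z. u z + v z) \<le> 2 * L2sq u + 2 * L2sq v"
  using L2sq_add[OF assms] L2sq_diff[OF assms] L2sq_nonneg[of "\<lambda>z. u z - v z"] by linarith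

lemma L2sq_diff_le3:
  assumes "u \<in> L2" "v \<in> L2" "w \<in> L2"
  shows "L2sq (\<lambda>z. u z - w z) \<le> 2 * L2sq (\<lambda>z. u z - v z) + 2 * L2sq (\<lambda>z. v z - w z)"
  using L2sq_add_le[OF L2_diff[OF assms(1,2)] L2_diff[OF assms(2,3)]] by simp

lemma L2sq_diff_commute: "L2sq (\<lambda>z. u z - v z) = L2sq (\<lambda>z. v z - u z)"
  by (simp add: L2sq_def norm_minus_commute)

lemma L2_tendsto_combine:
  assumes "\<And>R. f R \<in> L2" "\<And>R. f' R \<in> L2" "g \<in> L2"
    and "((\<lambda>R. L2sq (\<lambda>z. f R z - f' R z)) \<longlongrightarrow> 0) F" "((\<lambda>R. L2sq (\<lambda>z. f' R z - g z)) \<longlongrightarrow> 0) F"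
  shows "((\<lambda>R. L2sq (\<lambda>z. f R z - g z)) \<longlongrightarrow> 0) F"
proof (rule tendsto_sandwich[OF _ _ tendsto_const])
  show "((\<lambda>R. 2 * L2sq (\<lambda>z. f R z - f' R z) + 2 * L2sq (\<lambda>z. f' R z - g z)) \<longlongrightarrow> 0) F"
    using tendsto_add[OF tendsto_mult_left[OF assms(4), of 2] tendsto_mult_left[OF assms(5), of 2]] by simp
qed (use L2sq_diff_le3[OF assms(1,2,3)] in auto)

text \<open>
  The truncations of \<open>f\<close> converge in \<open>L\<^sup>2\<close>, so by Plancherel their transforms form a Cauchy family.
\<close>

lemma has_fourier_exists:
  assumes f: "f \<in> L2"
  obtains g where "has_fourier f g"
proof -
  define t where "t R = (\<lambda>z. indicator (cball 0 R) z * f z)" for R :: real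
  have tL: "t R \<in> L2" "integrable lborel (t R)" for R
    unfolding t_def using f by (auto intro: L2_truncate_integrable)
  define F where "F R = fourier_integral (t R)" for R
  have FL: "F R \<in> L2" for R unfolding F_def by (intro Plancherel_integrable tL)
  have dist: "L2sq (\<lambda>\<zeta>. F R \<zeta> - F S \<zeta>) = 4 * pi\<^sup>2 * L2sq (\<lambda>z. t R z - t S z)" for R S
    unfolding F_def by (intro fourier_integral_dist tL)
  have dist_le: "L2sq (\<lambda>\<zeta>. F R \<zeta> - F S \<zeta>) \<le>
      4 * pi\<^sup>2 * (2 * L2sq (\<lambda>z. t R z - f z) + 2 * L2sq (\<lambda>z. t S z - f z))" for R S
    unfolding dist using L2sq_diff_le3[OF tL(1) f tL(1), of R S] L2sq_diff_commute[of f "t S"]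
    by (intro mult_left_mono) auto
  have lim: "((\<lambda>R. L2sq (\<lambda>z. t R z - f z)) \<longlongrightarrow> 0) at_top"
    unfolding t_def by (rule L2_truncate_tendsto[OF f])
  have Cau: "\<exists>N. \<forall>m\<ge>N. \<forall>n\<ge>N. L2sq (\<lambda>\<zeta>. F (real m) \<zeta> - F (real n) \<zeta>) \<le> e" if "e > 0" for e
  proof -
    have "(\<lambda>n. L2sq (\<lambda>z. t (real n) z - f z)) \<longlonglongrightarrow> 0"
      by (rule filterlim_compose[OF lim filterlim_real_sequentially])
    from LIMSEQ_D[OF this, of "e / (16 * pi\<^sup>2)"] that obtain N
      where N': "\<forall>n\<ge>N. L2sq (\<lambda>z. t (real n) z - f z) < e / (16 * pi\<^sup>2)" by auto
    have N: "L2sq (\<lambda>z. t (real n) z - f z) \<le> e / (16 * pi\<^sup>2)" if "n \<ge> N" for n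
      using N' that by (simp add: less_imp_le)
    have "L2sq (\<lambda>\<zeta>. F (real m) \<zeta> - F (real n) \<zeta>) \<le> e" if "m \<ge> N" "n \<ge> N" for m n
    proof -
      have "4 * pi\<^sup>2 * (2 * L2sq (\<lambda>z. t (real m) z - f z) + 2 * L2sq (\<lambda>z. t (real n) z - f z))
          \<le> 4 * pi\<^sup>2 * (4 * (e / (16 * pi\<^sup>2)))"
        using N[OF that(1)] N[OF that(2)] by (intro mult_left_mono) auto
      then show ?thesis using dist_le[of "real m" "real n"] by simp
    qed
    then show ?thesis by blast
  qed
  obtain g where g: "g \<in> L2" "(\<lambda>n. L2sq (\<lambda>z. F (real n) z - g z)) \<longlonglongrightarrow> 0"
    using Riesz_Fischer[of "\<lambda>n. F (real n)", OF FL Cau] by blast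
  have "((\<lambda>R. L2sq (\<lambda>\<zeta>. F R \<zeta> - g \<zeta>)) \<longlongrightarrow> 0) at_top"
  proof (rule tendsto_at_topI_sequentially)
    fix X :: "nat \<Rightarrow> real" assume X: "filterlim X at_top sequentially"
    have "(\<lambda>n. L2sq (\<lambda>\<zeta>. F (X n) \<zeta> - F (real n) \<zeta>)) \<longlonglongrightarrow> 0"
    proof (rule tendsto_sandwich[OF _ _ tendsto_const])
      show "(\<lambda>n. 4 * pi\<^sup>2 * (2 * L2sq (\<lambda>z. t (X n) z - f z) + 2 * L2sq (\<lambda>z. t (real n) z - f z))) \<longlonglongrightarrow> 0"
        by (auto intro!: tendsto_eq_intros filterlim_compose[OF lim] X filterlim_real_sequentially)
    qed (use dist_le in auto)
    then show "(\<lambda>n. L2sq (\<lambda>\<zeta>. F (X n) \<zeta> - g \<zeta>)) \<longlonglongrightarrow> 0"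
      by (rule L2_tendsto_combine[OF FL FL g(1) _ g(2)])
  qed
  then have "has_fourier f g" unfolding has_fourier_iff F_def t_def using f g(1) by simp
  then show ?thesis by (rule that)
qed

lemma has_fourier_add:
  assumes "has_fourier f g" "has_fourier f' g'"
  shows "has_fourier (\<lambda>z. f z + f' z) (\<lambda>z. g z + g' z)"
proof -
  note L = has_fourier_L2[OF assms(1)] has_fourier_L2[OF assms(2)]
  let ?t = "\<lambda>R f z. indicator (cball 0 R) z * f z"
  have "fourier_integral (?t R (\<lambda>z. f z + f' z)) \<zeta> = fourier_integral (?t R f) \<zeta> + fourier_integral (?t R f') \<zeta>" for R \<zeta>
    using fourier_integral_add[OF L2_truncate_integrable[OF L(1)] L2_truncate_integrable[OF L(3)]]
    by (simp add: distrib_left)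
  then have eq: "fourier_integral (?t R (\<lambda>z. f z + f' z)) \<zeta> - (g \<zeta> + g' \<zeta>)
    = (fourier_integral (?t R f) \<zeta> - g \<zeta>) + (fourier_integral (?t R f') \<zeta> - g' \<zeta>)" for R \<zeta> by simp
  have "((\<lambda>R. L2sq (\<lambda>\<zeta>. fourier_integral (?t R (\<lambda>z. f z + f' z)) \<zeta> - (g \<zeta> + g' \<zeta>))) \<longlongrightarrow> 0) at_top"
    unfolding eq
  proof (rule tendsto_sandwich[OF _ _ tendsto_const])
    show "((\<lambda>R. 2 * L2sq (\<lambda>\<zeta>. fourier_integral (?t R f) \<zeta> - g \<zeta>)
        + 2 * L2sq (\<lambda>\<zeta>. fourier_integral (?t R f') \<zeta> - g' \<zeta>)) \<longlongrightarrow> 0) at_top"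
      using assms unfolding has_fourier_iff by (auto intro!: tendsto_eq_intros)
    show "\<forall>\<^sub>F R in at_top. L2sq (\<lambda>\<zeta>. fourier_integral (?t R f) \<zeta> - g \<zeta> + (fourier_integral (?t R f') \<zeta> - g' \<zeta>))
       \<le> 2 * L2sq (\<lambda>\<zeta>. fourier_integral (?t R f) \<zeta> - g \<zeta>) + 2 * L2sq (\<lambda>\<zeta>. fourier_integral (?t R f') \<zeta> - g' \<zeta>)"
      by (intro always_eventually allI L2sq_add_le L2_diff fourier_truncate_L2 L)
  qed simp
  then show ?thesis unfolding has_fourier_iff using L by (simp add: L2_add)
qed

lemma has_fourier_scale:
  assumes "has_fourier f g"
  shows "has_fourier (\<lambda>z. c * f z) (\<lambda>z. c * g z)"
proof -
  note L = has_fourier_L2[OF assms]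
  let ?t = "\<lambda>R f z. indicator (cball 0 R) z * f z"
  have "fourier_integral (?t R (\<lambda>z. c * f z)) \<zeta> = c * fourier_integral (?t R f) \<zeta>" for R \<zeta>
    using fourier_integral_scale[of c "?t R f" \<zeta>] by (simp add: mult.left_commute)
  then have "fourier_integral (?t R (\<lambda>z. c * f z)) \<zeta> - c * g \<zeta> = c * (fourier_integral (?t R f) \<zeta> - g \<zeta>)" for R \<zeta>
    by (simp add: right_diff_distrib)
  then have "((\<lambda>R. L2sq (\<lambda>\<zeta>. fourier_integral (?t R (\<lambda>z. c * f z)) \<zeta> - c * g \<zeta>)) \<longlongrightarrow> 0) at_top"
    using assms unfolding has_fourier_iff by (auto simp: L2sq_scale intro!: tendsto_eq_intros)
  then show ?thesis unfolding has_fourier_iff using L by (simp add: L2_scale)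
qed

lemma has_fourier_diff:
  assumes "has_fourier f g" "has_fourier f' g'"
  shows "has_fourier (\<lambda>z. f z - f' z) (\<lambda>z. g z - g' z)"
  using has_fourier_add[OF assms(1) has_fourier_scale[OF assms(2), of "-1"]] by simp

lemma has_fourier_cong_AE:
  assumes "has_fourier f g" "AE z in lborel. f z = f' z" "AE z in lborel. g z = g' z"
    and [measurable]: "f' \<in> borel_measurable borel" "g' \<in> borel_measurable borel"
  shows "has_fourier f' g'"
proof -
  note L = has_fourier_L2[OF assms(1)]
  note [measurable] = L2_measurable[OF L(1)] L2_measurable[OF L(2)]
  have f': "f' \<in> L2"
    by (rule L2_Fatou(1)[where f="\<lambda>_. f" and c="L2sq f"]) (use assms(2) L in auto)
  have g': "g' \<in> L2"
    by (rule L2_Fatou(1)[where f="\<lambda>_. g" and c="L2sq g"]) (use assms(3) L in auto)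
  have "fourier_integral (\<lambda>z. indicator (cball 0 R) z * f' z) = fourier_integral (\<lambda>z. indicator (cball 0 R) z * f z)" for R
    unfolding fourier_integral_def using assms(2) by (intro ext integral_cong_AE) auto
  moreover have "L2sq (\<lambda>\<zeta>. fourier_integral (\<lambda>z. indicator (cball 0 R) z * f z) \<zeta> - g' \<zeta>)
     = L2sq (\<lambda>\<zeta>. fourier_integral (\<lambda>z. indicator (cball 0 R) z * f z) \<zeta> - g \<zeta>)" for R
    by (rule L2sq_cong_AE) (use assms(3) in auto)
  ultimately show ?thesis using assms(1) f' g' by (simp add: has_fourier_iff)
qed

lemma has_fourier_unique:
  assumes "has_fourier f g" "has_fourier f' g'" "AE z in lborel. f z = f' z"
  shows "AE \<zeta> in lborel. g \<zeta> = g' \<zeta>"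
proof -
  note L = has_fourier_L2[OF assms(1)] has_fourier_L2[OF assms(2)]
  have "L2sq (\<lambda>z. f z - f' z) = 0"
    using assms(3) by (subst L2sq_eq_0_iff) (auto intro: L2_diff L)
  then have "L2sq (\<lambda>z. g z - g' z) = 0"
    using has_fourier_Plancherel[OF has_fourier_diff[OF assms(1,2)]] by simp
  then show ?thesis using L2sq_eq_0_iff[OF L2_diff[OF L(2,4)]] by auto
qed

lemma has_fourier_integrable:
  assumes "integrable lborel f" "f \<in> L2"
  shows "has_fourier f (fourier_integral f)"
proof -
  have "((\<lambda>R. 4 * pi\<^sup>2 * L2sq (\<lambda>z. indicator (cball 0 R) z * f z - f z)) \<longlongrightarrow> 4 * pi\<^sup>2 * 0) at_top"
    by (intro tendsto_intros L2_truncate_tendsto assms)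
  then show ?thesis
    using assms by (simp add: has_fourier_iff Plancherel_integrable fourier_integral_dist L2_truncate_integrable)
qed

text \<open>
  The graph of the Fourier transform is closed. Hence identities for it have to be checked only on
  truncations, where the transform is an integral.
\<close>

lemma has_fourier_limit:
  assumes "\<And>n::nat. has_fourier (f n) (g n)" "f' \<in> L2" "g' \<in> L2"
    and "(\<lambda>n. L2sq (\<lambda>z. f n z - f' z)) \<longlonglongrightarrow> 0" "(\<lambda>n. L2sq (\<lambda>z. g n z - g' z)) \<longlonglongrightarrow> 0"
  shows "has_fourier f' g'"
proof -
  obtain k where k: "has_fourier f' k" using has_fourier_exists[OF assms(2)] .
  note L = has_fourier_L2(2)[OF assms(1)] has_fourier_L2(2)[OF k]
  have "(\<lambda>n. L2sq (\<lambda>z. k z - g n z)) \<longlonglongrightarrow> 0"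
    using tendsto_mult_left[OF assms(4), of "4 * pi\<^sup>2"]
    by (simp add: has_fourier_Plancherel[OF has_fourier_diff[OF k assms(1)]] L2sq_diff_commute[of f'])
  then have "(\<lambda>n. L2sq (\<lambda>z. k z - g' z)) \<longlonglongrightarrow> 0"
    by (rule L2_tendsto_combine[OF L(2,1) assms(3) _ assms(5)])
  then have "L2sq (\<lambda>z. k z - g' z) = 0" using LIMSEQ_unique tendsto_const by blast
  then have "AE z in lborel. k z = g' z"
    using L2sq_eq_0_iff[OF L2_diff[OF L(2) assms(3)]] by auto
  then show ?thesis
    by (intro has_fourier_cong_AE[OF k]) (auto intro: L2_measurable assms)
qed

definition FT :: "(plane \<Rightarrow> complex) \<Rightarrow> plane \<Rightarrow> complex" where
  "FT f = (SOME g. has_fourier f g)"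

lemma has_fourier_FT: "f \<in> L2 \<Longrightarrow> has_fourier f (FT f)"
  unfolding FT_def using has_fourier_exists[of f] someI[of "has_fourier f"] by blast

lemma FT_L2 [simp]: "f \<in> L2 \<Longrightarrow> FT f \<in> L2"
  using has_fourier_FT has_fourier_L2 by blast

lemma FT_eqI: "has_fourier f g \<Longrightarrow> AE \<zeta> in lborel. FT f \<zeta> = g \<zeta>"
  by (rule has_fourier_unique[of f _ f]) (auto intro: has_fourier_FT has_fourier_L2)

lemma FT_cong_AE: "f \<in> L2 \<Longrightarrow> g \<in> L2 \<Longrightarrow> AE z in lborel. f z = g z \<Longrightarrow> AE \<zeta> in lborel. FT f \<zeta> = FT g \<zeta>"
  by (rule has_fourier_unique[OF has_fourier_FT has_fourier_FT])

lemma FT_add: "f \<in> L2 \<Longrightarrow> g \<in> L2 \<Longrightarrow> AE \<zeta> in lborel. FT (\<lambda>z. f z + g z) \<zeta> = FT f \<zeta> + FT g \<zeta>"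
  by (intro FT_eqI has_fourier_add has_fourier_FT)

lemma FT_diff: "f \<in> L2 \<Longrightarrow> g \<in> L2 \<Longrightarrow> AE \<zeta> in lborel. FT (\<lambda>z. f z - g z) \<zeta> = FT f \<zeta> - FT g \<zeta>"
  by (intro FT_eqI has_fourier_diff has_fourier_FT)

lemma FT_scale: "f \<in> L2 \<Longrightarrow> AE \<zeta> in lborel. FT (\<lambda>z. c * f z) \<zeta> = c * FT f \<zeta>"
  by (intro FT_eqI has_fourier_scale has_fourier_FT)

lemma L2sq_FT: "f \<in> L2 \<Longrightarrow> L2sq (FT f) = 4 * pi\<^sup>2 * L2sq f"
  by (intro has_fourier_Plancherel has_fourier_FT)

text \<open>
  Plancherel for \<open>f + g\<close> gives the real parts, and the imaginary parts follow with \<open>\<i> g\<close> in place of \<open>g\<close>.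
\<close>

lemma Parseval:
  assumes f: "f \<in> L2" and g: "g \<in> L2"
  shows "L2_inner (FT f) (FT g) = 4 * pi\<^sup>2 * L2_inner f g"
proof -
  have re: "Re (L2_inner (FT f) (FT g)) = 4 * pi\<^sup>2 * Re (L2_inner f g)" if g: "g \<in> L2" for g
  proof -
    have "L2sq (\<lambda>z. FT f z + FT g z) = 4 * pi\<^sup>2 * L2sq (\<lambda>z. f z + g z)"
      by (intro has_fourier_Plancherel has_fourier_add has_fourier_FT f g)
    then show ?thesis
      unfolding L2sq_add[OF f g] L2sq_add[OF FT_L2[OF f] FT_L2[OF g]] L2sq_FT[OF f] L2sq_FT[OF g]
      by (simp add: algebra_simps)
  qed
  have "L2_inner (FT f) (FT (\<lambda>z. \<i> * g z)) = L2_inner (FT f) (\<lambda>z. \<i> * FT g z)"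
    by (intro L2_inner_cong_AE FT_scale g) (auto intro!: L2_measurable FT_L2 L2_scale f g)
  then have "Im (L2_inner (FT f) (FT g)) = 4 * pi\<^sup>2 * Im (L2_inner f g)"
    using re[OF L2_scale[OF g, of \<i>]] by (simp add: L2_inner_scale_right)
  then show ?thesis using re[OF g] by (simp add: complex_eq_iff)
qed

lemma L2_inner_tendsto2:
  assumes "\<And>n::nat. f n \<in> L2" "g \<in> L2" "\<And>n. f' n \<in> L2" "g' \<in> L2"
    and "(\<lambda>n. L2sq (\<lambda>z. f n z - g z)) \<longlonglongrightarrow> 0" "(\<lambda>n. L2sq (\<lambda>z. f' n z - g' z)) \<longlonglongrightarrow> 0"
  shows "(\<lambda>n. L2_inner (f n) (f' n)) \<longlonglongrightarrow> L2_inner g g'"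
proof -
  have "(\<lambda>n. L2norm (f n) * L2norm (\<lambda>z. f' n z - g' z)) \<longlonglongrightarrow> L2norm g * 0"
    by (intro tendsto_mult L2norm_tendsto(1)) (use assms in \<open>auto simp: L2norm_tendsto_0_iff\<close>)
  then have lim: "(\<lambda>n. L2norm (f n) * L2norm (\<lambda>z. f' n z - g' z)) \<longlonglongrightarrow> 0" by simp
  have "(\<lambda>n. L2_inner (f n) (\<lambda>z. f' n z - g' z)) \<longlonglongrightarrow> 0"
    by (rule Lim_null_comparison[OF _ lim]) (use L2_inner_bound[OF assms(1) L2_diff[OF assms(3,4)]] in auto)
  moreover have "(\<lambda>n. L2_inner (f n) g') \<longlonglongrightarrow> L2_inner g g'"
    by (rule L2_inner_tendsto) (use assms in auto)
  ultimately have "(\<lambda>n. L2_inner (f n) (\<lambda>z. f' n z - g' z) + L2_inner (f n) g') \<longlonglongrightarrow> 0 + L2_inner g g'"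
    by (rule tendsto_add)
  then show ?thesis by (simp add: L2_inner_diff_right[OF assms(3,4,1)])
qed

lemma FT_truncate_tendsto:
  assumes "f \<in> L2"
  shows "(\<lambda>n. L2sq (\<lambda>\<zeta>. fourier_integral (\<lambda>z. indicator (cball 0 (real n)) z * f z) \<zeta> - FT f \<zeta>)) \<longlonglongrightarrow> 0"
  using has_fourier_FT[OF assms] unfolding has_fourier_iff
  by (auto intro: filterlim_compose[OF _ filterlim_real_sequentially])

lemma FT_multiplication_formula:
  assumes f: "f \<in> L2" and g: "g \<in> L2"
  shows "L2_inner (FT f) (\<lambda>z. cnj (g z)) = L2_inner f (\<lambda>z. cnj (FT g z))"
proof (rule LIMSEQ_unique)
  let ?t = "\<lambda>n f z. indicator (cball 0 (real n)) z * f z"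
  have cn: "L2sq (\<lambda>z. cnj (u z) - cnj (v z)) = L2sq (\<lambda>z. u z - v z)" for u v
    using L2sq_cnj[of "\<lambda>z. u z - v z"] by simp
  show "(\<lambda>n. L2_inner (fourier_integral (?t n f)) (\<lambda>z. cnj (?t n g z))) \<longlonglongrightarrow> L2_inner (FT f) (\<lambda>z. cnj (g z))"
    by (intro L2_inner_tendsto2 fourier_truncate_L2 FT_L2 L2_cnj truncate_L2 f g FT_truncate_tendsto)
       (unfold cn, rule L2_truncate_tendsto_nat[OF g])
  have "(\<lambda>n. L2_inner (?t n f) (\<lambda>z. cnj (fourier_integral (?t n g) z))) \<longlonglongrightarrow> L2_inner f (\<lambda>z. cnj (FT g z))"
    by (intro L2_inner_tendsto2 fourier_truncate_L2 FT_L2 L2_cnj truncate_L2 f g L2_truncate_tendsto_nat)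
       (unfold cn, rule FT_truncate_tendsto[OF g])
  moreover have "L2_inner (?t n f) (\<lambda>z. cnj (fourier_integral (?t n g) z)) =
      L2_inner (fourier_integral (?t n f)) (\<lambda>z. cnj (?t n g z))" for n
    using fourier_multiplication_formula[OF L2_truncate_integrable[OF f] L2_truncate_integrable[OF g]]
    unfolding L2_inner_def by (simp add: mult.commute)
  ultimately show "(\<lambda>n. L2_inner (fourier_integral (?t n f)) (\<lambda>z. cnj (?t n g z))) \<longlonglongrightarrow> L2_inner f (\<lambda>z. cnj (FT g z))"
    by simp
qed

text \<open>
  The candidate is \<open>f = cnj (FT (cnj g)) / (4 \<pi>\<^sup>2)\<close>. The multiplication formula gives
  \<open>L2_inner (FT f) g = L2sq g\<close>, and Plancherel, used twice, gives \<open>L2sq (FT f) = L2sq g\<close>.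
  Therefore \<open>L2sq (FT f - g) = 0\<close>.
\<close>

theorem FT_surj:
  assumes g: "g \<in> L2"
  obtains f where "f \<in> L2" "has_fourier f g"
proof -
  define c where "c = 4 * pi\<^sup>2"
  have c: "c > 0" by (simp add: c_def)
  define k where "k = FT (\<lambda>z. cnj (g z))"
  have k: "k \<in> L2" unfolding k_def by (intro FT_L2 L2_cnj g)
  have kn: "L2sq k = c * L2sq g" unfolding k_def c_def using L2sq_FT[OF L2_cnj[OF g]] by (simp add: L2sq_cnj)
  define f where "f = (\<lambda>z. complex_of_real (1/c) * cnj (k z))"
  have f: "f \<in> L2" unfolding f_def by (intro L2_scale L2_cnj k)
  have fn: "L2sq (FT f) = L2sq g"
  proof -
    have "L2sq (FT f) = c * ((1/c)\<^sup>2 * (c * L2sq g))"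
      unfolding L2sq_FT[OF f] unfolding f_def L2sq_scale L2sq_cnj kn norm_of_real power2_abs c_def ..
    then show ?thesis using c by (simp add: power2_eq_square)
  qed
  have "L2_inner (FT f) g = L2_inner f (\<lambda>z. cnj (k z))"
    using FT_multiplication_formula[OF f L2_cnj[OF g]] by (simp add: k_def)
  also have "\<dots> = complex_of_real (1/c) * L2_inner (\<lambda>z. cnj (k z)) (\<lambda>z. cnj (k z))"
    unfolding f_def by (rule L2_inner_scale_left)
  also have "\<dots> = complex_of_real (L2sq g)"
    unfolding L2_inner_self L2sq_cnj kn using c by simp
  finally have "L2sq (\<lambda>z. FT f z - g z) = 0"
    unfolding L2sq_diff[OF FT_L2[OF f] g] fn by simp
  then have "AE z in lborel. FT f z = g z"
    using L2sq_eq_0_iff[OF L2_diff[OF FT_L2[OF f] g]] by auto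
  then have "has_fourier f g"
    by (intro has_fourier_cong_AE[OF has_fourier_FT[OF f]]) (auto intro: L2_measurable f g)
  with f show ?thesis by (rule that)
qed

text \<open>
  The change of variables deforms the balls in the limit in the mean. So the formula is
  first obtained for truncations and then carried over with \<open>has_fourier_limit\<close>.
\<close>

lemma has_fourier_aff:
  assumes "\<alpha> \<noteq> 0" "\<beta> \<noteq> 0" and f: "f \<in> L2"
  shows "has_fourier (\<lambda>z. f (aff \<alpha> \<beta> h z))
    (\<lambda>\<zeta>. complex_of_real (1 / \<bar>\<alpha> * \<beta>\<bar>) * (cis (h \<bullet> aff (1/\<alpha>) (1/\<beta>) 0 \<zeta>) * FT f (aff (1/\<alpha>) (1/\<beta>) 0 \<zeta>)))"
proof -
  define S where "S g = (\<lambda>\<zeta>. complex_of_real (1 / \<bar>\<alpha> * \<beta>\<bar>) * (cis (h \<bullet> aff (1/\<alpha>) (1/\<beta>) 0 \<zeta>) * g (aff (1/\<alpha>) (1/\<beta>) 0 \<zeta>)))" for g :: "plane \<Rightarrow> complex"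
  have nz: "1/\<alpha> \<noteq> 0" "1/\<beta> \<noteq> 0" using assms by auto
  have SL: "S g \<in> L2" if g: "g \<in> L2" for g
  proof -
    note [measurable] = L2_measurable[OF g]
    have "(\<lambda>\<zeta>. cis (h \<bullet> aff (1/\<alpha>) (1/\<beta>) 0 \<zeta>) * g (aff (1/\<alpha>) (1/\<beta>) 0 \<zeta>)) \<in> L2"
      by (rule L2_bound(1)[OF L2_aff[OF nz g, of 0], where B=1]) (auto simp: norm_mult)
    then show ?thesis unfolding S_def by (rule L2_scale)
  qed
  have Sd: "L2sq (\<lambda>\<zeta>. S g \<zeta> - S g' \<zeta>) = (1 / \<bar>\<alpha> * \<beta>\<bar>)\<^sup>2 * (L2sq (\<lambda>\<zeta>. g \<zeta> - g' \<zeta>) / \<bar>1/\<alpha> * (1/\<beta>)\<bar>)" for g g'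
  proof -
    have "S g \<zeta> - S g' \<zeta> = complex_of_real (1 / \<bar>\<alpha> * \<beta>\<bar>) * (cis (h \<bullet> aff (1/\<alpha>) (1/\<beta>) 0 \<zeta>) *
       (\<lambda>\<zeta>. g \<zeta> - g' \<zeta>) (aff (1/\<alpha>) (1/\<beta>) 0 \<zeta>))" for \<zeta>
      by (simp add: S_def algebra_simps)
    moreover have "L2sq (\<lambda>\<zeta>. cis (h \<bullet> aff (1/\<alpha>) (1/\<beta>) 0 \<zeta>) * (\<lambda>\<zeta>. g \<zeta> - g' \<zeta>) (aff (1/\<alpha>) (1/\<beta>) 0 \<zeta>))
        = L2sq (\<lambda>\<zeta>. (\<lambda>\<zeta>. g \<zeta> - g' \<zeta>) (aff (1/\<alpha>) (1/\<beta>) 0 \<zeta>))"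
      by (simp add: L2sq_def norm_mult)
    ultimately show ?thesis
      using L2sq_aff[OF nz, of "\<lambda>\<zeta>. g \<zeta> - g' \<zeta>" 0]
      by (simp only: L2sq_scale norm_of_real power2_abs)
  qed
  have FI: "fourier_integral (\<lambda>z. g (aff \<alpha> \<beta> h z)) = S (fourier_integral g)" for g
  proof
    fix \<zeta> :: plane
    have "fourier_integral (\<lambda>z. g (aff \<alpha> \<beta> h z)) \<zeta> =
      (LINT z|lborel. (\<lambda>w. cis (h \<bullet> aff (1/\<alpha>) (1/\<beta>) 0 \<zeta>) * (cis (- (w \<bullet> aff (1/\<alpha>) (1/\<beta>) 0 \<zeta>)) * g w)) (aff \<alpha> \<beta> h z))"
      unfolding fourier_integral_def
    proof (intro Bochner_Integration.integral_cong refl)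
      fix w :: plane
      have "- (w \<bullet> \<zeta>) = h \<bullet> aff (1/\<alpha>) (1/\<beta>) 0 \<zeta> - aff \<alpha> \<beta> h w \<bullet> aff (1/\<alpha>) (1/\<beta>) 0 \<zeta>"
        using assms(1,2) by (simp add: aff_def inner_prod_def field_simps)
      then have "cis (- (w \<bullet> \<zeta>)) = cis (h \<bullet> aff (1/\<alpha>) (1/\<beta>) 0 \<zeta>) * cis (- (aff \<alpha> \<beta> h w \<bullet> aff (1/\<alpha>) (1/\<beta>) 0 \<zeta>))"
        by (simp add: cis_mult)
      then show "cis (- (w \<bullet> \<zeta>)) * g (aff \<alpha> \<beta> h w) =
        cis (h \<bullet> aff (1/\<alpha>) (1/\<beta>) 0 \<zeta>) * (cis (- (aff \<alpha> \<beta> h w \<bullet> aff (1/\<alpha>) (1/\<beta>) 0 \<zeta>)) * g (aff \<alpha> \<beta> h w))"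
        by (simp only: mult.assoc)
    qed
    also have "\<dots> = S (fourier_integral g) \<zeta>"
      using assms(1,2) by (subst integral_aff) (auto simp: S_def fourier_integral_def scaleR_conv_of_real)
    finally show "fourier_integral (\<lambda>z. g (aff \<alpha> \<beta> h z)) \<zeta> = S (fourier_integral g) \<zeta>" .
  qed
  let ?t = "\<lambda>n z. indicator (cball 0 (real n)) z * f z"
  have "has_fourier (\<lambda>z. f (aff \<alpha> \<beta> h z)) (S (FT f))"
  proof (rule has_fourier_limit)
    show "has_fourier (\<lambda>z. ?t n (aff \<alpha> \<beta> h z)) (S (fourier_integral (?t n)))" for n
      unfolding FI[symmetric]
      by (intro has_fourier_integrable integrable_aff[where f="?t n"] L2_aff[where u="?t n"] L2_truncate_integrable truncate_L2 assms)
    show "(\<lambda>n. L2sq (\<lambda>z. ?t n (aff \<alpha> \<beta> h z) - f (aff \<alpha> \<beta> h z))) \<longlonglongrightarrow> 0"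
      using tendsto_divide[OF L2_truncate_tendsto_nat[OF f] tendsto_const, of "\<bar>\<alpha> * \<beta>\<bar>"] assms(1,2)
        L2sq_aff[OF assms(1,2), of "\<lambda>z. ?t n z - f z" h for n] by simp
    show "(\<lambda>n. L2sq (\<lambda>z. S (fourier_integral (?t n)) z - S (FT f) z)) \<longlonglongrightarrow> 0"
      unfolding Sd using assms(1,2)
      by (auto intro!: tendsto_eq_intros FT_truncate_tendsto[OF f])
  qed (use L2_aff assms SL in auto)
  then show ?thesis by (simp add: S_def)
qed

lemma has_fourier_cnj:
  assumes f: "f \<in> L2"
  shows "has_fourier (\<lambda>z. cnj (f z)) (\<lambda>\<zeta>. cnj (FT f (- \<zeta>)))"
proof -
  have m: "- \<zeta> = aff (-1) (-1) 0 \<zeta>" for \<zeta> :: plane by (simp add: aff_def prod_eq_iff)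
  have cn: "L2sq (\<lambda>z. cnj (u z) - cnj (v z)) = L2sq (\<lambda>z. u z - v z)" for u v
    using L2sq_cnj[of "\<lambda>z. u z - v z"] by simp
  have FI: "fourier_integral (\<lambda>z. cnj (g z)) = (\<lambda>\<zeta>. cnj (fourier_integral g (- \<zeta>)))" for g
  proof
    fix \<zeta> :: plane
    have "fourier_integral (\<lambda>z. cnj (g z)) \<zeta> = (LINT z|lborel. cnj (cis (- (z \<bullet> (- \<zeta>))) * g z))"
      unfolding fourier_integral_def by (simp add: cis_cnj)
    also have "\<dots> = cnj (fourier_integral g (- \<zeta>))"
      unfolding fourier_integral_def by (rule Bochner_Integration.integral_cnj)
    finally show "fourier_integral (\<lambda>z. cnj (g z)) \<zeta> = cnj (fourier_integral g (- \<zeta>))" .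
  qed
  let ?t = "\<lambda>n z. indicator (cball 0 (real n)) z * f z"
  show ?thesis
  proof (rule has_fourier_limit)
    show "has_fourier (\<lambda>z. cnj (?t n z)) (\<lambda>\<zeta>. cnj (fourier_integral (?t n) (- \<zeta>)))" for n
      unfolding FI[symmetric]
      by (intro has_fourier_integrable L2_cnj truncate_L2 f integrable_cnj L2_truncate_integrable)
    show "(\<lambda>n. L2sq (\<lambda>z. cnj (?t n z) - cnj (f z))) \<longlonglongrightarrow> 0"
      unfolding cn by (rule L2_truncate_tendsto_nat[OF f])
    show "(\<lambda>n. L2sq (\<lambda>\<zeta>. cnj (fourier_integral (?t n) (- \<zeta>)) - cnj (FT f (- \<zeta>)))) \<longlonglongrightarrow> 0"
      unfolding cn using FT_truncate_tendsto[OF f]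
        L2sq_aff[of "-1" "-1" "\<lambda>\<zeta>. fourier_integral (?t n) \<zeta> - FT f \<zeta>" 0 for n] by (simp add: m)
    show "(\<lambda>\<zeta>. cnj (FT f (- \<zeta>))) \<in> L2" unfolding m by (intro L2_cnj L2_aff FT_L2 f) auto
  qed (intro L2_cnj f)
qed

section \<open>Fourier multipliers\<close>

lemma has_multiplier_iff:
  assumes [measurable]: "m \<in> borel_measurable borel"
  shows "has_multiplier m u v \<longleftrightarrow> u \<in> L2 \<and> v \<in> L2 \<and> (AE \<zeta> in lborel. FT v \<zeta> = m \<zeta> * FT u \<zeta>)"
proof
  assume "has_multiplier m u v"
  then obtain g h where gh: "has_fourier u g" "has_fourier v h" "AE \<zeta> in lborel. h \<zeta> = m \<zeta> * g \<zeta>"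
    by (auto simp: has_multiplier_def)
  have "AE \<zeta> in lborel. FT v \<zeta> = m \<zeta> * FT u \<zeta>"
    using FT_eqI[OF gh(1)] FT_eqI[OF gh(2)] gh(3) by eventually_elim simp
  then show "u \<in> L2 \<and> v \<in> L2 \<and> (AE \<zeta> in lborel. FT v \<zeta> = m \<zeta> * FT u \<zeta>)"
    using has_fourier_L2[OF gh(1)] has_fourier_L2[OF gh(2)] by simp
next
  assume "u \<in> L2 \<and> v \<in> L2 \<and> (AE \<zeta> in lborel. FT v \<zeta> = m \<zeta> * FT u \<zeta>)"
  then show "has_multiplier m u v"
    unfolding has_multiplier_def by (intro exI[of _ "FT u"] exI[of _ "FT v"]) (auto intro: has_fourier_FT)
qed

text \<open>
  By surjectivity of the Fourier transform every square-integrable \<open>m * FT u\<close> is a transform.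
\<close>

lemma ex_multiplier_iff:
  assumes [measurable]: "m \<in> borel_measurable borel" and u: "u \<in> L2"
  shows "(\<exists>v. has_multiplier m u v) \<longleftrightarrow> (\<lambda>\<zeta>. m \<zeta> * FT u \<zeta>) \<in> L2"
proof
  note [measurable] = L2_measurable[OF FT_L2[OF u]]
  assume "\<exists>v. has_multiplier m u v"
  then obtain v where v: "v \<in> L2" "AE \<zeta> in lborel. FT v \<zeta> = m \<zeta> * FT u \<zeta>" by (auto simp: has_multiplier_iff)
  show "(\<lambda>\<zeta>. m \<zeta> * FT u \<zeta>) \<in> L2"
    by (rule L2_Fatou(1)[where f="\<lambda>_. FT v" and c="L2sq (FT v)"]) (use v in auto)
next
  assume *: "(\<lambda>\<zeta>. m \<zeta> * FT u \<zeta>) \<in> L2"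
  obtain v where v: "v \<in> L2" "has_fourier v (\<lambda>\<zeta>. m \<zeta> * FT u \<zeta>)" using FT_surj[OF *] .
  then show "\<exists>v. has_multiplier m u v"
    using u by (auto simp: has_multiplier_def intro: has_fourier_FT)
qed

lemma multiplier_L2_FT:
  assumes "m \<in> borel_measurable borel" "u \<in> L2" "(\<lambda>\<zeta>. m \<zeta> * FT u \<zeta>) \<in> L2"
  shows "multiplier m u \<in> L2" "AE \<zeta> in lborel. FT (multiplier m u) \<zeta> = m \<zeta> * FT u \<zeta>"
proof -
  have "\<exists>v. has_multiplier m u v" using ex_multiplier_iff[OF assms(1,2)] assms(3) by simp
  then have "has_multiplier m u (multiplier m u)" unfolding multiplier_def by (rule someI_ex)
  then show "multiplier m u \<in> L2" "AE \<zeta> in lborel. FT (multiplier m u) \<zeta> = m \<zeta> * FT u \<zeta>"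
    using has_multiplier_iff[OF assms(1)] by auto
qed

section \<open>The energy space in terms of the Fourier transform\<close>

text \<open>
  The symbol of \<open>- \<partial>\<^sub>x\<^sub>x + \<bar>D\<^sub>y\<bar>\<close>.
\<close>

definition weight :: "plane \<Rightarrow> real" where
  "weight \<zeta> = (fst \<zeta>)\<^sup>2 + \<bar>snd \<zeta>\<bar>"

text \<open>
  The transform of the square root of \<open>- \<partial>\<^sub>x\<^sub>x + \<bar>D\<^sub>y\<bar>\<close> applied to \<open>u\<close>. It replaces the pair of \<open>dx u\<close> and \<open>Dy (1/2) u\<close>: only their joint form enters the energy and the equation.
\<close>

definition WFT :: "(plane \<Rightarrow> complex) \<Rightarrow> plane \<Rightarrow> complex" where
  "WFT u \<zeta> = complex_of_real (sqrt (weight \<zeta>)) * FT u \<zeta>"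

definition dform :: "(plane \<Rightarrow> complex) \<Rightarrow> (plane \<Rightarrow> complex) \<Rightarrow> complex" where
  "dform u v = L2_inner (WFT u) (WFT v) / (4 * pi\<^sup>2)"

definition kin :: "(plane \<Rightarrow> complex) \<Rightarrow> real" where
  "kin u = L2sq (WFT u) / (4 * pi\<^sup>2)"

definition pot :: "real \<Rightarrow> (plane \<Rightarrow> complex) \<Rightarrow> real" where
  "pot q u = (LINT z|lborel. cmod (u z) powr q)"

lemma weight_measurable [measurable]: "weight \<in> borel_measurable borel"
  unfolding weight_def[abs_def] by (intro borel_measurable_continuous_onI continuous_intros)

lemma weight_nonneg [simp]: "weight \<zeta> \<ge> 0"
  by (simp add: weight_def)

lemma kin_nonneg [simp]: "kin u \<ge> 0"
  by (simp add: kin_def)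

lemma kin_dform: "complex_of_real (kin u) = dform u u"
  by (simp add: kin_def dform_def L2_inner_self)

lemma kin_eq_Re_dform: "kin u = Re (dform u u)"
  using kin_dform[of u] by (metis Re_complex_of_real)

lemma dx_symbol_measurable [measurable]: "dx_symbol \<in> borel_measurable borel"
proof -
  have eq: "dx_symbol = (\<lambda>z. \<i> * complex_of_real (fst z))" by (auto simp: dx_symbol_def fun_eq_iff)
  show ?thesis unfolding eq by (intro borel_measurable_continuous_onI continuous_intros)
qed

lemma Dy_symbol_measurable [measurable]: "Dy_symbol (1/2) \<in> borel_measurable borel"
proof -
  have eq: "Dy_symbol (1/2) = (\<lambda>z. complex_of_real (sqrt \<bar>snd z\<bar>))"
    by (auto simp: Dy_symbol_def fun_eq_iff powr_half_sqrt)
  show ?thesis unfolding eq by (intro borel_measurable_continuous_onI continuous_intros)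
qed

lemma cmod_dx_symbol: "(cmod (dx_symbol \<zeta>))\<^sup>2 = (fst \<zeta>)\<^sup>2"
  by (simp add: dx_symbol_def norm_mult split: prod.split)

lemma cmod_Dy_symbol: "(cmod (Dy_symbol (1/2) \<zeta>))\<^sup>2 = \<bar>snd \<zeta>\<bar>"
  by (simp add: Dy_symbol_def powr_half_sqrt split: prod.split)

lemma WFT_measurable [measurable]: "u \<in> L2 \<Longrightarrow> WFT u \<in> borel_measurable borel"
  using L2_measurable[OF FT_L2[of u]] unfolding WFT_def[abs_def] by measurable

lemma cmod_WFT: "(cmod (WFT u \<zeta>))\<^sup>2 = (cmod (dx_symbol \<zeta> * FT u \<zeta>))\<^sup>2 + (cmod (Dy_symbol (1/2) \<zeta> * FT u \<zeta>))\<^sup>2"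
  by (simp add: WFT_def norm_mult power_mult_distrib cmod_dx_symbol cmod_Dy_symbol weight_def distrib_right del: Dy_symbol_def)

lemma X_multipliers_iff:
  "u \<in> X \<longleftrightarrow> u \<in> L2 \<and> (\<lambda>\<zeta>. dx_symbol \<zeta> * FT u \<zeta>) \<in> L2 \<and> (\<lambda>\<zeta>. Dy_symbol (1/2) \<zeta> * FT u \<zeta>) \<in> L2"
  unfolding X_def using ex_multiplier_iff[of dx_symbol u] ex_multiplier_iff[of "Dy_symbol (1/2)" u] by auto

lemma X_iff: "u \<in> X \<longleftrightarrow> u \<in> L2 \<and> WFT u \<in> L2"
proof (cases "u \<in> L2")
  case True
  note [measurable] = L2_measurable[OF FT_L2[OF True]] WFT_measurable[OF True]
  have "WFT u \<in> L2" if "(\<lambda>\<zeta>. dx_symbol \<zeta> * FT u \<zeta>) \<in> L2" "(\<lambda>\<zeta>. Dy_symbol (1/2) \<zeta> * FT u \<zeta>) \<in> L2"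
    using that by (simp add: L2_iff cmod_WFT)
  moreover have "(\<lambda>\<zeta>. dx_symbol \<zeta> * FT u \<zeta>) \<in> L2" if "WFT u \<in> L2"
  proof (rule L2_bound(1)[OF that, where B=1])
    show "cmod (dx_symbol z * FT u z) \<le> 1 * cmod (WFT u z)" for z
      unfolding mult_1 by (rule power2_le_imp_le) (simp_all only: cmod_WFT norm_ge_zero le_add_same_cancel1 zero_le_power2)
  qed measurable
  moreover have "(\<lambda>\<zeta>. Dy_symbol (1/2) \<zeta> * FT u \<zeta>) \<in> L2" if "WFT u \<in> L2"
  proof (rule L2_bound(1)[OF that, where B=1])
    show "cmod (Dy_symbol (1/2) z * FT u z) \<le> 1 * cmod (WFT u z)" for z
      unfolding mult_1 by (rule power2_le_imp_le) (simp_all only: cmod_WFT norm_ge_zero le_add_same_cancel2 zero_le_power2)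
  qed measurable
  ultimately show ?thesis using True by (auto simp: X_multipliers_iff)
qed (auto simp: X_def)

lemma X_L2: "u \<in> X \<Longrightarrow> u \<in> L2"
  by (simp add: X_iff)

lemma WFT_L2: "u \<in> X \<Longrightarrow> WFT u \<in> L2"
  by (simp add: X_iff)

lemma Lnorm_2: "Lnorm 2 u = L2norm u"
  by (simp add: Lnorm_def L2norm_def L2sq_def powr_half_sqrt)

lemma multiplier_inner:
  assumes m: "m \<in> borel_measurable borel"
    and u: "u \<in> L2" "(\<lambda>\<zeta>. m \<zeta> * FT u \<zeta>) \<in> L2" and v: "v \<in> L2" "(\<lambda>\<zeta>. m \<zeta> * FT v \<zeta>) \<in> L2"
  shows "4 * pi\<^sup>2 * L2_inner (multiplier m u) (multiplier m v)
    = L2_inner (\<lambda>\<zeta>. m \<zeta> * FT u \<zeta>) (\<lambda>\<zeta>. m \<zeta> * FT v \<zeta>)"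
proof -
  note mu = multiplier_L2_FT[OF m u] and mv = multiplier_L2_FT[OF m v]
  show ?thesis
    unfolding Parseval[OF mu(1) mv(1), symmetric]
    by (intro L2_inner_cong_AE mu(2) mv(2)) (auto intro: L2_measurable FT_L2 mu mv u v)
qed

lemma dform_eq:
  assumes u: "u \<in> X" and v: "v \<in> X"
  shows "L2_inner (dx u) (dx v) + L2_inner (Dy (1/2) u) (Dy (1/2) v) = dform u v"
proof -
  have Lu: "u \<in> L2" "(\<lambda>\<zeta>. dx_symbol \<zeta> * FT u \<zeta>) \<in> L2" "(\<lambda>\<zeta>. Dy_symbol (1/2) \<zeta> * FT u \<zeta>) \<in> L2"
    using u by (auto simp: X_multipliers_iff)
  have Lv: "v \<in> L2" "(\<lambda>\<zeta>. dx_symbol \<zeta> * FT v \<zeta>) \<in> L2" "(\<lambda>\<zeta>. Dy_symbol (1/2) \<zeta> * FT v \<zeta>) \<in> L2"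
    using v by (auto simp: X_multipliers_iff)
  have cc: "a * cnj a = complex_of_real ((cmod a)\<^sup>2)" for a by (simp only: complex_norm_square)
  have eq: "WFT u \<zeta> * cnj (WFT v \<zeta>) = dx_symbol \<zeta> * FT u \<zeta> * cnj (dx_symbol \<zeta> * FT v \<zeta>)
      + Dy_symbol (1/2) \<zeta> * FT u \<zeta> * cnj (Dy_symbol (1/2) \<zeta> * FT v \<zeta>)" for \<zeta>
  proof -
    have "dx_symbol \<zeta> * FT u \<zeta> * cnj (dx_symbol \<zeta> * FT v \<zeta>)
      + Dy_symbol (1/2) \<zeta> * FT u \<zeta> * cnj (Dy_symbol (1/2) \<zeta> * FT v \<zeta>)
      = (dx_symbol \<zeta> * cnj (dx_symbol \<zeta>) + Dy_symbol (1/2) \<zeta> * cnj (Dy_symbol (1/2) \<zeta>)) * (FT u \<zeta> * cnj (FT v \<zeta>))"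
      by (simp add: algebra_simps)
    also have "\<dots> = complex_of_real (weight \<zeta>) * (FT u \<zeta> * cnj (FT v \<zeta>))"
      unfolding cc cmod_dx_symbol cmod_Dy_symbol weight_def by simp
    also have "complex_of_real (weight \<zeta>) = complex_of_real (sqrt (weight \<zeta>)) * complex_of_real (sqrt (weight \<zeta>))"
      unfolding of_real_mult[symmetric] by simp
    finally show ?thesis by (simp add: WFT_def mult_ac)
  qed
  have "L2_inner (WFT u) (WFT v) = L2_inner (\<lambda>\<zeta>. dx_symbol \<zeta> * FT u \<zeta>) (\<lambda>\<zeta>. dx_symbol \<zeta> * FT v \<zeta>)
    + L2_inner (\<lambda>\<zeta>. Dy_symbol (1/2) \<zeta> * FT u \<zeta>) (\<lambda>\<zeta>. Dy_symbol (1/2) \<zeta> * FT v \<zeta>)"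
    unfolding L2_inner_def eq
    by (rule Bochner_Integration.integral_add) (intro L2_prod_integrable(3) Lu Lv)+
  then have "L2_inner (WFT u) (WFT v) = 4 * pi\<^sup>2 * (L2_inner (dx u) (dx v) + L2_inner (Dy (1/2) u) (Dy (1/2) v))"
    using multiplier_inner[OF dx_symbol_measurable Lu(1,2) Lv(1,2)]
      multiplier_inner[OF Dy_symbol_measurable Lu(1,3) Lv(1,3)]
    by (simp add: distrib_left)
  then show ?thesis by (simp add: dform_def)
qed

lemma kin_eq:
  assumes "u \<in> X"
  shows "(Lnorm 2 (dx u))\<^sup>2 + (Lnorm 2 (Dy (1/2) u))\<^sup>2 = kin u"
proof -
  have "complex_of_real (L2sq (dx u) + L2sq (Dy (1/2) u)) = complex_of_real (kin u)"
    using dform_eq[OF assms assms] unfolding L2_inner_self kin_dform by simp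
  then show ?thesis by (simp only: of_real_eq_iff Lnorm_2 L2norm_power2)
qed

lemma X_norm_eq: "u \<in> X \<Longrightarrow> X_norm u = sqrt (kin u + L2sq u)"
  unfolding X_norm_def kin_eq by (simp add: Lnorm_2)

lemma X_norm_nonneg [simp]: "X_norm u \<ge> 0"
  by (simp add: X_norm_def)

lemma X_norm_power2: "u \<in> X \<Longrightarrow> (X_norm u)\<^sup>2 = kin u + L2sq u"
  by (simp add: X_norm_eq)

lemma mass_eq: "mass u = L2sq u / 2"
  by (simp add: mass_def Lnorm_2)

lemma pot_nonneg [simp]: "pot q u \<ge> 0"
  by (simp add: pot_def)

lemma energy_eq:
  assumes "u \<in> X" "p > 0"
  shows "energy p u = kin u / 2 - pot (p + 1) u / (p + 1)"
proof -
  have "Lnorm (p + 1) u powr (p + 1) = pot (p + 1) u"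
    using assms(2) pot_nonneg[of "p+1" u] by (simp add: Lnorm_def pot_def[symmetric] powr_powr)
  then show ?thesis using kin_eq[OF assms(1)] by (simp add: energy_def)
qed

section \<open>Operations on the energy space\<close>

lemma WFT_add: "u \<in> L2 \<Longrightarrow> v \<in> L2 \<Longrightarrow> AE \<zeta> in lborel. WFT (\<lambda>z. u z + v z) \<zeta> = WFT u \<zeta> + WFT v \<zeta>"
  using FT_add[of u v] by (auto simp: WFT_def distrib_left elim: eventually_mono)

lemma WFT_diff: "u \<in> L2 \<Longrightarrow> v \<in> L2 \<Longrightarrow> AE \<zeta> in lborel. WFT (\<lambda>z. u z - v z) \<zeta> = WFT u \<zeta> - WFT v \<zeta>"
  using FT_diff[of u v] by (auto simp: WFT_def right_diff_distrib elim: eventually_mono)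

lemma WFT_scale: "u \<in> L2 \<Longrightarrow> AE \<zeta> in lborel. WFT (\<lambda>z. c * u z) \<zeta> = c * WFT u \<zeta>"
  using FT_scale[of u c] by (auto simp: WFT_def elim: eventually_mono)

lemma WFT_cong_AE: "u \<in> L2 \<Longrightarrow> v \<in> L2 \<Longrightarrow> AE z in lborel. u z = v z \<Longrightarrow> AE \<zeta> in lborel. WFT u \<zeta> = WFT v \<zeta>"
  using FT_cong_AE[of u v] by (auto simp: WFT_def elim: eventually_mono)

lemma L2_cong_AE:
  assumes "u \<in> L2" "AE z in lborel. u z = v z" "v \<in> borel_measurable borel"
  shows "v \<in> L2"
  by (rule L2_Fatou(1)[where f="\<lambda>_. u" and c="L2sq u"]) (use assms in auto)

lemma XI:
  assumes "u \<in> L2" "g \<in> L2" "AE \<zeta> in lborel. WFT u \<zeta> = g \<zeta>"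
  shows "u \<in> X"
proof -
  have "AE \<zeta> in lborel. g \<zeta> = WFT u \<zeta>" using assms(3) by eventually_elim simp
  then have "WFT u \<in> L2" by (rule L2_cong_AE[OF assms(2) _ WFT_measurable[OF assms(1)]])
  then show ?thesis using assms(1) by (simp add: X_iff)
qed

lemma X_add: "u \<in> X \<Longrightarrow> v \<in> X \<Longrightarrow> (\<lambda>z. u z + v z) \<in> X"
  by (rule XI[OF L2_add L2_add[of "WFT u" "WFT v"] WFT_add]) (simp_all add: X_iff)

lemma X_diff: "u \<in> X \<Longrightarrow> v \<in> X \<Longrightarrow> (\<lambda>z. u z - v z) \<in> X"
  by (rule XI[OF L2_diff L2_diff[of "WFT u" "WFT v"] WFT_diff]) (simp_all add: X_iff)

lemma X_scale: "u \<in> X \<Longrightarrow> (\<lambda>z. c * u z) \<in> X"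
  by (rule XI[OF L2_scale L2_scale[of "WFT u"] WFT_scale]) (simp_all add: X_iff)

lemma dform_cong_AE:
  assumes "u \<in> L2" "u' \<in> L2" "v \<in> L2" "v' \<in> L2"
    "AE z in lborel. u z = u' z" "AE z in lborel. v z = v' z"
  shows "dform u v = dform u' v'"
  unfolding dform_def using assms
  by (intro arg_cong2[where f="(/)"] L2_inner_cong_AE WFT_cong_AE WFT_measurable refl)

lemma kin_cong_AE: "u \<in> L2 \<Longrightarrow> v \<in> L2 \<Longrightarrow> AE z in lborel. u z = v z \<Longrightarrow> kin u = kin v"
  unfolding kin_eq_Re_dform using dform_cong_AE[of u v u v] by simp

lemma kin_scale: "u \<in> L2 \<Longrightarrow> kin (\<lambda>z. c * u z) = (cmod c)\<^sup>2 * kin u"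
  using L2sq_cong_AE[OF WFT_scale[of u c]] WFT_measurable[of u] WFT_measurable[of "\<lambda>z. c * u z"]
  by (auto simp: kin_def L2sq_scale L2_scale)

lemma Re_dform: "Re (dform u v) = Re (L2_inner (WFT u) (WFT v)) / (4 * pi\<^sup>2)"
proof -
  have "dform u v = L2_inner (WFT u) (WFT v) / complex_of_real (4 * pi\<^sup>2)"
    by (simp add: dform_def)
  then show ?thesis by (simp only: Re_divide_of_real)
qed

lemma kin_diff:
  assumes "u \<in> X" "v \<in> X"
  shows "kin (\<lambda>z. u z - v z) = kin u + kin v - 2 * Re (dform u v)"
proof -
  have "L2sq (WFT (\<lambda>z. u z - v z)) = L2sq (\<lambda>\<zeta>. WFT u \<zeta> - WFT v \<zeta>)"
    using assms by (intro L2sq_cong_AE WFT_diff X_L2 L2_measurable L2_diff WFT_L2 X_diff)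
  then show ?thesis
    by (simp add: kin_def Re_dform L2sq_diff WFT_L2 assms add_divide_distrib diff_divide_distrib)
qed

lemma kin_add:
  assumes "u \<in> X" "v \<in> X"
  shows "kin (\<lambda>z. u z + v z) = kin u + kin v + 2 * Re (dform u v)"
proof -
  have "L2sq (WFT (\<lambda>z. u z + v z)) = L2sq (\<lambda>\<zeta>. WFT u \<zeta> + WFT v \<zeta>)"
    using assms by (intro L2sq_cong_AE WFT_add X_L2 L2_measurable L2_add WFT_L2 X_add)
  then show ?thesis
    by (simp add: kin_def Re_dform L2sq_add WFT_L2 assms add_divide_distrib)
qed

lemma kin_diff_le:
  assumes "u \<in> X" "v \<in> X"
  shows "kin (\<lambda>z. u z - v z) \<le> 2 * kin u + 2 * kin v"
  using kin_diff[OF assms] kin_add[OF assms] kin_nonneg[of "\<lambda>z. u z + v z"] by linarith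

lemma kin_dform_bound:
  assumes "u \<in> X" "v \<in> X"
  shows "\<bar>Re (dform u v)\<bar> \<le> sqrt (kin u) * sqrt (kin v)"
proof -
  have "\<bar>Re (dform u v)\<bar> \<le> cmod (dform u v)" by (rule abs_Re_le_cmod)
  also have "\<dots> \<le> L2norm (WFT u) * L2norm (WFT v) / (4 * pi\<^sup>2)"
    using L2_inner_bound[OF WFT_L2[OF assms(1)] WFT_L2[OF assms(2)]]
    by (simp add: dform_def norm_divide norm_mult norm_power divide_right_mono)
  also have "\<dots> = sqrt (kin u) * sqrt (kin v)"
    by (simp add: kin_def L2norm_def real_sqrt_divide real_sqrt_mult power2_eq_square)
  finally show ?thesis .
qed

lemma FT_cnj_AE: "u \<in> L2 \<Longrightarrow> AE \<zeta> in lborel. FT (\<lambda>z. cnj (u z)) \<zeta> = cnj (FT u (- \<zeta>))"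
  by (intro FT_eqI has_fourier_cnj)

lemma minus_aff: "- \<zeta> = aff (-1) (-1) 0 \<zeta>"
  by (simp add: aff_def prod_eq_iff)

lemma WFT_cnj_AE: "u \<in> L2 \<Longrightarrow> AE \<zeta> in lborel. WFT (\<lambda>z. cnj (u z)) \<zeta> = cnj (WFT u (- \<zeta>))"
  using FT_cnj_AE[of u] by (auto simp: WFT_def weight_def elim: eventually_mono)

lemma L2_neg: "u \<in> L2 \<Longrightarrow> (\<lambda>\<zeta>. u (- \<zeta>)) \<in> L2"
  unfolding minus_aff by (rule L2_aff) auto

lemma X_cnj: "u \<in> X \<Longrightarrow> (\<lambda>z. cnj (u z)) \<in> X"
  by (rule XI[OF L2_cnj L2_cnj[OF L2_neg[of "WFT u"]] WFT_cnj_AE]) (simp_all add: X_iff)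

lemma dform_cnj:
  assumes "u \<in> X" "v \<in> X"
  shows "dform (\<lambda>z. cnj (u z)) v = cnj (dform u (\<lambda>z. cnj (v z)))"
proof -
  have L: "u \<in> L2" "v \<in> L2" using assms by (auto intro: X_L2)
  have "cnj (L2_inner (WFT u) (WFT (\<lambda>z. cnj (v z)))) = cnj (L2_inner (WFT u) (\<lambda>\<zeta>. cnj (WFT v (- \<zeta>))))"
    by (intro arg_cong[where f=cnj] L2_inner_cong_AE WFT_cnj_AE L WFT_measurable L2_measurable L2_cnj L2_neg WFT_L2 assms AE_I2 refl)
  also have "\<dots> = (LINT \<zeta>|lborel. cnj (WFT u \<zeta> * WFT v (- \<zeta>)))"
    unfolding L2_inner_def by (subst Bochner_Integration.integral_cnj[symmetric]) simp
  also have "\<dots> = (LINT \<zeta>|lborel. (\<lambda>\<zeta>. cnj (WFT u (- \<zeta>) * WFT v \<zeta>)) (aff (-1) (-1) 0 \<zeta>))"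
    by (simp add: minus_aff[symmetric])
  also have "\<dots> = (LINT \<zeta>|lborel. cnj (WFT u (- \<zeta>)) * cnj (WFT v \<zeta>))"
    by (subst integral_aff) auto
  also have "\<dots> = L2_inner (\<lambda>\<zeta>. cnj (WFT u (- \<zeta>))) (WFT v)" by (simp add: L2_inner_def)
  also have "\<dots> = L2_inner (WFT (\<lambda>z. cnj (u z))) (WFT v)"
    by (intro L2_inner_cong_AE AE_symmetric[OF WFT_cnj_AE] L WFT_measurable L2_measurable L2_cnj L2_neg WFT_L2 assms AE_I2 refl)
  finally show ?thesis by (simp add: dform_def)
qed

lemma kin_cnj: "u \<in> X \<Longrightarrow> kin (\<lambda>z. cnj (u z)) = kin u"
  using dform_cnj[of u "\<lambda>z. cnj (u z)"] X_cnj[of u] by (simp add: kin_eq_Re_dform)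

lemma WFT_aff:
  assumes "u \<in> L2" and l: "l > 0"
  shows "AE \<zeta> in lborel. WFT (\<lambda>z. u (aff l (l\<^sup>2) h z)) \<zeta> =
     complex_of_real (1 / l\<^sup>2) * (cis (h \<bullet> aff (1/l) (1/l\<^sup>2) 0 \<zeta>) * WFT u (aff (1/l) (1/l\<^sup>2) 0 \<zeta>))"
proof -
  have w: "sqrt (weight \<zeta>) = l * sqrt (weight (aff (1/l) (1/l\<^sup>2) 0 \<zeta>))" for \<zeta>
  proof -
    have "weight \<zeta> = l\<^sup>2 * weight (aff (1/l) (1/l\<^sup>2) 0 \<zeta>)"
      using l by (simp add: weight_def aff_def abs_mult field_simps)
    then show ?thesis using l by (simp add: real_sqrt_mult)
  qed
  have nz: "l \<noteq> 0" "l\<^sup>2 \<noteq> 0" using l by auto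
  show ?thesis
    using FT_eqI[OF has_fourier_aff[OF nz assms(1), of h]]
  proof eventually_elim
    case (elim \<zeta>)
    have "WFT (\<lambda>z. u (aff l (l\<^sup>2) h z)) \<zeta> = complex_of_real (l * (1 / \<bar>l * l\<^sup>2\<bar>)) *
      (cis (h \<bullet> aff (1/l) (1/l\<^sup>2) 0 \<zeta>) * WFT u (aff (1/l) (1/l\<^sup>2) 0 \<zeta>))"
      unfolding WFT_def elim w[of \<zeta>] by simp
    moreover have "l * (1 / \<bar>l * l\<^sup>2\<bar>) = 1 / l\<^sup>2" using l by (simp add: abs_mult)
    ultimately show ?case by (simp only:)
  qed
qed

lemma X_aff:
  assumes "u \<in> X" and l: "l > 0"
  shows "(\<lambda>z. u (aff l (l\<^sup>2) h z)) \<in> X"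
proof -
  have nz: "l \<noteq> 0" "l\<^sup>2 \<noteq> 0" "1/l \<noteq> 0" "1/l\<^sup>2 \<noteq> 0" using l by auto
  note L = X_L2[OF assms(1)] and W = WFT_L2[OF assms(1)]
  have LA: "(\<lambda>z. u (aff l (l\<^sup>2) h z)) \<in> L2" by (intro L2_aff nz L)
  note [measurable] = WFT_measurable[OF L]
  have "(\<lambda>\<zeta>. complex_of_real (1 / l\<^sup>2) * (cis (h \<bullet> aff (1/l) (1/l\<^sup>2) 0 \<zeta>) * WFT u (aff (1/l) (1/l\<^sup>2) 0 \<zeta>))) \<in> L2"
    by (intro L2_scale L2_bound(1)[OF L2_aff[OF nz(3,4) W, of 0], where B=1]) (auto simp: norm_mult)
  from XI[OF LA this WFT_aff[OF L l]] show ?thesis .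
qed

lemma dform_aff:
  assumes "u \<in> X" "v \<in> X" and l: "l > 0"
  shows "dform (\<lambda>z. u (aff l (l\<^sup>2) h z)) (\<lambda>z. v (aff l (l\<^sup>2) h z)) = dform u v / l"
proof -
  have nz: "l \<noteq> 0" "l\<^sup>2 \<noteq> 0" "1/l \<noteq> 0" "1/l\<^sup>2 \<noteq> 0" using l by auto
  note L = X_L2[OF assms(1)] X_L2[OF assms(2)]
  note [measurable] = WFT_measurable[OF L(1)] WFT_measurable[OF L(2)]
  let ?a = "aff (1/l) (1/l\<^sup>2) 0"
  have "L2_inner (WFT (\<lambda>z. u (aff l (l\<^sup>2) h z))) (WFT (\<lambda>z. v (aff l (l\<^sup>2) h z))) =
    L2_inner (\<lambda>\<zeta>. complex_of_real (1 / l\<^sup>2) * (cis (h \<bullet> ?a \<zeta>) * WFT u (?a \<zeta>)))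
      (\<lambda>\<zeta>. complex_of_real (1 / l\<^sup>2) * (cis (h \<bullet> ?a \<zeta>) * WFT v (?a \<zeta>)))"
    by (intro L2_inner_cong_AE WFT_aff L l WFT_measurable L2_aff nz) measurable
  also have "\<dots> = complex_of_real (1 / l\<^sup>2) * (complex_of_real (1 / l\<^sup>2) * L2_inner (\<lambda>\<zeta>. cis (h \<bullet> ?a \<zeta>) * WFT u (?a \<zeta>)) (\<lambda>\<zeta>. cis (h \<bullet> ?a \<zeta>) * WFT v (?a \<zeta>)))"
    unfolding L2_inner_scale_left L2_inner_scale_right by simp
  also have "L2_inner (\<lambda>\<zeta>. cis (h \<bullet> ?a \<zeta>) * WFT u (?a \<zeta>)) (\<lambda>\<zeta>. cis (h \<bullet> ?a \<zeta>) * WFT v (?a \<zeta>))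
     = (LINT \<zeta>|lborel. (\<lambda>\<zeta>. WFT u \<zeta> * cnj (WFT v \<zeta>)) (?a \<zeta>))"
  proof -
    have "cis t * a * cnj (cis t * b) = a * cnj b" for t a b
    proof -
      have "cis t * a * cnj (cis t * b) = (cis t * cnj (cis t)) * (a * cnj b)" by (simp add: mult_ac)
      then show ?thesis by (simp add: cis_cnj cis_mult)
    qed
    then show ?thesis unfolding L2_inner_def by (simp only:)
  qed
  also have "\<dots> = complex_of_real (l * l\<^sup>2) * L2_inner (WFT u) (WFT v)"
    using l by (subst integral_aff[OF nz(3,4)]) (simp add: L2_inner_def scaleR_conv_of_real abs_mult)
  finally show ?thesis using l by (simp add: dform_def power2_eq_square field_simps)
qed

lemma kin_aff: "u \<in> X \<Longrightarrow> l > 0 \<Longrightarrow> kin (\<lambda>z. u (aff l (l\<^sup>2) h z)) = kin u / l"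
  by (simp add: kin_eq_Re_dform dform_aff)

lemma X_translate: "u \<in> X \<Longrightarrow> (\<lambda>z. u (z + h)) \<in> X"
  using X_aff[of u 1 h] by (simp add: aff_translate)

lemma kin_translate: "u \<in> X \<Longrightarrow> kin (\<lambda>z. u (z + h)) = kin u"
  using kin_aff[of u 1 h] by (simp add: aff_translate)

lemma pot_aff: "\<alpha> \<noteq> 0 \<Longrightarrow> \<beta> \<noteq> 0 \<Longrightarrow> pot q (\<lambda>z. u (aff \<alpha> \<beta> h z)) = pot q u / \<bar>\<alpha> * \<beta>\<bar>"
  unfolding pot_def using integral_aff[of \<alpha> \<beta> "\<lambda>z. cmod (u z) powr q" h] by simp

lemma pot_translate: "pot q (\<lambda>z. u (z + h)) = pot q u"
  using pot_aff[of 1 1 q u h] by (simp add: aff_translate)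

lemma pot_scale: "pot q (\<lambda>z. c * u z) = cmod c powr q * pot q u"
  by (simp add: pot_def norm_mult powr_mult)

section \<open>Increments under translations\<close>

lemma cis_minus_1: "(cmod (cis t - 1))\<^sup>2 = 4 * (sin (t/2))\<^sup>2"
proof -
  have "(cmod (cis t - 1))\<^sup>2 = 2 - 2 * cos t"
    using sin_cos_squared_add3[of t] unfolding cmod_power2 by (simp add: power2_eq_square algebra_simps)
  also have "cos t = 1 - 2 * (sin (t/2))\<^sup>2" using cos_double_sin[of "t/2"] by simp
  finally show ?thesis by simp
qed

lemma cis_minus_1_bounds: "(cmod (cis t - 1))\<^sup>2 \<le> t\<^sup>2" "(cmod (cis t - 1))\<^sup>2 \<le> 2 * \<bar>t\<bar>"
proof -
  have 1: "\<bar>sin (t/2)\<bar> \<le> \<bar>t/2\<bar>" by (rule abs_sin_x_le_abs_x)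
  then have "(sin (t/2))\<^sup>2 \<le> (t/2)\<^sup>2" by (simp only: abs_le_square_iff)
  then show "(cmod (cis t - 1))\<^sup>2 \<le> t\<^sup>2" unfolding cis_minus_1 by (simp add: power_divide)
  have "\<bar>sin (t/2)\<bar> * \<bar>sin (t/2)\<bar> \<le> \<bar>t/2\<bar> * 1" using 1 by (intro mult_mono) auto
  then show "(cmod (cis t - 1))\<^sup>2 \<le> 2 * \<bar>t\<bar>" unfolding cis_minus_1 by (simp add: power2_eq_square)
qed

text \<open>
  On the Fourier side the increment is multiplication by \<open>cis (h \<bullet> \<zeta>) - 1\<close>. As
  \<open>\<bar>cis t - 1\<bar>\<^sup>2\<close> is at most \<open>t\<^sup>2\<close> and at most \<open>2 \<bar>t\<bar>\<close>, the part from \<open>x\<close> is bounded by \<open>h\<^sub>1\<^sup>2 \<xi>\<^sup>2\<close> and the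
  part from \<open>y\<close> by \<open>\<bar>h\<^sub>2\<bar> \<bar>\<eta>\<bar>\<close>, up to constants.
\<close>

theorem L2sq_translate_diff:
  assumes u: "u \<in> X"
  shows "L2sq (\<lambda>z. u (z + h) - u z) \<le> 4 * weight h * kin u"
proof -
  note L = X_L2[OF u]
  note [measurable] = L2_measurable[OF FT_L2[OF L]]
  have "has_fourier (\<lambda>z. u (aff 1 1 h z)) (\<lambda>\<zeta>. complex_of_real (1 / \<bar>1 * 1\<bar>) * (cis (h \<bullet> aff (1/1) (1/1) 0 \<zeta>) * FT u (aff (1/1) (1/1) 0 \<zeta>)))"
    by (intro has_fourier_aff L) auto
  then have "has_fourier (\<lambda>z. u (z + h)) (\<lambda>\<zeta>. cis (h \<bullet> \<zeta>) * FT u \<zeta>)"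
    by (simp add: aff_translate)
  from has_fourier_diff[OF this has_fourier_FT[OF L]]
  have "has_fourier (\<lambda>z. u (z + h) - u z) (\<lambda>\<zeta>. cis (h \<bullet> \<zeta>) * FT u \<zeta> - FT u \<zeta>)" .
  note P = has_fourier_Plancherel[OF this] has_fourier_L2(2)[OF this]
  have le: "cmod (cis (h \<bullet> \<zeta>) - 1) \<le> sqrt (4 * weight h) * sqrt (weight \<zeta>)" for \<zeta>
  proof -
    define a where "a = fst h * fst \<zeta>"
    define b where "b = snd h * snd \<zeta>"
    have hz: "h \<bullet> \<zeta> = a + b" by (simp add: a_def b_def inner_prod_def)
    have eq: "cis (a + b) - 1 = cis b * (cis a - 1) + (cis b - 1)" by (simp add: cis_mult[symmetric] algebra_simps)
    have "cmod (cis (a + b) - 1) \<le> cmod (cis b * (cis a - 1)) + cmod (cis b - 1)"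
      unfolding eq by (rule norm_triangle_ineq)
    then have "cmod (cis (a + b) - 1) \<le> cmod (cis a - 1) + cmod (cis b - 1)"
      by (simp add: norm_mult)
    then have "(cmod (cis (a + b) - 1))\<^sup>2 \<le> (cmod (cis a - 1) + cmod (cis b - 1))\<^sup>2"
      by (intro power_mono) auto
    also have "\<dots> \<le> 2 * (cmod (cis a - 1))\<^sup>2 + 2 * (cmod (cis b - 1))\<^sup>2"
      using sum_squares_bound[of "cmod (cis a - 1)" "cmod (cis b - 1)"] by (simp add: power2_sum)
    also have "\<dots> \<le> 2 * a\<^sup>2 + 4 * \<bar>b\<bar>"
      using cis_minus_1_bounds(1)[of a] cis_minus_1_bounds(2)[of b] by linarith
    also have "\<dots> \<le> 4 * weight h * weight \<zeta>"
    proof -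
      define r where "r = (fst h)\<^sup>2 * \<bar>snd \<zeta>\<bar> + \<bar>snd h\<bar> * (fst \<zeta>)\<^sup>2"
      have eq: "4 * weight h * weight \<zeta> = 4 * a\<^sup>2 + 4 * \<bar>b\<bar> + 4 * r"
        by (simp add: weight_def a_def b_def r_def abs_mult power_mult_distrib algebra_simps)
      have "0 \<le> a\<^sup>2" "0 \<le> r" by (auto simp: r_def)
      then show ?thesis unfolding eq by linarith
    qed
    finally have "cmod (cis (a + b) - 1) \<le> sqrt (4 * weight h * weight \<zeta>)" by (rule real_le_rsqrt)
    then show ?thesis by (simp add: hz real_sqrt_mult)
  qed
  have "L2sq (\<lambda>\<zeta>. cis (h \<bullet> \<zeta>) * FT u \<zeta> - FT u \<zeta>) \<le> (sqrt (4 * weight h))\<^sup>2 * L2sq (WFT u)"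
  proof (rule L2_bound(2)[OF WFT_L2[OF u]])
    fix \<zeta>
    have "cmod (cis (h \<bullet> \<zeta>) * FT u \<zeta> - FT u \<zeta>) = cmod (cis (h \<bullet> \<zeta>) - 1) * cmod (FT u \<zeta>)"
      by (simp add: norm_mult[symmetric] algebra_simps)
    also have "\<dots> \<le> sqrt (4 * weight h) * sqrt (weight \<zeta>) * cmod (FT u \<zeta>)"
      using le by (rule mult_right_mono) simp
    finally show "cmod (cis (h \<bullet> \<zeta>) * FT u \<zeta> - FT u \<zeta>) \<le> sqrt (4 * weight h) * cmod (WFT u \<zeta>)"
      by (simp add: WFT_def norm_mult)
  qed measurable
  then show ?thesis unfolding P by (simp add: kin_def field_simps)
qed

section \<open>Averages over parabolic boxes\<close>

text \<open>
  A side of length \<open>e\<^sup>2\<close> in \<open>y\<close> matches a side of length \<open>e\<close> in \<open>x\<close>: both increments of \<open>u\<close> are then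
  of order \<open>e (kin u)\<^bsup>1/2\<^esup>\<close>.
\<close>

definition pbox :: "real \<Rightarrow> plane set" where
  "pbox e = cbox (0, 0) (e, e\<^sup>2)"

text \<open>
  The mean value of \<open>u\<close> over \<open>z + pbox e\<close>, written as an inner product so that weak convergence
  applies to it.
\<close>

definition box_avg :: "real \<Rightarrow> (plane \<Rightarrow> complex) \<Rightarrow> plane \<Rightarrow> complex" where
  "box_avg e u z = L2_inner (\<lambda>h. u (h + z)) (indicator (pbox e)) / e^3"

lemma pbox_sets [measurable]: "pbox e \<in> sets borel"
  by (simp add: pbox_def)

lemma pbox_weight: "h \<in> pbox e \<Longrightarrow> weight h \<le> 2 * e\<^sup>2"
proof -
  assume "h \<in> pbox e"
  then have h: "0 \<le> fst h" "fst h \<le> e" "0 \<le> snd h" "snd h \<le> e\<^sup>2"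
    by (auto simp: pbox_def mem_box Basis_prod_def inner_prod_def)
  have "(fst h)\<^sup>2 \<le> e\<^sup>2" using h by (intro power_mono) auto
  moreover have "\<bar>snd h\<bar> \<le> e\<^sup>2" using h by simp
  ultimately show ?thesis unfolding weight_def by linarith
qed

lemma emeasure_pbox: "e > 0 \<Longrightarrow> emeasure lborel (pbox e) = ennreal (e^3)"
proof -
  assume e: "e > 0"
  have "emeasure lborel (pbox e) = ennreal (e * e\<^sup>2)"
    unfolding pbox_def using e
    by (subst emeasure_lborel_cbox) (auto simp: Basis_prod_def inner_prod_def)
  then show ?thesis by (simp add: power2_eq_square power3_eq_cube mult.assoc)
qed

lemma pbox_indicator_L2:
  assumes e: "e > 0"
  shows "(indicator (pbox e) :: plane \<Rightarrow> complex) \<in> L2" "L2sq (indicator (pbox e)) = e^3"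
proof -
  have i: "integrable lborel (indicator (pbox e) :: plane \<Rightarrow> real)"
    using emeasure_pbox[OF e] by (intro integrable_real_indicator) auto
  have eq: "(cmod (indicator (pbox e) z))\<^sup>2 = indicator (pbox e) z" for z
    by (simp split: split_indicator)
  show "(indicator (pbox e) :: plane \<Rightarrow> complex) \<in> L2"
    using i by (simp add: L2_iff eq borel_measurable_indicator)
  show "L2sq (indicator (pbox e)) = e^3"
    unfolding L2sq_def eq using emeasure_pbox[OF e] e by (simp add: measure_def)
qed

lemma box_avg_bound:
  assumes "u \<in> L2" and e: "e > 0"
  shows "cmod (box_avg e u z) \<le> L2norm u / sqrt (e^3)"
proof -
  have "cmod (L2_inner (\<lambda>h. u (h + z)) (indicator (pbox e))) \<le> L2norm (\<lambda>h. u (h + z)) * L2norm (indicator (pbox e))"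
    by (intro L2_inner_bound L2_translate assms pbox_indicator_L2)
  also have "\<dots> = L2norm u * sqrt (e^3)"
    by (simp add: L2norm_def L2sq_translate pbox_indicator_L2(2)[OF e])
  finally have "cmod (box_avg e u z) \<le> L2norm u * sqrt (e^3) / e^3"
    using e by (simp add: box_avg_def norm_divide norm_power divide_right_mono)
  also have "\<dots> = L2norm u / sqrt (e^3)"
  proof -
    define s where "s = sqrt (e^3)"
    have "s > 0" "e^3 = s * s" using e by (auto simp: s_def)
    then show ?thesis by (simp only: s_def[symmetric]) simp
  qed
  finally show ?thesis .
qed

lemma box_avg_diff:
  assumes "u \<in> L2" "v \<in> L2" "e > 0"
  shows "box_avg e (\<lambda>z. u z - v z) z = box_avg e u z - box_avg e v z"
  using L2_inner_diff_left[OF L2_translate[OF assms(1)] L2_translate[OF assms(2)] pbox_indicator_L2(1)[OF assms(3)], of z z]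
  by (simp add: box_avg_def diff_divide_distrib)

lemma box_avg_dist:
  assumes "u \<in> X" "e > 0"
  shows "cmod (box_avg e u z - box_avg e u w) \<le> sqrt (4 * weight (z - w) * kin u) / sqrt (e^3)"
proof -
  note L = X_L2[OF assms(1)]
  have "box_avg e u z - box_avg e u w = box_avg e (\<lambda>x. u (x + (z - w)) - u x) w"
    by (subst box_avg_diff[OF L2_translate[OF L] L assms(2)]) (simp add: box_avg_def add.assoc)
  also have "cmod \<dots> \<le> L2norm (\<lambda>x. u (x + (z - w)) - u x) / sqrt (e^3)"
    by (intro box_avg_bound L2_diff L2_translate L assms)
  also have "\<dots> \<le> sqrt (4 * weight (z - w) * kin u) / sqrt (e^3)"
    using L2sq_translate_diff[OF assms(1), of "z - w"] assms(2)
    by (intro divide_right_mono) (simp_all add: L2norm_def)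
  finally show ?thesis .
qed

lemma box_avg_measurable [measurable]:
  assumes "u \<in> L2"
  shows "box_avg e u \<in> borel_measurable borel"
proof -
  note [measurable] = L2_measurable[OF assms]
  have [measurable]: "(indicator (pbox e) :: plane \<Rightarrow> complex) \<in> borel_measurable borel"
    by (intro borel_measurable_indicator) simp
  show ?thesis unfolding box_avg_def[abs_def] L2_inner_def by measurable
qed

lemma box_avg_error_pointwise:
  assumes u: "u \<in> L2" and e: "e > 0"
  shows "ennreal ((cmod (u z - box_avg e u z))\<^sup>2)
    \<le> ennreal (1 / e^3) * (\<integral>\<^sup>+h. indicator (pbox e) h * ennreal ((cmod (u (z + h) - u z))\<^sup>2) \<partial>lborel)"
proof -
  let ?I = "indicator (pbox e) :: plane \<Rightarrow> complex"
  note I = pbox_indicator_L2[OF e]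
  note [measurable] = L2_measurable[OF u] L2_measurable[OF I(1)]
  define g where "g h = u z * ?I h - ?I h * u (h + z)" for h
  have gL: "g \<in> L2"
    unfolding g_def by (intro L2_diff L2_scale I L2_indicator L2_translate u) simp
  have II: "L2_inner ?I ?I = e^3" by (simp add: L2_inner_self I)
  have "L2_inner g ?I = L2_inner (\<lambda>h. u z * ?I h) ?I - L2_inner (\<lambda>h. ?I h * u (h + z)) ?I"
    unfolding g_def by (intro L2_inner_diff_left L2_scale I L2_indicator L2_translate u) simp
  also have "L2_inner (\<lambda>h. ?I h * u (h + z)) ?I = L2_inner (\<lambda>h. u (h + z)) ?I"
    unfolding L2_inner_def by (intro Bochner_Integration.integral_cong) (auto split: split_indicator)
  finally have "L2_inner g ?I = u z * e^3 - e^3 * box_avg e u z"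
    using e by (simp add: box_avg_def L2_inner_scale_left II)
  then have gi: "L2_inner g ?I = e^3 * (u z - box_avg e u z)" by (simp add: algebra_simps)
  have "(e^3 * cmod (u z - box_avg e u z))\<^sup>2 = (cmod (L2_inner g ?I))\<^sup>2"
    unfolding gi using e by (simp add: norm_mult norm_power)
  also have "\<dots> \<le> (L2norm g * L2norm ?I)\<^sup>2"
    by (intro power_mono L2_inner_bound gL I) simp
  also have "\<dots> = L2sq g * e^3" by (simp add: power_mult_distrib I)
  finally have "(e^3)\<^sup>2 * (cmod (u z - box_avg e u z))\<^sup>2 \<le> L2sq g * e^3" by (simp add: power_mult_distrib)
  then have "e^3 * (e^3 * (cmod (u z - box_avg e u z))\<^sup>2) \<le> e^3 * L2sq g" by (simp add: power2_eq_square mult_ac)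
  then have "e^3 * (cmod (u z - box_avg e u z))\<^sup>2 \<le> L2sq g"
    by (rule mult_left_le_imp_le) (use e in simp)
  then have "(cmod (u z - box_avg e u z))\<^sup>2 \<le> (1/e^3) * L2sq g"
    using e by (simp add: pos_le_divide_eq mult.commute)
  then have "ennreal ((cmod (u z - box_avg e u z))\<^sup>2) \<le> ennreal (1/e^3) * ennreal (L2sq g)"
    using e by (simp add: ennreal_mult[symmetric] ennreal_leI)
  also have "ennreal (L2sq g) = (\<integral>\<^sup>+h. ennreal ((cmod (g h))\<^sup>2) \<partial>lborel)"
    by (rule nn_integral_L2sq[OF gL, symmetric])
  also have "\<dots> = (\<integral>\<^sup>+h. indicator (pbox e) h * ennreal ((cmod (u (z + h) - u z))\<^sup>2) \<partial>lborel)"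
    by (intro nn_integral_cong) (auto simp: g_def add.commute norm_minus_commute split: split_indicator)
  finally show ?thesis .
qed

text \<open>
  By the Cauchy-Schwarz inequality the squared error at \<open>z\<close> is at most the mean of
  \<open>\<bar>u (z + h) - u z\<bar>\<^sup>2\<close> over \<open>h \<in> pbox e\<close>; integrate in \<open>z\<close> first.
\<close>

theorem box_avg_error:
  assumes u: "u \<in> X" and e: "e > 0"
  shows "(\<lambda>z. u z - box_avg e u z) \<in> L2" "L2sq (\<lambda>z. u z - box_avg e u z) \<le> 8 * e\<^sup>2 * kin u"
proof -
  note L = X_L2[OF u]
  note [measurable] = L2_measurable[OF L] box_avg_measurable[OF L]
  have "(\<integral>\<^sup>+z. ennreal ((cmod (u z - box_avg e u z))\<^sup>2) \<partial>lborel) \<le>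
    (\<integral>\<^sup>+z. ennreal (1 / e^3) * (\<integral>\<^sup>+h. indicator (pbox e) h * ennreal ((cmod (u (z + h) - u z))\<^sup>2) \<partial>lborel) \<partial>lborel)"
    by (intro nn_integral_mono box_avg_error_pointwise L e)
  also have "\<dots> = ennreal (1 / e^3) * (\<integral>\<^sup>+z. (\<integral>\<^sup>+h. indicator (pbox e) h * ennreal ((cmod (u (z + h) - u z))\<^sup>2) \<partial>lborel) \<partial>lborel)"
    by (rule nn_integral_cmult) measurable
  also have "(\<integral>\<^sup>+z. (\<integral>\<^sup>+h. indicator (pbox e) h * ennreal ((cmod (u (z + h) - u z))\<^sup>2) \<partial>lborel) \<partial>lborel)
     = (\<integral>\<^sup>+h. (\<integral>\<^sup>+z. indicator (pbox e) h * ennreal ((cmod (u (z + h) - u z))\<^sup>2) \<partial>lborel) \<partial>lborel)"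
    by (rule lborel_pair.Fubini'[symmetric]) measurable
  also have "\<dots> \<le> (\<integral>\<^sup>+h. ennreal (8 * e\<^sup>2 * kin u) * indicator (pbox e) h \<partial>lborel)"
  proof (intro nn_integral_mono)
    fix h
    have "(\<integral>\<^sup>+z. indicator (pbox e) h * ennreal ((cmod (u (z + h) - u z))\<^sup>2) \<partial>lborel)
      = indicator (pbox e) h * ennreal (L2sq (\<lambda>z. u (z + h) - u z))"
      by (subst nn_integral_cmult) (simp_all add: nn_integral_L2sq L2_diff L2_translate L)
    also have "\<dots> \<le> ennreal (8 * e\<^sup>2 * kin u) * indicator (pbox e) h"
    proof (cases "h \<in> pbox e")
      case True
      have "4 * weight h * kin u \<le> 4 * (2 * e\<^sup>2) * kin u"
        using pbox_weight[OF True] by (intro mult_right_mono mult_left_mono) auto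
      then have "L2sq (\<lambda>z. u (z + h) - u z) \<le> 8 * e\<^sup>2 * kin u"
        using L2sq_translate_diff[OF u, of h] by linarith
      then show ?thesis using True by (simp add: ennreal_leI)
    qed simp
    finally show "(\<integral>\<^sup>+z. indicator (pbox e) h * ennreal ((cmod (u (z + h) - u z))\<^sup>2) \<partial>lborel) \<le> ennreal (8 * e\<^sup>2 * kin u) * indicator (pbox e) h" .
  qed
  also have "\<dots> = ennreal (8 * e\<^sup>2 * kin u) * ennreal (e^3)"
    by (subst nn_integral_cmult_indicator) (simp_all add: emeasure_pbox[OF e])
  finally have "(\<integral>\<^sup>+z. ennreal ((cmod (u z - box_avg e u z))\<^sup>2) \<partial>lborel)
      \<le> ennreal (1 / e^3) * (ennreal (8 * e\<^sup>2 * kin u) * ennreal (e^3))"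
    by (simp add: mult_left_mono)
  also have "\<dots> = ennreal (8 * e\<^sup>2 * kin u)"
    using e by (simp add: ennreal_mult[symmetric] field_simps)
  finally show "(\<lambda>z. u z - box_avg e u z) \<in> L2" "L2sq (\<lambda>z. u z - box_avg e u z) \<le> 8 * e\<^sup>2 * kin u"
    by (auto intro!: L2_if_nn_integral[where c="8 * e\<^sup>2 * kin u"])
qed

section \<open>Level sets and the Gagliardo-Nirenberg inequality\<close>

text \<open>
  The part of \<open>pot q u\<close> that comes from the points where \<open>\<bar>u\<bar>\<close> lies in \<open>S\<close>.
\<close>

definition level_mass :: "real \<Rightarrow> (plane \<Rightarrow> complex) \<Rightarrow> real set \<Rightarrow> ennreal" where
  "level_mass q u S = (\<integral>\<^sup>+z. indicator S (cmod (u z)) * ennreal (cmod (u z) powr q) \<partial>lborel)"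

lemma level_mass_Un:
  assumes "u \<in> L2" "S \<in> sets borel" "T \<in> sets borel"
  shows "level_mass q u (S \<union> T) \<le> level_mass q u S + level_mass q u T"
proof -
  note [measurable] = L2_measurable[OF assms(1)] assms(2,3)
  have "level_mass q u (S \<union> T) \<le> (\<integral>\<^sup>+z. indicator S (cmod (u z)) * ennreal (cmod (u z) powr q)
     + indicator T (cmod (u z)) * ennreal (cmod (u z) powr q) \<partial>lborel)"
    unfolding level_mass_def by (intro nn_integral_mono) (auto split: split_indicator)
  also have "\<dots> = level_mass q u S + level_mass q u T"
    unfolding level_mass_def by (intro nn_integral_add) measurable
  finally show ?thesis .
qed

lemma powr_split_square: "x \<ge> 0 \<Longrightarrow> q > 2 \<Longrightarrow> x powr q = x powr (q - 2) * x\<^sup>2" for x :: real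
  by (cases "x = 0") (simp_all add: powr_diff flip: powr_numeral)

lemma level_mass_low:
  assumes u: "u \<in> L2" and q: "q > 2" and "\<Lambda> > 0"
  shows "level_mass q u {..\<Lambda>} \<le> ennreal (\<Lambda> powr (q - 2) * L2sq u)"
proof -
  note [measurable] = L2_measurable[OF u]
  have "level_mass q u {..\<Lambda>} \<le> (\<integral>\<^sup>+z. ennreal (\<Lambda> powr (q - 2)) * ennreal ((cmod (u z))\<^sup>2) \<partial>lborel)"
    unfolding level_mass_def
  proof (intro nn_integral_mono)
    fix z
    show "indicator {..\<Lambda>} (cmod (u z)) * ennreal (cmod (u z) powr q) \<le> ennreal (\<Lambda> powr (q - 2)) * ennreal ((cmod (u z))\<^sup>2)"
    proof (cases "cmod (u z) \<le> \<Lambda>")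
      case True
      then have "cmod (u z) powr (q - 2) * (cmod (u z))\<^sup>2 \<le> \<Lambda> powr (q - 2) * (cmod (u z))\<^sup>2"
        using q by (intro mult_right_mono powr_mono2) auto
      then have "cmod (u z) powr q \<le> \<Lambda> powr (q - 2) * (cmod (u z))\<^sup>2"
        using q by (simp add: powr_split_square)
      then show ?thesis using True by (simp add: ennreal_mult[symmetric] ennreal_leI)
    qed simp
  qed
  also have "\<dots> = ennreal (\<Lambda> powr (q - 2)) * ennreal (L2sq u)"
    by (subst nn_integral_cmult) (simp_all add: nn_integral_L2sq u)
  finally show ?thesis by (simp add: ennreal_mult)
qed

text \<open>
  Where \<open>\<bar>u\<bar> > l\<close>, an average of modulus at most \<open>l / 2\<close> makes up at most half of \<open>u\<close>. So \<open>\<bar>u\<bar>\<close> is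
  at most twice the averaging error there.
\<close>

lemma level_mass_middle:
  assumes u: "u \<in> X" and e: "e > 0" and q: "q > 2" and l: "0 < l"
    and avg: "\<And>z. cmod (box_avg e u z) \<le> l / 2"
  shows "level_mass q u {l<..\<Lambda>} \<le> ennreal (\<Lambda> powr (q - 2) * (32 * e\<^sup>2 * kin u))"
proof -
  note L = X_L2[OF u]
  note [measurable] = L2_measurable[OF L] box_avg_measurable[OF L]
  note E = box_avg_error[OF u e]
  have "level_mass q u {l<..\<Lambda>} \<le> (\<integral>\<^sup>+z. ennreal (\<Lambda> powr (q - 2) * 4) * ennreal ((cmod (u z - box_avg e u z))\<^sup>2) \<partial>lborel)"
    unfolding level_mass_def
  proof (intro nn_integral_mono)
    fix z
    show "indicator {l<..\<Lambda>} (cmod (u z)) * ennreal (cmod (u z) powr q) \<le> ennreal (\<Lambda> powr (q - 2) * 4) * ennreal ((cmod (u z - box_avg e u z))\<^sup>2)"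
    proof (cases "cmod (u z) \<in> {l<..\<Lambda>}")
      case True
      have "cmod (u z) \<le> 2 * cmod (u z - box_avg e u z)"
        using norm_triangle_ineq2[of "u z" "box_avg e u z"] avg[of z] True by auto
      then have "(cmod (u z))\<^sup>2 \<le> (2 * cmod (u z - box_avg e u z))\<^sup>2" by (intro power_mono) auto
      then have "cmod (u z) powr (q - 2) * (cmod (u z))\<^sup>2 \<le> \<Lambda> powr (q - 2) * (2 * cmod (u z - box_avg e u z))\<^sup>2"
        using q True by (intro mult_mono powr_mono2) auto
      then have "cmod (u z) powr q \<le> \<Lambda> powr (q - 2) * 4 * (cmod (u z - box_avg e u z))\<^sup>2"
        using q by (simp add: powr_split_square power_mult_distrib)
      then show ?thesis using True by (simp add: ennreal_mult[symmetric] ennreal_leI)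
    qed simp
  qed
  also have "\<dots> = ennreal (\<Lambda> powr (q - 2) * 4) * ennreal (L2sq (\<lambda>z. u z - box_avg e u z))"
    by (subst nn_integral_cmult) (simp_all add: nn_integral_L2sq E)
  also have "\<dots> \<le> ennreal (\<Lambda> powr (q - 2) * 4) * ennreal (8 * e\<^sup>2 * kin u)"
    by (intro mult_left_mono ennreal_leI E) auto
  finally show ?thesis by (simp add: ennreal_mult[symmetric] mult_ac)
qed

text \<open>
  The denominator is the sum of the geometric series over the dyadic levels in \<open>level_mass_high\<close>.
\<close>

definition tail_const :: "real \<Rightarrow> real" where
  "tail_const q = 32 * 2 powr (q - 2) * 2 powr (4/3) / (1 - 2 powr (q - 10/3))"

lemma tail_const_pos: "q < 10/3 \<Longrightarrow> tail_const q > 0"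
proof -
  assume "q < 10/3"
  then have "2 powr (q - 10/3) < 2 powr (0::real)" by (intro powr_less_mono) auto
  then show ?thesis by (simp add: tail_const_def)
qed

text \<open>
  At the dyadic level \<open>l' = 2\<^sup>k \<Lambda>\<close> choose the box with \<open>e\<^bsup>3/2\<^esup> = 2 N / l'\<close>: its averages are at most
  \<open>l' / 2\<close>. The level then contributes a multiple of \<open>l' powr (q - 2) * e\<^sup>2\<close>, hence of
  \<open>l' powr (q - 10/3)\<close>, and the sum over \<open>k\<close> converges because \<open>q < 10/3\<close>.
\<close>

lemma level_mass_high:
  assumes u: "u \<in> X" and q: "2 < q" "q < 10/3" and N: "L2norm u \<le> N" "0 < N" and l: "0 < \<Lambda>"
  shows "level_mass q u {\<Lambda><..} \<le> ennreal (tail_const q * \<Lambda> powr (q - 10/3) * N powr (4/3) * kin u)"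
proof -
  note L = X_L2[OF u]
  note [measurable] = L2_measurable[OF L]
  define r where "r = (2::real) powr (q - 10/3)"
  have r: "0 < r" "r < 1" unfolding r_def using q powr_less_mono[of "q - 10/3" 0 "2::real"] by auto
  define A where "A = 32 * 2 powr (q - 2) * 2 powr (4/3) * N powr (4/3) * \<Lambda> powr (q - 10/3) * kin u"
  have A: "A \<ge> 0" by (simp add: A_def)
  define S where "S k = {2^k * \<Lambda><..2 * (2^k * \<Lambda>)}" for k :: nat
  have piece: "level_mass q u (S k) \<le> ennreal (A * r^k)" for k
  proof -
    define l' where "l' = 2^k * \<Lambda>"
    have l': "l' > 0" using l by (simp add: l'_def)
    define e where "e = (2 * N / l') powr (2/3)"
    have b: "2 * N / l' > 0" using N l' by simp
    have e: "e > 0" using N(2) l' by (simp add: e_def)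
    have "e^3 = e powr 3" using e by (simp add: powr_numeral)
    also have "\<dots> = (2 * N / l')\<^sup>2" unfolding e_def powr_powr using N(2) l' by simp
    finally have e3: "sqrt (e^3) = 2 * N / l'" using N(2) l' by (simp add: real_sqrt_abs)
    have e2: "e\<^sup>2 = (2 * N / l') powr (4/3)"
    proof -
      have "e\<^sup>2 = e powr 2" using e by (simp add: powr_numeral)
      then show ?thesis unfolding e_def powr_powr by simp
    qed
    have avg: "cmod (box_avg e u z) \<le> l' / 2" for z
    proof -
      have "cmod (box_avg e u z) \<le> L2norm u / (2 * N / l')" using box_avg_bound[OF L e, of z] e3 by simp
      also have "\<dots> \<le> N / (2 * N / l')" using N b by (intro divide_right_mono) auto
      also have "\<dots> = l' / 2" using N(2) l' by simp
      finally show ?thesis .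
    qed
    have "level_mass q u (S k) \<le> ennreal ((2 * l') powr (q - 2) * (32 * e\<^sup>2 * kin u))"
      unfolding S_def l'_def[symmetric] by (rule level_mass_middle[OF u e q(1) l' avg])
    also have "(2 * l') powr (q - 2) * (32 * e\<^sup>2 * kin u) = A * r^k"
    proof -
      have 1: "(2 * l') powr (q - 2) = 2 powr (q - 2) * l' powr (q - 2)" using l' by (simp add: powr_mult)
      have 2: "e\<^sup>2 = 2 powr (4/3) * N powr (4/3) / l' powr (4/3)"
        unfolding e2 using N l' by (simp add: powr_mult powr_divide)
      have 3: "l' powr (q - 2) / l' powr (4/3) = l' powr (q - 10/3)" using l' by (simp add: powr_diff[symmetric])
      have 4: "l' powr (q - 10/3) = r^k * \<Lambda> powr (q - 10/3)"
      proof -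
        have "l' powr (q - 10/3) = (2^k) powr (q - 10/3) * \<Lambda> powr (q - 10/3)"
          unfolding l'_def using l by (simp add: powr_mult)
        also have "(2^k) powr (q - 10/3) = r^k"
          unfolding r_def by (simp add: powr_powr powr_realpow[symmetric] mult.commute)
        finally show ?thesis .
      qed
      have "(2 * l') powr (q - 2) * (32 * e\<^sup>2 * kin u) =
        32 * 2 powr (q - 2) * 2 powr (4/3) * N powr (4/3) * (l' powr (q - 2) / l' powr (4/3)) * kin u"
        unfolding 1 2 by simp
      also have "\<dots> = A * r^k" unfolding 3 4 A_def by (simp only: mult_ac)
      finally show ?thesis .
    qed
    finally show ?thesis .
  qed
  have "level_mass q u {\<Lambda><..} \<le> (\<integral>\<^sup>+z. (\<Sum>k. indicator (S k) (cmod (u z)) * ennreal (cmod (u z) powr q)) \<partial>lborel)"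
    unfolding level_mass_def
  proof (intro nn_integral_mono)
    fix z
    show "indicator {\<Lambda><..} (cmod (u z)) * ennreal (cmod (u z) powr q) \<le> (\<Sum>k. indicator (S k) (cmod (u z)) * ennreal (cmod (u z) powr q))"
    proof (cases "cmod (u z) > \<Lambda>")
      case True
      define k where "k = (LEAST k. cmod (u z) \<le> 2^Suc k * \<Lambda>)"
      obtain n where "cmod (u z) / \<Lambda> < 2^n" using real_arch_pow[of 2 "cmod (u z) / \<Lambda>"] by auto
      then have "cmod (u z) \<le> 2^n * \<Lambda>" using l by (simp add: field_simps)
      also have "\<dots> \<le> 2^Suc n * \<Lambda>" using l by simp
      finally have "cmod (u z) \<le> 2^Suc n * \<Lambda>" .
      then have k1: "cmod (u z) \<le> 2^Suc k * \<Lambda>" unfolding k_def by (rule LeastI)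
      have k2: "cmod (u z) > 2^k * \<Lambda>"
      proof (cases k)
        case 0
        then show ?thesis using True by simp
      next
        case (Suc j)
        then have "\<not> cmod (u z) \<le> 2^Suc j * \<Lambda>"
          unfolding k_def by (metis lessI not_less_Least)
        then show ?thesis using Suc by simp
      qed
      have "cmod (u z) \<in> S k" using k1 k2 by (simp add: S_def)
      then have "indicator {\<Lambda><..} (cmod (u z)) * ennreal (cmod (u z) powr q) = sum (\<lambda>k. indicator (S k) (cmod (u z)) * ennreal (cmod (u z) powr q)) {k}"
        using True by simp
      also have "\<dots> \<le> (\<Sum>k. indicator (S k) (cmod (u z)) * ennreal (cmod (u z) powr q))"
        by (rule sum_le_suminf) auto
      finally show ?thesis .
    qed simp
  qed
  also have "\<dots> = (\<Sum>k. level_mass q u (S k))"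
    unfolding level_mass_def by (rule nn_integral_suminf) (simp add: S_def)
  also have "\<dots> \<le> (\<Sum>k. ennreal (A * r^k))"
    by (intro suminf_le piece) auto
  also have "\<dots> = ennreal (A / (1 - r))"
    using r A by (subst suminf_ennreal2) (auto simp: suminf_mult suminf_geometric intro!: summable_mult summable_geometric)
  also have "A / (1 - r) = tail_const q * \<Lambda> powr (q - 10/3) * N powr (4/3) * kin u"
    by (simp add: A_def tail_const_def r_def)
  finally show ?thesis .
qed

lemma pot_level_mass:
  assumes "u \<in> L2" "level_mass q u UNIV \<le> ennreal c" "0 \<le> c"
  shows "integrable lborel (\<lambda>z. cmod (u z) powr q)" "pot q u \<le> c"
proof -
  note [measurable] = L2_measurable[OF assms(1)]
  have n: "(\<integral>\<^sup>+z. ennreal (cmod (u z) powr q) \<partial>lborel) \<le> ennreal c"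
    using assms(2) by (simp add: level_mass_def)
  show i: "integrable lborel (\<lambda>z. cmod (u z) powr q)"
    unfolding integrable_iff_bounded using n by (auto intro: le_less_trans[OF _ ennreal_less_top])
  show "pot q u \<le> c"
    using n assms(3) unfolding pot_def by (subst (asm) nn_integral_eq_integral[OF i]) auto
qed

text \<open>
  The threshold \<open>\<Lambda>\<close> is left free: a large \<open>\<Lambda>\<close> makes the coefficient of \<open>kin u\<close> as small as desired.
\<close>

theorem Gagliardo_Nirenberg:
  assumes u: "u \<in> X" and q: "2 < q" "q < 10/3" and N: "L2norm u \<le> N" "0 < N" and l: "0 < \<Lambda>"
  shows "integrable lborel (\<lambda>z. cmod (u z) powr q)"
    "pot q u \<le> \<Lambda> powr (q - 2) * L2sq u + tail_const q * \<Lambda> powr (q - 10/3) * N powr (4/3) * kin u"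
proof -
  note L = X_L2[OF u]
  have "UNIV = {..\<Lambda>} \<union> {\<Lambda><..}" by auto
  then have "level_mass q u UNIV \<le> level_mass q u {..\<Lambda>} + level_mass q u {\<Lambda><..}"
    using level_mass_Un[OF L, of "{..\<Lambda>}" "{\<Lambda><..}"] by simp
  also have "\<dots> \<le> ennreal (\<Lambda> powr (q - 2) * L2sq u) + ennreal (tail_const q * \<Lambda> powr (q - 10/3) * N powr (4/3) * kin u)"
    by (intro add_mono level_mass_low level_mass_high L assms)
  also have "\<dots> = ennreal (\<Lambda> powr (q - 2) * L2sq u + tail_const q * \<Lambda> powr (q - 10/3) * N powr (4/3) * kin u)"
    using tail_const_pos[OF q(2)] by (subst ennreal_plus) auto
  finally have *: "level_mass q u UNIV \<le> ennreal (\<Lambda> powr (q - 2) * L2sq u + tail_const q * \<Lambda> powr (q - 10/3) * N powr (4/3) * kin u)" .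
  show "integrable lborel (\<lambda>z. cmod (u z) powr q)"
    "pot q u \<le> \<Lambda> powr (q - 2) * L2sq u + tail_const q * \<Lambda> powr (q - 10/3) * N powr (4/3) * kin u"
    using pot_level_mass[OF L *] tail_const_pos[OF q(2)] by auto
qed

text \<open>
  Low levels contribute little by the bound on the mass and high levels by \<open>level_mass_high\<close>. If all
  averages at a suitable small scale are small, the remaining levels contribute little as well, by
  \<open>level_mass_middle\<close>. The constants leave at most \<open>3 \<delta> / 4\<close> in total.
\<close>

theorem nonvanishing:
  assumes q: "2 < q" "q < 10/3" and d: "\<delta> > 0" and C: "C > 0"
  obtains e \<kappa> where "e > 0" "\<kappa> > 0"
    "\<And>u. u \<in> X \<Longrightarrow> L2sq u \<le> C \<Longrightarrow> kin u \<le> C \<Longrightarrow> pot q u \<ge> \<delta> \<Longrightarrow> \<exists>z. cmod (box_avg e u z) \<ge> \<kappa>"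
proof -
  define l where "l = (\<delta> / (4 * C)) powr (1 / (q - 2))"
  have l: "l > 0" using d C by (simp add: l_def)
  have l2: "l powr (q - 2) * C = \<delta> / 4"
    unfolding l_def powr_powr using q d C by simp
  define B where "B = tail_const q * (sqrt C) powr (4/3) * C"
  have B: "B > 0" using tail_const_pos[OF q(2)] C by (simp add: B_def)
  have "((\<lambda>\<Lambda>. \<Lambda> powr (q - 10/3)) \<longlongrightarrow> 0) at_top"
    using q by (intro tendsto_neg_powr filterlim_ident) auto
  from order_tendstoD(2)[OF this, of "\<delta> / (4 * B)"] d B
  have "\<forall>\<^sub>F \<Lambda> in at_top. \<Lambda> powr (q - 10/3) < \<delta> / (4 * B)" by simp
  then obtain \<Lambda> where L: "\<Lambda> \<ge> l" "\<Lambda> powr (q - 10/3) < \<delta> / (4 * B)"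
    using eventually_conj[OF eventually_ge_at_top[of l]] eventually_happens[of _ at_top]
    by (metis (no_types, lifting) eventually_at_top_linorder linorder_le_cases)
  have L0: "\<Lambda> > 0" using L l by linarith
  define e where "e = sqrt (\<delta> / (4 * (\<Lambda> powr (q - 2) * 32 * C)))"
  have e: "e > 0" using d C L0 by (simp add: e_def)
  have e2: "\<Lambda> powr (q - 2) * (32 * e\<^sup>2 * C) = \<delta> / 4"
    using d C L0 by (simp add: e_def)
  have "\<exists>z. cmod (box_avg e u z) \<ge> l / 2" if u: "u \<in> X" "L2sq u \<le> C" "kin u \<le> C" "pot q u \<ge> \<delta>" for u
  proof (rule ccontr)
    assume "\<not> (\<exists>z. cmod (box_avg e u z) \<ge> l / 2)"
    then have avg: "cmod (box_avg e u z) \<le> l / 2" for z by (meson linear)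
    note U = X_L2[OF u(1)]
    have N: "L2norm u \<le> sqrt C" "0 < sqrt C" using u(2) C by (auto simp: L2norm_def)
    have "UNIV = {..l} \<union> ({l<..\<Lambda>} \<union> {\<Lambda><..})" using L by auto
    then have "level_mass q u UNIV \<le> level_mass q u {..l} + level_mass q u ({l<..\<Lambda>} \<union> {\<Lambda><..})"
      using level_mass_Un[OF U, of "{..l}" "{l<..\<Lambda>} \<union> {\<Lambda><..}"] by simp
    also have "\<dots> \<le> level_mass q u {..l} + (level_mass q u {l<..\<Lambda>} + level_mass q u {\<Lambda><..})"
      by (intro add_left_mono level_mass_Un U) auto
    also have "\<dots> \<le> ennreal (\<delta>/4) + (ennreal (\<delta>/4) + ennreal (\<delta>/4))"
    proof (intro add_mono)
      have "l powr (q - 2) * L2sq u \<le> \<delta>/4" unfolding l2[symmetric] using u(2) by (intro mult_left_mono) auto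
      then show "level_mass q u {..l} \<le> ennreal (\<delta>/4)"
        using level_mass_low[OF U q(1) l] by (meson ennreal_leI order_trans)
      have "\<Lambda> powr (q - 2) * (32 * e\<^sup>2 * kin u) \<le> \<delta>/4"
        unfolding e2[symmetric] using u(3) by (intro mult_left_mono) auto
      then show "level_mass q u {l<..\<Lambda>} \<le> ennreal (\<delta>/4)"
        using level_mass_middle[OF u(1) e q(1) l avg, of \<Lambda>] by (meson ennreal_leI order_trans)
      have "tail_const q * \<Lambda> powr (q - 10/3) * (sqrt C) powr (4/3) * kin u
          \<le> tail_const q * \<Lambda> powr (q - 10/3) * (sqrt C) powr (4/3) * C"
        using u(3) tail_const_pos[OF q(2)] by (intro mult_left_mono) auto
      also have "\<dots> = B * \<Lambda> powr (q - 10/3)" by (simp add: B_def)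
      also have "\<dots> \<le> B * (\<delta> / (4 * B))" using L(2) B by (intro mult_left_mono) auto
      also have "\<dots> = \<delta>/4" using B by simp
      finally show "level_mass q u {\<Lambda><..} \<le> ennreal (\<delta>/4)"
        using level_mass_high[OF u(1) q N L0] by (meson ennreal_leI order_trans)
    qed
    also have "\<dots> = ennreal (3 * \<delta> / 4)" using d by (simp flip: ennreal_plus)
    finally have "pot q u \<le> 3 * \<delta> / 4" using pot_level_mass(2)[OF U, of q "3 * \<delta> / 4"] d by simp
    then show False using u(4) d by linarith
  qed
  then show ?thesis using e l that[of e "l/2"] by auto
qed

section \<open>Weak and local compactness\<close>

lemma bounded_diagonal_subsequence:
  fixes x :: "nat \<Rightarrow> nat \<Rightarrow> complex"
  assumes B: "\<And>n i. cmod (x n i) \<le> B i"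
  obtains r where "strict_mono r" "\<And>i. convergent (\<lambda>n. x (r n) i)"
proof -
  interpret subseqs "\<lambda>i s. convergent (\<lambda>n. x (s n) i)"
  proof
    fix i and s :: "nat \<Rightarrow> nat" assume "strict_mono s"
    have "bounded (range (\<lambda>n. x (s n) i))"
      using B by (auto intro!: boundedI)
    then show "\<exists>r'. strict_mono r' \<and> convergent (\<lambda>n. x ((s \<circ> r') n) i)"
      using bounded_imp_convergent_subsequence[of "\<lambda>n. x (s n) i"] by (auto simp: o_def convergent_def)
  qed
  have "convergent (\<lambda>n. x (diagseq n) i)" for i
  proof -
    have "convergent (\<lambda>n. x ((diagseq \<circ> ((+) (Suc i))) n) i)"
    proof (rule diagseq_holds)
      fix r s :: "nat \<Rightarrow> nat" and n
      assume r: "strict_mono r" "convergent (\<lambda>k. x (s k) n)"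
      then show "convergent (\<lambda>k. x ((s \<circ> r) k) n)"
        using convergent_subseq_convergent[of "\<lambda>k. x (s k) n" r] by (simp add: o_def)
    qed
    then have "convergent (\<lambda>n. x (diagseq (n + Suc i)) i)" by (simp add: o_def add.commute)
    then show ?thesis by (subst (asm) convergent_ignore_initial_segment)
  qed
  then show ?thesis using subseq_diagseq that by blast
qed

definition weak_conv :: "(nat \<Rightarrow> plane \<Rightarrow> complex) \<Rightarrow> (plane \<Rightarrow> complex) \<Rightarrow> bool" where
  "weak_conv g h \<longleftrightarrow> (\<forall>\<phi>\<in>L2. (\<lambda>n. L2_inner (g n) \<phi>) \<longlonglongrightarrow> L2_inner h \<phi>)"

lemma weak_convD: "weak_conv g h \<Longrightarrow> \<phi> \<in> L2 \<Longrightarrow> (\<lambda>n. L2_inner (g n) \<phi>) \<longlonglongrightarrow> L2_inner h \<phi>"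
  by (simp add: weak_conv_def)

text \<open>
  Truncations are dense, and the bound on the norms makes the error of truncating \<open>\<phi>\<close> uniform in \<open>n\<close>.
\<close>

lemma weak_conv_truncated:
  assumes g: "\<And>n. g n \<in> L2" "\<And>n. L2sq (g n) \<le> C" and h: "h \<in> L2"
    and lim: "\<And>\<phi> R. \<phi> \<in> L2 \<Longrightarrow>
      (\<lambda>n. L2_inner (g n) (\<lambda>z. indicator (cball 0 (real R)) z * \<phi> z))
        \<longlonglongrightarrow> L2_inner h (\<lambda>z. indicator (cball 0 (real R)) z * \<phi> z)"
  shows "weak_conv g h"
  unfolding weak_conv_def
proof (intro ballI LIMSEQ_I)
  fix \<phi> :: "plane \<Rightarrow> complex" and e :: real assume \<phi>: "\<phi> \<in> L2" and e: "e > 0"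
  define M where "M = sqrt C + L2norm h + 1"
  have C0: "0 \<le> C" using g(2)[of 0] L2sq_nonneg[of "g 0"] by linarith
  have M: "M > 0" using C0 by (simp add: M_def add_nonneg_pos)
  have "(\<lambda>n. L2norm (\<lambda>z. indicator (cball 0 (real n)) z * \<phi> z - \<phi> z)) \<longlonglongrightarrow> 0"
    using L2_truncate_tendsto_nat[OF \<phi>] by (simp add: L2norm_tendsto_0_iff)
  from LIMSEQ_D[OF this, of "e / (2 * M)"] e M obtain R :: nat
    where R: "L2norm (\<lambda>z. indicator (cball 0 (real R)) z * \<phi> z - \<phi> z) < e / (2 * M)" by auto
  let ?p = "\<lambda>z. indicator (cball 0 (real R)) z * \<phi> z"
  have p: "?p \<in> L2" by (rule truncate_L2[OF \<phi>])
  from LIMSEQ_D[OF lim[OF \<phi>, of R], of "e/2"] e obtain N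
    where N: "\<And>n. n \<ge> N \<Longrightarrow> cmod (L2_inner (g n) ?p - L2_inner h ?p) < e/2" by auto
  have "cmod (L2_inner (g n) \<phi> - L2_inner h \<phi>) < e" if "n \<ge> N" for n
  proof -
    have gn: "L2norm (g n) \<le> sqrt C" using g(2)[of n] by (simp add: L2norm_def)
    have eq: "L2_inner (g n) \<phi> - L2_inner h \<phi> = (L2_inner (g n) ?p - L2_inner h ?p)
        - (L2_inner (g n) (\<lambda>z. ?p z - \<phi> z) - L2_inner h (\<lambda>z. ?p z - \<phi> z))"
      by (simp add: L2_inner_diff_right[OF p \<phi>] g h)
    have "cmod (L2_inner (g n) \<phi> - L2_inner h \<phi>) \<le> cmod (L2_inner (g n) ?p - L2_inner h ?p)
        + (cmod (L2_inner (g n) (\<lambda>z. ?p z - \<phi> z)) + cmod (L2_inner h (\<lambda>z. ?p z - \<phi> z)))"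
      unfolding eq by (intro order_trans[OF norm_triangle_ineq4] add_left_mono norm_triangle_ineq4)
    also have "cmod (L2_inner (g n) (\<lambda>z. ?p z - \<phi> z)) + cmod (L2_inner h (\<lambda>z. ?p z - \<phi> z))
      \<le> L2norm (g n) * L2norm (\<lambda>z. ?p z - \<phi> z) + L2norm h * L2norm (\<lambda>z. ?p z - \<phi> z)"
      by (intro add_mono L2_inner_bound L2_diff p \<phi> g h)
    also have "\<dots> \<le> M * L2norm (\<lambda>z. ?p z - \<phi> z)"
      unfolding distrib_right[symmetric] M_def using gn by (intro mult_right_mono) auto
    also have "\<dots> \<le> M * (e / (2 * M))" using R M by (intro mult_left_mono) auto
    also have "\<dots> = e / 2" using M by simp
    finally show ?thesis using N[OF that] by linarith
  qed
  then show "\<exists>N. \<forall>n\<ge>N. norm (L2_inner (g n) \<phi> - L2_inner h \<phi>) < e" by blast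
qed

text \<open>
  Testing against \<open>m h'\<close> truncated to a ball bounds the norm of this truncation by \<open>sqrt C\<close>, so \<open>m h'\<close>
  is square integrable. The truncations of a test function absorb the weight.
\<close>

lemma weak_conv_mult:
  assumes h: "\<And>n. h n \<in> L2" "h' \<in> L2" "weak_conv h h'"
    and [measurable]: "m \<in> borel_measurable borel" and m: "\<And>R z. norm z \<le> R \<Longrightarrow> \<bar>m z\<bar> \<le> B R"
    and mh: "\<And>n. (\<lambda>z. complex_of_real (m z) * h n z) \<in> L2" "\<And>n. L2sq (\<lambda>z. complex_of_real (m z) * h n z) \<le> C"
  shows "(\<lambda>z. complex_of_real (m z) * h' z) \<in> L2"
    "weak_conv (\<lambda>n z. complex_of_real (m z) * h n z) (\<lambda>z. complex_of_real (m z) * h' z)"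
proof -
  note [measurable] = L2_measurable[OF h(2)] L2_measurable[OF h(1)]
  let ?i = "\<lambda>R z. indicator (cball 0 (real R)) z :: complex"
  have tr: "(\<lambda>z. complex_of_real (m z) * (?i R z * \<phi> z)) \<in> L2" if "\<phi> \<in> L2" for \<phi> R
  proof (rule L2_bound(1)[OF that, where B="B R"])
    note [measurable] = L2_measurable[OF that]
    show "(\<lambda>z. complex_of_real (m z) * (?i R z * \<phi> z)) \<in> borel_measurable borel" by measurable
    fix z
    have "0 \<le> B R" using m[of 0 "real R"] by (simp add: order_trans[OF abs_ge_zero])
    then show "cmod (complex_of_real (m z) * (?i R z * \<phi> z)) \<le> B R * cmod (\<phi> z)"
      using m[of z "real R"] by (auto simp: norm_mult norm_indicator_complex mult_right_mono split: split_indicator)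
  qed
  have sw: "L2_inner (\<lambda>z. complex_of_real (m z) * u z) (\<lambda>z. ?i R z * \<phi> z) = L2_inner u (\<lambda>z. complex_of_real (m z) * (?i R z * \<phi> z))" for u \<phi> R
    unfolding L2_inner_def by (intro Bochner_Integration.integral_cong) auto
  have lim: "(\<lambda>n. L2_inner (\<lambda>z. complex_of_real (m z) * h n z) (\<lambda>z. ?i R z * \<phi> z))
        \<longlonglongrightarrow> L2_inner (\<lambda>z. complex_of_real (m z) * h' z) (\<lambda>z. ?i R z * \<phi> z)" if "\<phi> \<in> L2" for \<phi> R
    unfolding sw by (rule weak_convD[OF h(3) tr[OF that]])
  have C0: "0 \<le> C" using mh(2)[of 0] by (rule order_trans[OF L2sq_nonneg])
  define f where "f R z = complex_of_real (m z) * (?i R z * h' z)" for R z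
  have fL: "f R \<in> L2" for R unfolding f_def by (rule tr[OF h(2)])
  have fC: "L2sq (f R) \<le> C" for R
  proof -
    have i2: "?i R z * f R z = f R z" for z by (simp add: f_def split: split_indicator)
    have "(\<lambda>n. L2_inner (\<lambda>z. complex_of_real (m z) * h n z) (f R)) \<longlonglongrightarrow> L2_inner (\<lambda>z. complex_of_real (m z) * h' z) (f R)"
      using lim[OF fL, of R R] by (simp only: i2)
    moreover have "L2_inner (\<lambda>z. complex_of_real (m z) * h' z) (f R) = L2_inner (f R) (f R)"
      unfolding L2_inner_def by (intro Bochner_Integration.integral_cong) (auto simp: f_def split: split_indicator)
    ultimately have "(\<lambda>n. cmod (L2_inner (\<lambda>z. complex_of_real (m z) * h n z) (f R))) \<longlonglongrightarrow> cmod (L2_inner (f R) (f R))"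
      by (intro tendsto_norm) simp
    moreover have "cmod (L2_inner (\<lambda>z. complex_of_real (m z) * h n z) (f R)) \<le> sqrt C * L2norm (f R)" for n
      by (rule order_trans[OF L2_inner_bound[OF mh(1) fL]]) (use mh(2) in \<open>auto simp: L2norm_def intro!: mult_right_mono\<close>)
    ultimately have "cmod (L2_inner (f R) (f R)) \<le> sqrt C * L2norm (f R)"
      by (intro Lim_bounded[where M=0]) auto
    then have *: "L2norm (f R) * L2norm (f R) \<le> sqrt C * L2norm (f R)"
      by (simp add: L2_inner_self flip: power2_eq_square)
    have "L2norm (f R) \<le> sqrt C"
    proof (cases "L2norm (f R) = 0")
      case False
      then have "L2norm (f R) > 0" using L2norm_nonneg[of "f R"] by linarith
      then show ?thesis using * by simp
    qed (use C0 in simp)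
    then have "(L2norm (f R))\<^sup>2 \<le> (sqrt C)\<^sup>2" by (intro power_mono) auto
    then show ?thesis using C0 by simp
  qed
  show mL: "(\<lambda>z. complex_of_real (m z) * h' z) \<in> L2"
  proof (rule L2_Fatou(1)[OF fL fC])
    show "AE z in lborel. (\<lambda>R. f R z) \<longlonglongrightarrow> complex_of_real (m z) * h' z"
    proof (intro AE_I2 tendsto_eventually)
      fix z :: plane
      obtain M :: nat where M: "norm z \<le> real M" using real_arch_simple by blast
      show "\<forall>\<^sub>F R in sequentially. f R z = complex_of_real (m z) * h' z"
        using eventually_ge_at_top[of M] by eventually_elim (use M in \<open>auto simp: f_def\<close>)
    qed
  qed measurable
  show "weak_conv (\<lambda>n z. complex_of_real (m z) * h n z) (\<lambda>z. complex_of_real (m z) * h' z)"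
    by (rule weak_conv_truncated[OF mh mL lim])
qed

lemma weak_conv_FT:
  assumes "\<And>n. v n \<in> L2" "v' \<in> L2" "weak_conv v v'"
  shows "weak_conv (\<lambda>n. FT (v n)) (FT v')"
  unfolding weak_conv_def
proof
  fix \<phi> :: "plane \<Rightarrow> complex" assume \<phi>: "\<phi> \<in> L2"
  obtain \<theta> where \<theta>: "\<theta> \<in> L2" "has_fourier \<theta> \<phi>" using FT_surj[OF \<phi>] .
  have eq: "L2_inner (FT u) \<phi> = 4 * pi\<^sup>2 * L2_inner u \<theta>" if "u \<in> L2" for u
    unfolding Parseval[OF that \<theta>(1), symmetric]
    by (intro L2_inner_cong_AE AE_symmetric[OF FT_eqI[OF \<theta>(2)]] L2_measurable FT_L2 that \<theta> \<phi> AE_I2 refl)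
  show "(\<lambda>n. L2_inner (FT (v n)) \<phi>) \<longlonglongrightarrow> L2_inner (FT v') \<phi>"
    unfolding eq[OF assms(1)] eq[OF assms(2)]
    by (intro tendsto_intros weak_convD[OF assms(3) \<theta>(1)])
qed

lemma gauss_L2: "(\<lambda>z. complex_of_real (gauss z)) \<in> L2"
proof -
  have "integrable lborel (\<lambda>z. (gauss z)\<^sup>2)"
  proof (rule Bochner_Integration.integrable_bound[OF gauss_integrable])
    show "AE z in lborel. norm ((gauss z)\<^sup>2) \<le> norm (gauss z)"
      by (intro AE_I2) (simp add: power2_eq_square mult_left_le gauss_le_1)
  qed measurable
  then show ?thesis by (simp add: L2_iff)
qed

lemma weight_small:
  assumes "d > 0"
  obtains \<delta> where "\<delta> > 0" "\<And>z. norm z < \<delta> \<Longrightarrow> weight z < d"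
proof -
  have c: "continuous_on UNIV weight"
    unfolding weight_def[abs_def] by (intro continuous_intros)
  then have "isCont weight 0" using continuous_on_eq_continuous_at[of UNIV weight] by blast
  then obtain \<delta> where "\<delta> > 0" "\<And>z. norm (z - 0) < \<delta> \<Longrightarrow> norm (weight z - weight 0) < d"
    using assms unfolding isCont_def LIM_eq by (metis norm_zero diff_zero assms diff_self)
  then show ?thesis using that[of \<delta>] by (simp add: weight_def)
qed

text \<open>
  A diagonal argument gives convergence at a countable dense set of points. It extends to all
  points because the averages at a fixed scale are equicontinuous by \<open>box_avg_dist\<close>.
\<close>

lemma box_avg_subsequence:
  fixes v :: "nat \<Rightarrow> plane \<Rightarrow> complex"
  assumes v: "\<And>n. v n \<in> X" "\<And>n. L2sq (v n) \<le> C" "\<And>n. kin (v n) \<le> C"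
  obtains r where "strict_mono r"
    "\<And>k z. convergent (\<lambda>n. box_avg (1 / real (Suc k)) (v (r n)) z)"
proof -
  define e where "e k = 1 / real (Suc k)" for k
  have e: "e k > 0" for k by (simp add: e_def)
  note L = X_L2[OF v(1)]
  obtain D :: "plane set" where D: "countable D" "\<And>U. open U \<Longrightarrow> U \<noteq> {} \<Longrightarrow> \<exists>d\<in>D. d \<in> U"
    by (rule countable_dense_setE) blast
  have Dne: "D \<noteq> {}" using D(2)[of UNIV] by auto
  define d where "d = from_nat_into D"
  have dense: "\<exists>j. d j \<in> U" if "open U" "U \<noteq> {}" for U
    using D(2)[OF that] range_from_nat_into[OF Dne D(1)] unfolding d_def by (metis rangeE)
  define x where "x n i = box_avg (e (fst (prod_decode i))) (v n) (d (snd (prod_decode i)))" for n i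
  have B: "cmod (x n i) \<le> sqrt C / sqrt ((e (fst (prod_decode i)))^3)" for n i
    unfolding x_def
    by (rule order_trans[OF box_avg_bound[OF L e]]) (use v(2) e in \<open>auto simp: L2norm_def less_imp_le intro!: divide_right_mono\<close>)
  obtain r where r: "strict_mono r" "\<And>i. convergent (\<lambda>n. x (r n) i)"
    by (rule bounded_diagonal_subsequence[where x=x, OF B], rule that)
  have conv: "convergent (\<lambda>n. box_avg (e k) (v (r n)) z)" for k z
  proof -
    have Cau: "Cauchy (\<lambda>n. box_avg (e k) (v (r n)) (d j))" for j
      using r(2)[of "prod_encode (k, j)"] by (simp add: x_def Cauchy_convergent_iff)
    have "Cauchy (\<lambda>n. box_avg (e k) (v (r n)) z)"
    proof (rule CauchyI)
      fix \<eta> :: real assume \<eta>: "\<eta> > 0"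
      define s where "s = sqrt ((e k)^3)"
      have s: "s > 0" using e by (simp add: s_def)
      have C0: "0 \<le> C" using v(2)[of 0] by (rule order_trans[OF L2sq_nonneg])
      obtain \<delta> where \<delta>: "\<delta> > 0" "\<And>z. norm z < \<delta> \<Longrightarrow> weight z < (\<eta> / 3 * s)\<^sup>2 / (4 * (C + 1))"
        using weight_small[of "(\<eta> / 3 * s)\<^sup>2 / (4 * (C + 1))"] \<eta> s C0 by auto
      obtain j where "d j \<in> ball z \<delta>" using dense[of "ball z \<delta>"] \<delta>(1) by auto
      then have "norm (z - d j) < \<delta>" by (simp add: dist_norm)
      then have w: "weight (z - d j) \<le> (\<eta> / 3 * s)\<^sup>2 / (4 * (C + 1))" using \<delta>(2) by (simp add: less_imp_le)
      have close: "cmod (box_avg (e k) (v n) z - box_avg (e k) (v n) (d j)) \<le> \<eta> / 3" for n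
      proof -
        have "4 * weight (z - d j) * kin (v n) \<le> 4 * ((\<eta> / 3 * s)\<^sup>2 / (4 * (C + 1))) * (C + 1)"
          using w v(3)[of n] C0 by (intro mult_mono) auto
        also have "\<dots> = (\<eta> / 3 * s)\<^sup>2"
        proof -
          have "4 * (y / (4 * (C + 1))) * (C + 1) = y" for y :: real using C0 by (simp add: field_simps)
          then show ?thesis .
        qed
        finally have "sqrt (4 * weight (z - d j) * kin (v n)) \<le> \<eta> / 3 * s"
          using \<eta> s by (intro real_le_lsqrt) auto
        then have "sqrt (4 * weight (z - d j) * kin (v n)) / s \<le> \<eta> / 3" using s by (simp add: pos_divide_le_eq)
        then show ?thesis using box_avg_dist[OF v(1) e, of k n z "d j"] unfolding s_def by linarith
      qed
      obtain M where M: "\<And>m n. m \<ge> M \<Longrightarrow> n \<ge> M \<Longrightarrow>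
          cmod (box_avg (e k) (v (r m)) (d j) - box_avg (e k) (v (r n)) (d j)) < \<eta> / 3"
        using CauchyD[OF Cau[of j], of "\<eta>/3"] \<eta> by auto
      have "cmod (box_avg (e k) (v (r m)) z - box_avg (e k) (v (r n)) z) < \<eta>" if mn: "m \<ge> M" "n \<ge> M" for m n
      proof -
        let ?a = "\<lambda>n z. box_avg (e k) (v (r n)) z"
        have eq: "?a m z - ?a n z = (?a m z - ?a m (d j)) + (?a m (d j) - ?a n (d j)) - (?a n z - ?a n (d j))" by simp
        have "cmod (?a m z - ?a n z) \<le> cmod (?a m z - ?a m (d j)) + cmod (?a m (d j) - ?a n (d j)) + cmod (?a n z - ?a n (d j))"
          by (subst eq) (intro order_trans[OF norm_triangle_ineq4] add_right_mono norm_triangle_ineq)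
        then show ?thesis using close[of "r m"] close[of "r n"] M[OF mn] by linarith
      qed
      then show "\<exists>M. \<forall>m\<ge>M. \<forall>n\<ge>M. norm (box_avg (e k) (v (r m)) z - box_avg (e k) (v (r n)) z) < \<eta>" by blast
    qed
    then show ?thesis by (simp add: Cauchy_convergent_iff)
  qed
  show ?thesis using that[OF r(1)] conv unfolding e_def by blast
qed

text \<open>
  A Gaussian weight \<open>\<omega>\<close> replaces local convergence by convergence on the whole plane. For a fixed
  scale the weighted averages converge by dominated convergence, and \<open>box_avg_error\<close> bounds the
  distance to the functions uniformly in \<open>n\<close>; so the weighted functions form a Cauchy sequence. Division
  by \<open>\<omega>\<close> gives the limit, almost everywhere and weakly. Weak convergence carries over to the
  transforms, and with the weight of \<open>kin\<close> by \<open>weak_conv_mult\<close>.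
\<close>

theorem X_compactness:
  fixes v :: "nat \<Rightarrow> plane \<Rightarrow> complex"
  assumes v: "\<And>n. v n \<in> X" "\<And>n. L2sq (v n) \<le> C" "\<And>n. kin (v n) \<le> C"
  obtains r v' where "strict_mono r" "v' \<in> X" "AE z in lborel. (\<lambda>n. v (r n) z) \<longlonglongrightarrow> v' z"
    "weak_conv (\<lambda>n. v (r n)) v'" "(\<lambda>n. dform (v (r n)) v') \<longlonglongrightarrow> dform v' v'"
proof -
  note L = X_L2[OF v(1)]
  have C0: "0 \<le> C" using v(2)[of 0] by (rule order_trans[OF L2sq_nonneg])
  note [measurable] = L2_measurable[OF L] box_avg_measurable[OF L]
  obtain r where r: "strict_mono r" and conv: "\<And>k z. convergent (\<lambda>n. box_avg (1 / real (Suc k)) (v (r n)) z)"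
    using box_avg_subsequence[of v C] v by blast
  define \<omega> where "\<omega> z = complex_of_real (gauss z)" for z
  have [measurable]: "\<omega> \<in> borel_measurable borel" unfolding \<omega>_def[abs_def] by measurable
  have \<omega>: "\<omega> \<in> L2" "\<And>z. \<omega> z \<noteq> 0" "\<And>z. cmod (\<omega> z) \<le> 1"
    using gauss_L2 by (simp_all add: \<omega>_def[abs_def] gauss_le_1)
  have \<omega>L: "(\<lambda>z. \<omega> z * u z) \<in> L2" "L2sq (\<lambda>z. \<omega> z * u z) \<le> L2sq u" if "u \<in> L2" for u
  proof -
    note [measurable] = L2_measurable[OF that]
    have "cmod (\<omega> z * u z) \<le> 1 * cmod (u z)" for z
      unfolding norm_mult by (intro mult_right_mono \<omega>) simp
    from L2_bound[OF that _ this] show "(\<lambda>z. \<omega> z * u z) \<in> L2" "L2sq (\<lambda>z. \<omega> z * u z) \<le> L2sq u" by auto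
  qed
  define f where "f n z = \<omega> z * v (r n) z" for n z
  have fL: "f n \<in> L2" for n unfolding f_def by (intro \<omega>L L)
  have Cau: "\<exists>N. \<forall>m\<ge>N. \<forall>n\<ge>N. L2sq (\<lambda>z. f m z - f n z) \<le> \<eta>" if \<eta>: "\<eta> > 0" for \<eta>
  proof -
    define t where "t = sqrt \<eta> / 4"
    have t: "t > 0" using \<eta> by (simp add: t_def)
    obtain k where k: "1 / real (Suc k) < t / sqrt (8 * (C + 1))"
      using reals_Archimedean[of "t / sqrt (8 * (C + 1))"] t C0 by (auto simp: inverse_eq_divide)
    define e where "e = 1 / real (Suc k)"
    have e: "e > 0" by (simp add: e_def)
    have err: "L2norm (\<lambda>z. v n z - box_avg e (v n) z) \<le> t" for n
    proof -
      have "L2sq (\<lambda>z. v n z - box_avg e (v n) z) \<le> 8 * e\<^sup>2 * (C + 1)"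
        by (rule order_trans[OF box_avg_error(2)[OF v(1) e]]) (use v(3)[of n] C0 in \<open>auto intro!: mult_left_mono\<close>)
      also have "\<dots> = (sqrt (8 * (C + 1)) * e)\<^sup>2" using C0 by (simp add: power_mult_distrib)
      also have "\<dots> \<le> t\<^sup>2"
      proof (intro power_mono)
        have "e < t / sqrt (8 * (C + 1))" using k by (simp only: e_def)
        then have "e * sqrt (8 * (C + 1)) < t" using C0 by (subst (asm) pos_less_divide_eq) auto
        then show "sqrt (8 * (C + 1)) * e \<le> t" by (simp add: mult.commute)
      qed (use e C0 in simp)
      finally show ?thesis unfolding L2norm_def using t by (intro real_le_lsqrt) auto
    qed
    define a where "a n z = \<omega> z * box_avg e (v (r n)) z" for n z
    have am [measurable]: "a n \<in> borel_measurable borel" for n unfolding a_def[abs_def] by measurable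
    define b where "b = sqrt C / sqrt (e^3)"
    have bb: "cmod (box_avg e (v n) z) \<le> b" for n z
      unfolding b_def by (rule order_trans[OF box_avg_bound[OF L e]])
        (use v(2) e in \<open>auto simp: L2norm_def less_imp_le intro!: divide_right_mono\<close>)
    have b0: "0 \<le> b" by (rule order_trans[OF norm_ge_zero bb])
    define a' where "a' z = \<omega> z * lim (\<lambda>n. box_avg e (v (r n)) z)" for z
    have a'm [measurable]: "a' \<in> borel_measurable borel" unfolding a'_def[abs_def] by measurable
    have al: "(\<lambda>n. a n z) \<longlonglongrightarrow> a' z" for z
      unfolding a_def a'_def using conv[of k z]
      by (intro tendsto_intros) (simp add: e_def convergent_LIMSEQ_iff)
    have ab: "cmod (a n z) \<le> cmod (complex_of_real b * \<omega> z)" for n z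
      using mult_right_mono[OF bb[of "r n" z], of "cmod (\<omega> z)"] b0 by (simp add: a_def norm_mult mult.commute)
    have aL1: "a' \<in> L2"
      by (rule L2_dominated(1)[OF am L2_scale[OF \<omega>(1), of b] a'm ab AE_I2[OF al]])
    have aL2: "(\<lambda>n. L2sq (\<lambda>z. a n z - a' z)) \<longlonglongrightarrow> 0"
      by (rule L2_dominated(2)[OF am L2_scale[OF \<omega>(1), of b] a'm ab AE_I2[OF al]])
    note aL = aL1 aL2
    have anL: "a n \<in> L2" for n
      by (rule L2_bound(1)[OF L2_scale[OF \<omega>(1), of b] am, where B=1]) (use ab in simp)
    from LIMSEQ_D[OF aL(2)[folded L2norm_tendsto_0_iff], of t] t obtain N
      where N: "\<And>n. n \<ge> N \<Longrightarrow> L2norm (\<lambda>z. a n z - a' z) < t" by auto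
    have fa: "L2norm (\<lambda>z. f n z - a n z) \<le> t" for n
    proof -
      have "L2sq (\<lambda>z. f n z - a n z) \<le> L2sq (\<lambda>z. v (r n) z - box_avg e (v (r n)) z)"
        using \<omega>L(2)[OF box_avg_error(1)[OF v(1)[of "r n"] e]] by (simp add: f_def a_def right_diff_distrib)
      then have "L2norm (\<lambda>z. f n z - a n z) \<le> L2norm (\<lambda>z. v (r n) z - box_avg e (v (r n)) z)"
        by (simp add: L2norm_def)
      then show ?thesis using err[of "r n"] by linarith
    qed
    have "L2sq (\<lambda>z. f m z - f n z) \<le> \<eta>" if mn: "m \<ge> N" "n \<ge> N" for m n
    proof -
      have "L2norm (\<lambda>z. f m z - f n z) \<le> L2norm (\<lambda>z. f m z - a m z) + L2norm (\<lambda>z. a m z - f n z)"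
        by (intro L2norm_triangle_diff fL anL)
      moreover have "L2norm (\<lambda>z. a m z - f n z) \<le> L2norm (\<lambda>z. a m z - a' z) + L2norm (\<lambda>z. a' z - f n z)"
        by (intro L2norm_triangle_diff fL anL aL)
      moreover have "L2norm (\<lambda>z. a' z - f n z) \<le> L2norm (\<lambda>z. a' z - a n z) + L2norm (\<lambda>z. a n z - f n z)"
        by (intro L2norm_triangle_diff fL anL aL)
      ultimately have "L2norm (\<lambda>z. f m z - f n z) \<le> 4 * t"
        using fa[of m] fa[of n] N[OF mn(1)] N[OF mn(2)]
          L2norm_diff_commute[of a' "a n"] L2norm_diff_commute[of "a n" "f n"] by linarith
      then have "(L2norm (\<lambda>z. f m z - f n z))\<^sup>2 \<le> (4 * t)\<^sup>2" by (intro power_mono) auto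
      then show ?thesis using \<eta> by (simp add: t_def power_divide)
    qed
    then show ?thesis by blast
  qed
  obtain g s where g: "g \<in> L2" "strict_mono s" "AE z in lborel. (\<lambda>n. f (s n) z) \<longlonglongrightarrow> g z"
    "(\<lambda>n. L2sq (\<lambda>z. f n z - g z)) \<longlonglongrightarrow> 0"
    using Riesz_Fischer[of f, OF fL Cau] by blast
  note [measurable] = L2_measurable[OF g(1)]
  define q where "q = r \<circ> s"
  have q: "strict_mono q" unfolding q_def using r g(2) by (rule strict_mono_o)
  define v' where "v' z = g z / \<omega> z" for z
  have [measurable]: "v' \<in> borel_measurable borel" unfolding v'_def[abs_def] by measurable
  have ae: "AE z in lborel. (\<lambda>n. v (q n) z) \<longlonglongrightarrow> v' z"
    using g(3)
  proof eventually_elim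
    case (elim z)
    from tendsto_divide[OF elim tendsto_const \<omega>(2)[of z]] show ?case
      using \<omega>(2) by (simp add: f_def v'_def q_def)
  qed
  have v'L: "v' \<in> L2" "L2sq v' \<le> C"
    using L2_Fatou[of "\<lambda>n. v (q n)", OF L v(2) _ ae] by auto
  have fs: "(\<lambda>n. L2sq (\<lambda>z. f (s n) z - g z)) \<longlonglongrightarrow> 0"
    using LIMSEQ_subseq_LIMSEQ[OF g(4) g(2)] by (simp add: o_def)
  have w: "weak_conv (\<lambda>n. v (q n)) v'"
  proof (rule weak_conv_truncated[OF L v(2) v'L(1)])
    fix \<phi> :: "plane \<Rightarrow> complex" and R :: nat assume \<phi>: "\<phi> \<in> L2"
    note [measurable] = L2_measurable[OF \<phi>]
    define \<psi> where "\<psi> z = indicator (cball 0 (real R)) z * \<phi> z / \<omega> z" for z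
    have \<psi>: "\<psi> \<in> L2"
    proof (rule L2_bound(1)[OF \<phi>, where B="exp ((real R)\<^sup>2 / 2)"])
      show "\<psi> \<in> borel_measurable borel" unfolding \<psi>_def[abs_def] by measurable
      show "cmod (\<psi> z) \<le> exp ((real R)\<^sup>2 / 2) * cmod (\<phi> z)" for z
      proof (cases "norm z \<le> real R")
        case True
        then have "(norm z)\<^sup>2 \<le> (real R)\<^sup>2" by (intro power_mono) auto
        then have "exp ((z \<bullet> z) / 2) \<le> exp ((real R)\<^sup>2 / 2)" by (simp add: power2_norm_eq_inner)
        moreover have "cmod (\<psi> z) = exp ((z \<bullet> z) / 2) * cmod (\<phi> z)"
        proof -
          have "\<psi> z = \<phi> z / \<omega> z" using True by (simp add: \<psi>_def)
          moreover have "cmod (\<omega> z) = exp (- ((z \<bullet> z) / 2))" by (simp add: \<omega>_def gauss_def)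
          ultimately have "cmod (\<psi> z) = cmod (\<phi> z) / exp (- ((z \<bullet> z) / 2))" by (simp only: norm_divide)
          then show ?thesis by (simp only: exp_minus divide_inverse inverse_inverse_eq mult.commute)
        qed
        ultimately show ?thesis by (simp add: mult_right_mono)
      next
        case False
        then show ?thesis by (simp add: \<psi>_def)
      qed
    qed
    have sw: "L2_inner u (\<lambda>z. indicator (cball 0 (real R)) z * \<phi> z) = L2_inner (\<lambda>z. \<omega> z * u z) \<psi>" for u
      unfolding L2_inner_def
    proof (intro Bochner_Integration.integral_cong refl)
      fix z
      have "\<omega> z * cnj (\<psi> z) = cnj (\<omega> z * \<psi> z)" by (simp add: \<omega>_def)
      also have "\<omega> z * \<psi> z = indicator (cball 0 (real R)) z * \<phi> z" using \<omega>(2) by (simp add: \<psi>_def)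
      finally show "u z * cnj (indicator (cball 0 (real R)) z * \<phi> z) = \<omega> z * u z * cnj (\<psi> z)"
        by (simp add: mult.assoc mult.left_commute)
    qed
    have "(\<lambda>n. L2_inner (f (s n)) \<psi>) \<longlonglongrightarrow> L2_inner g \<psi>"
      by (rule L2_inner_tendsto[OF fL g(1) \<psi> fs])
    moreover have "f (s n) = (\<lambda>z. \<omega> z * v (q n) z)" for n by (simp add: f_def[abs_def] q_def)
    moreover have "g = (\<lambda>z. \<omega> z * v' z)" using \<omega>(2) by (simp add: v'_def[abs_def])
    ultimately show "(\<lambda>n. L2_inner (v (q n)) (\<lambda>z. indicator (cball 0 (real R)) z * \<phi> z))
       \<longlonglongrightarrow> L2_inner v' (\<lambda>z. indicator (cball 0 (real R)) z * \<phi> z)"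
      unfolding sw by simp
  qed
  have WC: "L2sq (WFT (v n)) \<le> 4 * pi\<^sup>2 * C" for n
    using v(3)[of n] by (simp add: kin_def field_simps)
  have m: "\<bar>sqrt (weight z)\<bar> \<le> sqrt (R\<^sup>2 + R)" if "norm z \<le> R" for z R
  proof -
    have "\<bar>fst z\<bar> \<le> R" "\<bar>snd z\<bar> \<le> R"
      using norm_fst_le[of "fst z" "snd z"] norm_snd_le[of "snd z" "fst z"] that by simp_all
    moreover from this(1) have "(fst z)\<^sup>2 \<le> R\<^sup>2" by (metis abs_ge_zero power2_abs power_mono)
    ultimately show ?thesis by (simp add: weight_def)
  qed
  have W: "WFT v' \<in> L2" "weak_conv (\<lambda>n. WFT (v (q n))) (WFT v')"
    using weak_conv_mult[of "\<lambda>n. FT (v (q n))" "FT v'" "\<lambda>z. sqrt (weight z)" "\<lambda>R. sqrt (R\<^sup>2 + R)" "4 * pi\<^sup>2 * C"]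
      weak_conv_FT[OF L v'L(1) w] m WFT_L2[OF v(1)] WC L v'L
    by (auto simp: WFT_def[abs_def])
  have v'X: "v' \<in> X" using v'L W by (simp add: X_iff)
  have "(\<lambda>n. dform (v (q n)) v') \<longlonglongrightarrow> dform v' v'"
    unfolding dform_def by (intro tendsto_intros weak_convD[OF W(2,1)]) simp
  then show ?thesis using that q v'X ae w by blast
qed

section \<open>Splitting of the potential energy\<close>

text \<open>
  Choose \<open>t\<close> with \<open>(1 + t)\<^sup>q = 1 + d\<close> and distinguish whether \<open>y \<le> t x\<close> or \<open>x \<le> y / t\<close>.
\<close>

lemma powr_add_le:
  fixes q d :: real
  assumes "q > 0" "d > 0"
  obtains K where "K \<ge> 0" "\<And>x y. x \<ge> 0 \<Longrightarrow> y \<ge> 0 \<Longrightarrow> (x + y) powr q \<le> (1 + d) * x powr q + K * y powr q"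
proof -
  define t where "t = (1 + d) powr (1/q) - 1"
  have "1 powr (1/q) < (1 + d) powr (1/q)" using assms by (intro powr_less_mono2) auto
  then have t: "t > 0" by (simp add: t_def)
  have t2: "(1 + t) powr q = 1 + d" unfolding t_def using assms by (simp add: powr_powr)
  have "(x + y) powr q \<le> (1 + d) * x powr q + (1 + 1/t) powr q * y powr q" if xy: "x \<ge> 0" "y \<ge> 0" for x y
  proof (cases "y \<le> t * x")
    case True
    then have "(x + y) powr q \<le> ((1 + t) * x) powr q" using assms xy by (intro powr_mono2) (auto simp: algebra_simps)
    also have "\<dots> = (1 + d) * x powr q" using t xy t2 by (simp add: powr_mult)
    finally show ?thesis by (simp add: add_increasing2)
  next
    case False
    then have "x \<le> y / t" using t by (simp add: pos_le_divide_eq mult.commute)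
    then have "(x + y) powr q \<le> ((1 + 1/t) * y) powr q" using assms xy by (intro powr_mono2) (auto simp: algebra_simps)
    also have "\<dots> = (1 + 1/t) powr q * y powr q" using t xy by (simp add: powr_mult)
    finally show ?thesis using assms by (simp add: add_increasing)
  qed
  then show ?thesis using that[of "(1 + 1/t) powr q"] by simp
qed

lemma pot_add_le:
  assumes "q > 0" "d > 0"
  obtains K where "K \<ge> 0" "\<And>u v. u \<in> borel_measurable borel \<Longrightarrow> v \<in> borel_measurable borel \<Longrightarrow>
    integrable lborel (\<lambda>z. cmod (u z) powr q) \<Longrightarrow> integrable lborel (\<lambda>z. cmod (v z) powr q) \<Longrightarrow>
    pot q (\<lambda>z. u z + v z) \<le> (1 + d) * pot q u + K * pot q v"
proof -
  obtain K where K: "K \<ge> 0" "\<And>x y. x \<ge> 0 \<Longrightarrow> y \<ge> 0 \<Longrightarrow> (x + y) powr q \<le> (1 + d) * x powr q + K * y powr q"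
    using powr_add_le[OF assms] by blast
  have "pot q (\<lambda>z. u z + v z) \<le> (1 + d) * pot q u + K * pot q v"
    if [measurable]: "u \<in> borel_measurable borel" "v \<in> borel_measurable borel"
      and i: "integrable lborel (\<lambda>z. cmod (u z) powr q)" "integrable lborel (\<lambda>z. cmod (v z) powr q)" for u v
  proof -
    have le: "cmod (u z + v z) powr q \<le> (1 + d) * cmod (u z) powr q + K * cmod (v z) powr q" for z
    proof -
      have "cmod (u z + v z) powr q \<le> (cmod (u z) + cmod (v z)) powr q"
        using assms by (intro powr_mono2 norm_triangle_ineq) auto
      then show ?thesis using K(2)[of "cmod (u z)" "cmod (v z)"] by simp
    qed
    have I: "integrable lborel (\<lambda>z. (1 + d) * cmod (u z) powr q + K * cmod (v z) powr q)" using i by simp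
    have "pot q (\<lambda>z. u z + v z) \<le> (LINT z|lborel. (1 + d) * cmod (u z) powr q + K * cmod (v z) powr q)"
      unfolding pot_def
    proof (intro integral_mono I le)
      show "integrable lborel (\<lambda>z. cmod (u z + v z) powr q)"
      proof (rule Bochner_Integration.integrable_bound[OF I])
        show "AE z in lborel. norm (cmod (u z + v z) powr q) \<le> norm ((1 + d) * cmod (u z) powr q + K * cmod (v z) powr q)"
          using order_trans[OF le abs_ge_self] by (intro AE_I2) simp
      qed measurable
    qed
    then show ?thesis using i by (simp add: pot_def)
  qed
  then show ?thesis using that K(1) by blast
qed

text \<open>
  By \<open>powr_add_le\<close> the positive part of \<open>\<bar>w\<^sub>n\<bar>\<^sup>q - (1 + d) \<bar>w\<^sub>n - w'\<bar>\<^sup>q\<close> is dominated by a multiple of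
  \<open>\<bar>w'\<bar>\<^sup>q\<close>, and it tends to \<open>\<bar>w'\<bar>\<^sup>q\<close> almost everywhere. Letting \<open>d\<close> be small absorbs
  the factor \<open>1 + d\<close>. An upper bound for the potential energy is a lower bound for the energy.
\<close>

lemma Brezis_Lieb:
  assumes q: "q > 0" and [measurable]: "\<And>n. w n \<in> borel_measurable borel" "w' \<in> borel_measurable borel"
    and i: "\<And>n. integrable lborel (\<lambda>z. cmod (w n z) powr q)" "integrable lborel (\<lambda>z. cmod (w' z) powr q)"
      "\<And>n. integrable lborel (\<lambda>z. cmod (w n z - w' z) powr q)"
    and C: "\<And>n. pot q (\<lambda>z. w n z - w' z) \<le> C"
    and ae: "AE z in lborel. (\<lambda>n. w n z) \<longlonglongrightarrow> w' z" and e: "e > 0"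
  shows "\<forall>\<^sub>F n in sequentially. pot q (w n) \<le> pot q w' + pot q (\<lambda>z. w n z - w' z) + e"
proof -
  have C0: "0 \<le> C" using C[of 0] by (rule order_trans[OF pot_nonneg])
  define d where "d = e / (2 * (C + 1))"
  have d: "d > 0" using e C0 by (simp add: d_def)
  obtain K where K: "K \<ge> 0" "\<And>x y. x \<ge> 0 \<Longrightarrow> y \<ge> 0 \<Longrightarrow> (x + y) powr q \<le> (1 + d) * x powr q + K * y powr q"
    using powr_add_le[OF q d] by blast
  define g where "g n z = max 0 (cmod (w n z) powr q - (1 + d) * cmod (w n z - w' z) powr q)" for n z
  have gle: "\<bar>g n z\<bar> \<le> K * cmod (w' z) powr q" for n z
  proof -
    have "cmod (w n z) powr q \<le> (cmod (w n z - w' z) + cmod (w' z)) powr q"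
      using q norm_triangle_ineq[of "w n z - w' z" "w' z"] by (intro powr_mono2) auto
    also have "\<dots> \<le> (1 + d) * cmod (w n z - w' z) powr q + K * cmod (w' z) powr q" by (intro K) auto
    finally show ?thesis using K(1) by (simp add: g_def)
  qed
  have Ki: "integrable lborel (\<lambda>z. K * cmod (w' z) powr q)" using i by simp
  have gm [measurable]: "g n \<in> borel_measurable borel" for n unfolding g_def[abs_def] by measurable
  have gi: "integrable lborel (g n)" for n
    by (rule Bochner_Integration.integrable_bound[OF Ki]) (use gle K in auto)
  have "(\<lambda>n. LINT z|lborel. g n z) \<longlonglongrightarrow> (LINT z|lborel. cmod (w' z) powr q)"
  proof (rule integral_dominated_convergence[OF _ _ Ki])
    show "AE z in lborel. (\<lambda>n. g n z) \<longlonglongrightarrow> cmod (w' z) powr q"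
      using ae
    proof eventually_elim
      case (elim z)
      have c: "continuous_on {0..} (\<lambda>x::real. x powr q)" using q by (intro continuous_on_powr' continuous_intros) auto
      have p: "(\<lambda>n. x n powr q) \<longlonglongrightarrow> x' powr q" if "x \<longlonglongrightarrow> x'" "\<And>n. x n \<ge> 0" for x x'
        by (rule continuous_on_tendsto_compose[OF c that(1)]) (use that LIMSEQ_le_const[OF that(1), of 0] in auto)
      have "(\<lambda>n. max 0 (cmod (w n z) powr q - (1 + d) * cmod (w n z - w' z) powr q))
         \<longlonglongrightarrow> max 0 (cmod (w' z) powr q - (1 + d) * cmod (w' z - w' z) powr q)"
        by (intro tendsto_intros p elim) auto
      then show ?case using q by (simp add: g_def)
    qed
    show "AE z in lborel. norm (g n z) \<le> K * cmod (w' z) powr q" for n using gle by auto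
  qed auto
  then have "(\<lambda>n. LINT z|lborel. g n z) \<longlonglongrightarrow> pot q w'" by (simp add: pot_def)
  from order_tendstoD(2)[OF this, of "pot q w' + e/2"] e
  have "\<forall>\<^sub>F n in sequentially. (LINT z|lborel. g n z) < pot q w' + e/2" by simp
  then show ?thesis
  proof eventually_elim
    case (elim n)
    have "pot q (w n) \<le> (LINT z|lborel. (1 + d) * cmod (w n z - w' z) powr q + g n z)"
      unfolding pot_def using i gi by (intro integral_mono) (auto simp: g_def)
    also have "\<dots> = (1 + d) * pot q (\<lambda>z. w n z - w' z) + (LINT z|lborel. g n z)"
      using i gi by (simp add: pot_def)
    finally have le: "pot q (w n) \<le> (1 + d) * pot q (\<lambda>z. w n z - w' z) + (LINT z|lborel. g n z)" .
    have "d * pot q (\<lambda>z. w n z - w' z) \<le> d * (C + 1)"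
      using C[of n] d by (intro mult_left_mono) auto
    moreover have "d * (C + 1) = e / 2" using C0 by (simp add: d_def field_simps)
    ultimately have "(1 + d) * pot q (\<lambda>z. w n z - w' z) \<le> pot q (\<lambda>z. w n z - w' z) + e / 2"
      by (simp add: distrib_right)
    then show ?case using elim le by linarith
  qed
qed

section \<open>Dilations\<close>

definition dil :: "real \<Rightarrow> real \<Rightarrow> (plane \<Rightarrow> complex) \<Rightarrow> plane \<Rightarrow> complex" where
  "dil a l u z = complex_of_real a * u (aff l (l\<^sup>2) 0 z)"

lemma dil_fun: "dil a l u = (\<lambda>z. complex_of_real a * u (aff l (l\<^sup>2) 0 z))"
  by (rule ext) (simp add: dil_def)

lemma dil_X: "u \<in> X \<Longrightarrow> l > 0 \<Longrightarrow> dil a l u \<in> X"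
  unfolding dil_fun by (intro X_scale X_aff)

lemma L2sq_dil: "l > 0 \<Longrightarrow> L2sq (dil a l u) = a\<^sup>2 / l^3 * L2sq u"
  unfolding dil_fun L2sq_scale by (subst L2sq_aff) (simp_all add: abs_mult power2_eq_square power3_eq_cube)

lemma kin_dil: "u \<in> X \<Longrightarrow> l > 0 \<Longrightarrow> kin (dil a l u) = a\<^sup>2 / l * kin u"
  unfolding dil_fun by (subst kin_scale) (simp_all add: kin_aff X_L2 L2_aff)

lemma pot_dil: "l > 0 \<Longrightarrow> pot q (dil a l u) = \<bar>a\<bar> powr q / l^3 * pot q u"
  unfolding dil_fun pot_scale by (subst pot_aff) (simp_all add: abs_mult power2_eq_square power3_eq_cube)

lemma dil_dil: "l > 0 \<Longrightarrow> m > 0 \<Longrightarrow> dil a l (dil b m u) = dil (a * b) (l * m) u"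
  by (simp add: dil_fun aff_def power_mult_distrib mult_ac)

lemma dil_1: "dil 1 1 u = u"
  by (simp add: dil_fun aff_def)

lemma dil_diff: "dil a l (\<lambda>z. u z - v z) = (\<lambda>z. dil a l u z - dil a l v z)"
  by (simp add: dil_fun right_diff_distrib)

text \<open>
  The dilation that maps solutions of the equation to solutions if time is scaled by \<open>l\<^sup>2\<close>.
\<close>

definition nls_dil :: "real \<Rightarrow> real \<Rightarrow> (plane \<Rightarrow> complex) \<Rightarrow> plane \<Rightarrow> complex" where
  "nls_dil p l u = dil (l powr (2 / (p - 1))) l u"

locale subcritical =
  fixes p :: real
  assumes p: "1 < p" "p < 7/3"
begin

abbreviation q :: real where "q \<equiv> p + 1"

text \<open>
  Under \<open>nls_dil\<close> the mass scales like \<open>l powr \<sigma>\<close> and the energy like \<open>l powr (\<sigma> + 2)\<close>.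
\<close>

definition \<sigma> :: real where "\<sigma> = 4 / (p - 1) - 3"

text \<open>
  The exponent of the minimal energy as a function of the mass, \<open>(\<sigma> + 2) / \<sigma>\<close>.
\<close>

definition \<kappa> :: real where "\<kappa> = 1 + 2 / \<sigma>"

lemma q_range: "2 < q" "q < 10/3" "0 < q" "0 < p"
  using p by auto

lemma \<sigma>_pos: "\<sigma> > 0"
  using p by (simp add: \<sigma>_def field_simps)

lemma \<kappa>_gt_1: "\<kappa> > 1"
  using \<sigma>_pos by (simp add: \<kappa>_def)

lemma energy_kin_pot: "u \<in> X \<Longrightarrow> energy p u = kin u / 2 - pot q u / q"
  using energy_eq[of u p] p by simp

lemma nls_dil_X: "u \<in> X \<Longrightarrow> l > 0 \<Longrightarrow> nls_dil p l u \<in> X"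
  unfolding nls_dil_def by (rule dil_X)

lemma L2sq_nls_dil: "l > 0 \<Longrightarrow> L2sq (nls_dil p l u) = l powr \<sigma> * L2sq u"
proof -
  assume l: "l > 0"
  have "(l powr (2 / (p - 1)))\<^sup>2 = l powr (4 / (p - 1))"
    unfolding power2_eq_square powr_add[symmetric] by (simp flip: add_divide_distrib)
  moreover have "l^3 = l powr 3" using l by (simp add: powr_numeral)
  ultimately have "(l powr (2 / (p - 1)))\<^sup>2 / l^3 = l powr \<sigma>" by (simp only: \<sigma>_def powr_diff)
  then show ?thesis using l by (simp add: nls_dil_def L2sq_dil)
qed

lemma kin_nls_dil: "u \<in> X \<Longrightarrow> l > 0 \<Longrightarrow> kin (nls_dil p l u) = l powr (\<sigma> + 2) * kin u"
proof -
  assume u: "u \<in> X" and l: "l > 0"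
  have e: "\<sigma> + 2 = 4 / (p - 1) - 1" by (simp add: \<sigma>_def)
  have "(l powr (2 / (p - 1)))\<^sup>2 = l powr (4 / (p - 1))"
    unfolding power2_eq_square powr_add[symmetric] by (simp flip: add_divide_distrib)
  moreover have "l = l powr 1" using l by simp
  ultimately have "(l powr (2 / (p - 1)))\<^sup>2 / l = l powr (\<sigma> + 2)" by (metis e powr_diff)
  then show ?thesis using u l by (simp add: nls_dil_def kin_dil)
qed

lemma pot_nls_dil: "l > 0 \<Longrightarrow> pot q (nls_dil p l u) = l powr (\<sigma> + 2) * pot q u"
proof -
  assume l: "l > 0"
  have e: "\<sigma> + 2 = 2 / (p - 1) * q - 3" using p by (simp add: \<sigma>_def field_simps)
  have "l^3 = l powr 3" using l by (simp add: powr_numeral)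
  then have "(l powr (2 / (p - 1))) powr q / l^3 = l powr (\<sigma> + 2)" by (simp only: e powr_diff powr_powr)
  then show ?thesis using l by (simp add: nls_dil_def pot_dil)
qed

lemma energy_nls_dil: "u \<in> X \<Longrightarrow> l > 0 \<Longrightarrow> energy p (nls_dil p l u) = l powr (\<sigma> + 2) * energy p u"
proof -
  assume u: "u \<in> X" and l: "l > 0"
  have "energy p (nls_dil p l u) = (l powr (\<sigma> + 2) * kin u) / 2 - (l powr (\<sigma> + 2) * pot q u) / q"
    by (simp only: energy_kin_pot[OF nls_dil_X[OF u l]] kin_nls_dil[OF u l] pot_nls_dil[OF l])
  then show ?thesis by (simp only: energy_kin_pot[OF u] right_diff_distrib times_divide_eq_right)
qed

section \<open>Coercivity and the minimal energy\<close>

lemma pot_integrable: "u \<in> X \<Longrightarrow> integrable lborel (\<lambda>z. cmod (u z) powr q)"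
  by (rule Gagliardo_Nirenberg(1)[OF _ q_range(1,2), of u "L2norm u + 1" 1]) (auto simp: add_nonneg_pos)

text \<open>
  In \<open>Gagliardo_Nirenberg\<close> take \<open>\<Lambda>\<close> so large that the potential energy costs at most half of the
  kinetic energy.
\<close>

lemma coercivity:
  assumes "N > 0"
  obtains B where "B \<ge> 0" "\<And>u. u \<in> X \<Longrightarrow> L2norm u \<le> N \<Longrightarrow> kin u \<le> 4 * energy p u + B"
proof -
  define A where "A = tail_const q * N powr (4/3)"
  have A: "A > 0" using tail_const_pos[OF q_range(2)] assms by (simp add: A_def)
  have "((\<lambda>\<Lambda>. \<Lambda> powr (q - 10/3)) \<longlongrightarrow> 0) at_top"
    using q_range by (intro tendsto_neg_powr filterlim_ident) auto
  from order_tendstoD(2)[OF this, of "q / (4 * A)"] A q_range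
  have "\<forall>\<^sub>F \<Lambda> in at_top. \<Lambda> powr (q - 10/3) < q / (4 * A)" by simp
  from eventually_happens[OF eventually_conj[OF this eventually_gt_at_top[of 0]]]
  obtain \<Lambda> where L: "\<Lambda> powr (q - 10/3) < q / (4 * A)" "\<Lambda> > 0" by auto
  define B where "B = 4 * (\<Lambda> powr (q - 2) * N\<^sup>2 / q)"
  have "kin u \<le> 4 * energy p u + B" if u: "u \<in> X" "L2norm u \<le> N" for u
  proof -
    have "L2sq u \<le> N\<^sup>2" using power_mono[OF u(2), of 2] by simp
    then have 1: "\<Lambda> powr (q - 2) * L2sq u \<le> \<Lambda> powr (q - 2) * N\<^sup>2" by (intro mult_left_mono) auto
    have "tail_const q * \<Lambda> powr (q - 10/3) * N powr (4/3) * kin u = (\<Lambda> powr (q - 10/3) * A) * kin u"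
      by (simp add: A_def)
    also have "\<dots> \<le> (q / 4) * kin u"
      using L(1) A by (intro mult_right_mono) (auto simp: pos_less_divide_eq mult.commute mult.left_commute)
    finally have "pot q u \<le> \<Lambda> powr (q - 2) * N\<^sup>2 + (q / 4) * kin u"
      using Gagliardo_Nirenberg(2)[OF u(1) q_range(1,2) u(2) assms L(2)] 1 by linarith
    then have "pot q u / q \<le> (\<Lambda> powr (q - 2) * N\<^sup>2 + (q / 4) * kin u) / q"
      using q_range by (intro divide_right_mono) auto
    also have "\<dots> = B / 4 + kin u / 4"
    proof -
      have "(x + (Q / 4) * k) / Q = 4 * (x / Q) / 4 + k / 4" if "Q > 0" for x Q k :: real
        using that by (simp add: field_simps)
      from this[OF q_range(3)] show ?thesis unfolding B_def .
    qed
    finally show ?thesis using energy_kin_pot[OF u(1)] by linarith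
  qed
  moreover have "B \<ge> 0" using q_range by (simp add: B_def)
  ultimately show ?thesis using that by blast
qed

text \<open>
  Start from a function whose transform is the indicator of a box. The dilation
  \<open>l powr (3/2) * u (l x, l\<^sup>2 y)\<close> keeps the mass, scales \<open>kin\<close> by \<open>l\<^sup>2\<close> and \<open>pot\<close> by \<open>l powr s\<close> with
  \<open>s = 3 (p - 1) / 2 < 2\<close>. So the potential term dominates for small \<open>l\<close>.
\<close>

lemma ex_negative_energy: "\<exists>u\<in>X. L2sq u = 2 \<and> energy p u < 0"
proof -
  obtain u where u: "u \<in> L2" "has_fourier u (indicator (pbox 1))"
    using FT_surj[OF pbox_indicator_L2(1)[of 1]] by auto
  note [measurable] = L2_measurable[OF u(1)]
  have Im: "(indicator (pbox 1) :: plane \<Rightarrow> complex) \<in> L2" by (rule pbox_indicator_L2) simp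
  have "(\<lambda>\<zeta>. complex_of_real (sqrt (weight \<zeta>)) * indicator (pbox 1) \<zeta>) \<in> L2"
  proof (rule L2_bound(1)[OF Im, where B="sqrt 2"])
    show "cmod (complex_of_real (sqrt (weight z)) * indicator (pbox 1) z) \<le> sqrt 2 * cmod (indicator (pbox 1) z)" for z
      using pbox_weight[of z 1] by (auto simp: norm_mult split: split_indicator)
    show "(\<lambda>\<zeta>. complex_of_real (sqrt (weight \<zeta>)) * indicator (pbox 1) \<zeta>) \<in> borel_measurable borel"
      using L2_measurable[OF Im] by measurable
  qed
  moreover have "AE \<zeta> in lborel. WFT u \<zeta> = complex_of_real (sqrt (weight \<zeta>)) * indicator (pbox 1) \<zeta>"
    using FT_eqI[OF u(2)] by eventually_elim (simp add: WFT_def)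
  ultimately have uX: "u \<in> X" by (rule XI[OF u(1)])
  have m: "L2sq u > 0"
  proof -
    have "4 * pi\<^sup>2 * L2sq u = 1" using has_fourier_Plancherel[OF u(2)] pbox_indicator_L2(2)[of 1] by simp
    then have "L2sq u \<noteq> 0" by auto
    then show ?thesis using L2sq_nonneg[of u] by linarith
  qed
  have P: "pot q u > 0"
  proof (rule ccontr)
    assume "\<not> pot q u > 0"
    then have "pot q u = 0" using pot_nonneg[of q u] by linarith
    then have "AE z in lborel. cmod (u z) powr q = 0"
      using integral_nonneg_eq_0_iff_AE[of lborel "\<lambda>z. cmod (u z) powr q"] pot_integrable[OF uX]
      unfolding pot_def by simp
    then have "AE z in lborel. u z = 0" by eventually_elim (use q_range in auto)
    then show False using m L2sq_eq_0_iff[OF u(1)] by simp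
  qed
  define c where "c = sqrt (2 / L2sq u)"
  have c: "c > 0" "c\<^sup>2 * L2sq u = 2" using m by (auto simp: c_def)
  define s where "s = 3 * (p - 1) / 2"
  have s: "s < 2" using p by (simp add: s_def)
  define d where "d = c powr q * pot q u / q"
  have d: "d > 0" using c P q_range by (simp add: d_def)
  have "((\<lambda>l. c\<^sup>2 * kin u / 2 * l powr (2 - s)) \<longlongrightarrow> c\<^sup>2 * kin u / 2 * 0) (at_right 0)"
    using s by (intro tendsto_intros tendsto_zero_powrI[where b="2 - s"] tendsto_ident_at tendsto_const) (auto simp: eventually_at_right_less less_imp_le intro: eventually_mono[OF eventually_at_right_less])
  from order_tendstoD(2)[OF this, of d] d
  have "\<forall>\<^sub>F l in at_right 0. c\<^sup>2 * kin u / 2 * l powr (2 - s) < d" by simp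
  from eventually_happens[OF eventually_conj[OF this eventually_at_right_less]]
  obtain l where l: "c\<^sup>2 * kin u / 2 * l powr (2 - s) < d" "l > 0" by (auto simp: trivial_limit_at_right_real)
  define w where "w = dil (c * l powr (3/2)) l u"
  have wX: "w \<in> X" unfolding w_def by (intro dil_X uX l)
  have l3: "(c * l powr (3/2))\<^sup>2 = c\<^sup>2 * l^3"
  proof -
    have "(l powr (3/2))\<^sup>2 = l powr 3" unfolding power2_eq_square powr_add[symmetric] by simp
    also have "\<dots> = l^3" using l(2) by (simp add: powr_numeral)
    finally show ?thesis by (simp add: power_mult_distrib)
  qed
  have wm: "L2sq w = 2" unfolding w_def L2sq_dil[OF l(2)] l3 using l(2) c by simp
  have wk: "kin w = c\<^sup>2 * l powr 2 * kin u"
    unfolding w_def kin_dil[OF uX l(2)] l3 using l(2) by (simp add: powr_numeral power2_eq_square power3_eq_cube)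
  have e: "3/2 * q - 3 = s" by (simp add: s_def field_simps)
  have "\<bar>c * l powr (3/2)\<bar> powr q = c powr q * l powr (3/2 * q)"
    using l(2) c(1) by (simp add: powr_mult powr_powr abs_mult)
  moreover have "l^3 = l powr 3" using l(2) by (simp add: powr_numeral)
  ultimately have "pot q w = (c powr q * l powr (3/2 * q - 3)) * pot q u"
    unfolding w_def pot_dil[OF l(2)] powr_diff by simp
  then have wp: "pot q w / q = d * l powr s" unfolding e by (simp add: d_def)
  have "kin w / 2 = (c\<^sup>2 * kin u / 2 * l powr (2 - s)) * l powr s"
    unfolding wk using l(2) by (simp flip: powr_add)
  also have "\<dots> < d * l powr s" using l by (intro mult_strict_right_mono) auto
  finally have "energy p w < 0" unfolding energy_kin_pot[OF wX] wp by simp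
  then show ?thesis using wX wm by blast
qed

definition E1 :: real where
  "E1 = Inf {energy p u | u. u \<in> X \<and> mass u = 1}"

text \<open>
  The minimal energy at mass \<open>s\<close>, obtained by scaling from mass 1; see \<open>min_energy_eq\<close>.
\<close>

definition level :: "real \<Rightarrow> real" where
  "level s = s powr \<kappa> * E1"

lemma unit_energies_bdd: "bdd_below {energy p u | u. u \<in> X \<and> mass u = 1}"
proof -
  obtain B where B: "\<And>u. u \<in> X \<Longrightarrow> L2norm u \<le> sqrt 2 \<Longrightarrow> kin u \<le> 4 * energy p u + B"
    using coercivity[of "sqrt 2"] by auto
  have "- B / 4 \<le> energy p u" if "u \<in> X" "mass u = 1" for u
  proof -
    have "L2norm u \<le> sqrt 2" using that by (simp add: mass_eq L2norm_def)
    then show ?thesis using B[OF that(1)] kin_nonneg[of u] by linarith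
  qed
  then show ?thesis by (intro bdd_belowI[where m="- B / 4"]) auto
qed

lemma E1_neg: "E1 < 0"
proof -
  obtain u where u: "u \<in> X" "L2sq u = 2" "energy p u < 0" using ex_negative_energy by blast
  then have "energy p u \<in> {energy p u | u. u \<in> X \<and> mass u = 1}" by (auto simp: mass_eq)
  from cInf_lower[OF this unit_energies_bdd] show ?thesis using u by (simp add: E1_def)
qed

lemma level_le_energy:
  assumes u: "u \<in> X" and s: "mass u > 0"
  shows "level (mass u) \<le> energy p u"
proof -
  define s where "s = mass u"
  define l where "l = s powr (- 1 / \<sigma>)"
  have s0: "s > 0" using s by (simp add: s_def)
  have l: "l > 0" using s0 by (simp add: l_def)
  have l1: "l powr \<sigma> = 1 / s" unfolding l_def powr_powr using \<sigma>_pos s0 by (simp add: powr_minus_divide)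
  have ke: "- 1 / \<sigma> * (\<sigma> + 2) = - \<kappa>" using \<sigma>_pos by (simp add: \<kappa>_def field_simps)
  have l2: "l powr (\<sigma> + 2) = 1 / s powr \<kappa>" unfolding l_def powr_powr ke by (simp add: powr_minus_divide)
  have "mass (nls_dil p l u) = 1" using L2sq_nls_dil[OF l, of u] l1 s0 by (simp add: mass_eq s_def)
  then have "energy p (nls_dil p l u) \<in> {energy p u | u. u \<in> X \<and> mass u = 1}" using nls_dil_X[OF u l] by blast
  from cInf_lower[OF this unit_energies_bdd] have "E1 \<le> energy p u / s powr \<kappa>"
    by (simp add: E1_def energy_nls_dil[OF u l] l2)
  then show ?thesis using s0 by (simp add: level_def s_def field_simps)
qed

lemma level_approx:
  assumes s: "s > 0" and d: "d > 0"
  shows "\<exists>u\<in>X. mass u = s \<and> energy p u < level s + d"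
proof -
  have ne: "{energy p u | u. u \<in> X \<and> mass u = 1} \<noteq> {}"
    using ex_negative_energy by (auto simp: mass_eq)
  have "E1 < E1 + d / s powr \<kappa>" using d s by simp
  then obtain u where u: "u \<in> X" "mass u = 1" "energy p u < E1 + d / s powr \<kappa>"
    unfolding E1_def using cInf_lessD[OF ne] by blast
  define l where "l = s powr (1 / \<sigma>)"
  have l: "l > 0" using s by (simp add: l_def)
  have l1: "l powr \<sigma> = s" unfolding l_def powr_powr using \<sigma>_pos s by simp
  have ke: "1 / \<sigma> * (\<sigma> + 2) = \<kappa>" using \<sigma>_pos by (simp add: \<kappa>_def field_simps)
  have l2: "l powr (\<sigma> + 2) = s powr \<kappa>" unfolding l_def powr_powr ke ..
  have "mass (nls_dil p l u) = s" using L2sq_nls_dil[OF l, of u] l1 u(2) by (simp add: mass_eq)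
  moreover have "energy p (nls_dil p l u) < level s + d"
  proof -
    have "s powr \<kappa> * energy p u < s powr \<kappa> * (E1 + d / s powr \<kappa>)" using u(3) s by (intro mult_strict_left_mono) auto
    then show ?thesis using s by (simp add: energy_nls_dil[OF u(1) l] l2 level_def distrib_left)
  qed
  ultimately show ?thesis using nls_dil_X[OF u(1) l] by blast
qed

lemma min_energy_eq:
  assumes s: "s > 0"
  shows "min_energy p s = ereal (level s)"
  unfolding min_energy_def
proof (rule Inf_eqI)
  show "ereal (level s) \<le> i" if "i \<in> {ereal (energy p u) | u. u \<in> X \<and> mass u = s}" for i
    using that level_le_energy s by auto
  show "y \<le> ereal (level s)" if y: "\<And>i. i \<in> {ereal (energy p u) | u. u \<in> X \<and> mass u = s} \<Longrightarrow> y \<le> i" for y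
  proof -
    have "y \<le> ereal (level s) + ereal e" if e: "e > 0" for e :: real
    proof -
      obtain u where u: "u \<in> X" "mass u = s" "energy p u < level s + e" using level_approx[OF s e] by blast
      then have "y \<le> ereal (energy p u)" by (intro y) blast
      also have "\<dots> \<le> ereal (level s) + ereal e" using u(3) by simp
      finally show "y \<le> ereal (level s) + ereal e" .
    qed
    then show ?thesis by (rule ereal_le_epsilon2)
  qed
qed

lemma ground_states_iff:
  "\<mu> > 0 \<Longrightarrow> u \<in> ground_states p \<mu> \<longleftrightarrow> u \<in> X \<and> energy p u = level \<mu> \<and> mass u = \<mu>"
  by (simp add: ground_states_def min_energy_eq)

lemma level_neg: "s > 0 \<Longrightarrow> level s < 0"
  using E1_neg by (simp add: level_def mult_pos_neg)

text \<open>
  Since \<open>\<kappa> > 1\<close>, the function \<open>s powr \<kappa>\<close> is strictly superadditive, and \<open>E1\<close> is negative.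
\<close>

lemma level_strict:
  assumes "a > 0" "b > 0"
  shows "level (a + b) < level a + level b"
proof -
  have k: "\<kappa> = 1 + (\<kappa> - 1)" by simp
  have split: "x powr \<kappa> = x * x powr (\<kappa> - 1)" if "x > 0" for x :: real
    by (subst k, subst powr_add) (use that in simp)
  have "a * a powr (\<kappa> - 1) < a * (a + b) powr (\<kappa> - 1)"
    using assms \<kappa>_gt_1 by (intro mult_strict_left_mono powr_less_mono2) auto
  moreover have "b * b powr (\<kappa> - 1) < b * (a + b) powr (\<kappa> - 1)"
    using assms \<kappa>_gt_1 by (intro mult_strict_left_mono powr_less_mono2) auto
  ultimately have "a * a powr (\<kappa> - 1) + b * b powr (\<kappa> - 1) < (a + b) * (a + b) powr (\<kappa> - 1)"
    unfolding distrib_right by (rule add_strict_mono)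
  then have "a powr \<kappa> + b powr \<kappa> < (a + b) powr \<kappa>"
    using assms by (simp only: split add_pos_pos)
  then have "(a + b) powr \<kappa> * E1 < (a powr \<kappa> + b powr \<kappa>) * E1"
    using E1_neg by (intro mult_strict_right_mono_neg) auto
  then show ?thesis by (simp add: level_def distrib_right)
qed

lemma level_tendsto:
  assumes "(f \<longlongrightarrow> s) F" "s > 0"
  shows "((\<lambda>n. level (f n)) \<longlongrightarrow> level s) F"
  unfolding level_def using assms by (intro tendsto_intros) auto

section \<open>Compactness of minimizing sequences\<close>

lemma pot_tendsto_0:
  assumes w: "\<And>n::nat. w n \<in> X" "\<And>n. kin (w n) \<le> C" and l: "(\<lambda>n. L2sq (w n)) \<longlonglongrightarrow> 0"
  shows "(\<lambda>n. pot q (w n)) \<longlonglongrightarrow> 0"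
proof (rule tendsto_sandwich[OF _ _ tendsto_const])
  define N where "N n = L2norm (w n) + 1 / (real n + 1)" for n
  have Np: "N n > 0" "L2norm (w n) \<le> N n" for n by (auto simp: N_def add_nonneg_pos)
  have C0: "0 \<le> C" by (rule order_trans[OF kin_nonneg w(2)])
  have "(\<lambda>n. 1 / (real n + 1)) \<longlonglongrightarrow> 0"
    using LIMSEQ_inverse_real_of_nat by (simp add: inverse_eq_divide add.commute)
  then have "N \<longlonglongrightarrow> 0 + 0" unfolding N_def using l
    by (intro tendsto_add) (simp_all add: L2norm_tendsto_0_iff)
  then have "(\<lambda>n. N n powr (4/3)) \<longlonglongrightarrow> 0"
    using Np by (intro tendsto_zero_powrI[where b="4/3"] tendsto_const) (auto simp: less_imp_le)
  then have "(\<lambda>n. L2sq (w n) + tail_const q * N n powr (4/3) * C) \<longlonglongrightarrow> 0 + tail_const q * 0 * C"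
    by (intro tendsto_intros l)
  then show "(\<lambda>n. L2sq (w n) + tail_const q * N n powr (4/3) * C) \<longlonglongrightarrow> 0" by simp
  have "pot q (w n) \<le> L2sq (w n) + tail_const q * N n powr (4/3) * C" for n
  proof -
    have "pot q (w n) \<le> L2sq (w n) + tail_const q * N n powr (4/3) * kin (w n)"
      using Gagliardo_Nirenberg(2)[OF w(1) q_range(1,2) Np(2,1), of 1] by simp
    also have "tail_const q * N n powr (4/3) * kin (w n) \<le> tail_const q * N n powr (4/3) * C"
      using w(2)[of n] tail_const_pos[OF q_range(2)] by (intro mult_left_mono) auto
    finally show ?thesis by simp
  qed
  then show "\<forall>\<^sub>F n in sequentially. pot q (w n) \<le> L2sq (w n) + tail_const q * N n powr (4/3) * C" by simp
qed simp

text \<open>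
  The energy may exceed the minimum by \<open>a n\<close>, and the mass only has to converge: in this form the
  statement applies to solutions that start close to the ground states.
\<close>

theorem minimizing_compact:
  assumes \<mu>: "\<mu> > 0" and u: "\<And>n. u n \<in> X" and m: "(\<lambda>n. mass (u n)) \<longlonglongrightarrow> \<mu>"
    and a: "a \<longlonglongrightarrow> 0" and E: "\<And>n. energy p (u n) \<le> level \<mu> + a n"
  obtains v h k where "v \<in> ground_states p \<mu>" "strict_mono (k :: nat \<Rightarrow> nat)"
    "(\<lambda>n. X_norm (\<lambda>z. u (k n) (z + h n) - v z)) \<longlonglongrightarrow> 0"
proof -
  obtain Cm where Cm: "\<And>n. \<bar>mass (u n)\<bar> \<le> Cm" "Cm > 0"
    using convergent_imp_Bseq[OF convergentI[OF m]] by (auto simp: Bseq_def)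
  obtain Ca where Ca: "\<And>n. \<bar>a n\<bar> \<le> Ca" "Ca > 0"
    using convergent_imp_Bseq[OF convergentI[OF a]] by (auto simp: Bseq_def)
  have Lb: "L2sq (u n) \<le> 2 * Cm" for n using Cm(1)[of n] by (simp add: mass_eq)
  then have Nb: "L2norm (u n) \<le> sqrt (2 * Cm)" for n by (simp add: L2norm_def)
  obtain B where B: "B \<ge> 0" "\<And>u. u \<in> X \<Longrightarrow> L2norm u \<le> sqrt (2 * Cm) \<Longrightarrow> kin u \<le> 4 * energy p u + B"
    using coercivity[of "sqrt (2 * Cm)"] Cm(2) by auto
  define C where "C = 4 * Ca + B + 2 * Cm"
  have Cp: "C > 0" using Ca Cm B by (simp add: C_def)
  have kb: "kin (u n) \<le> C" for n
    using B(2)[OF u Nb, of n] E[of n] Ca(1)[of n] level_neg[OF \<mu>] Cm(2) by (simp add: C_def abs_le_iff)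
  have lb: "L2sq (u n) \<le> C" for n using Lb[of n] Ca B by (simp add: C_def)
  \<comment> \<open>Negative energy forces a lower bound on the potential energy, so some box average
    stays away from 0. It is moved to the origin by a translation.\<close>
  define \<delta> where "\<delta> = q * (- level \<mu> / 2)"
  have \<delta>: "\<delta> > 0" using level_neg[OF \<mu>] q_range by (simp add: \<delta>_def mult_pos_neg)
  obtain e k0 where e: "e > 0" "k0 > 0"
    and nv: "\<And>u. u \<in> X \<Longrightarrow> L2sq u \<le> C \<Longrightarrow> kin u \<le> C \<Longrightarrow> pot q u \<ge> \<delta> \<Longrightarrow> \<exists>z. cmod (box_avg e u z) \<ge> k0"
    using nonvanishing[OF q_range(1,2) \<delta> Cp] by blast
  obtain N0 where N0: "\<And>n. n \<ge> N0 \<Longrightarrow> a n < - level \<mu> / 2"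
    using order_tendstoD(2)[OF a, of "- level \<mu> / 2"] level_neg[OF \<mu>] by (auto simp: eventually_sequentially)
  define w where "w n = u (n + N0)" for n
  have "\<exists>z. cmod (box_avg e (w n) z) \<ge> k0" for n
  proof (rule nv)
    have "energy p (w n) \<le> level \<mu> / 2" using E[of "n + N0"] N0[of "n + N0"] by (simp add: w_def)
    moreover have "energy p (w n) = kin (w n) / 2 - pot q (w n) / q" by (rule energy_kin_pot) (simp add: w_def u)
    ultimately have "- level \<mu> / 2 \<le> pot q (w n) / q" using kin_nonneg[of "w n"] by linarith
    then show "pot q (w n) \<ge> \<delta>" using q_range by (simp add: \<delta>_def pos_le_divide_eq mult.commute)
  qed (use u lb kb in \<open>auto simp: w_def\<close>)
  then obtain h where h: "\<And>n. cmod (box_avg e (w n) (h n)) \<ge> k0" by metis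
  define y where "y n = (\<lambda>z. w n (z + h n))" for n
  have yX: "y n \<in> X" for n unfolding y_def w_def by (intro X_translate u)
  have ym: "L2sq (y n) = L2sq (u (n + N0))" for n by (simp add: y_def w_def L2sq_translate)
  have yk: "kin (y n) = kin (u (n + N0))" for n using kin_translate[OF u] by (simp add: y_def w_def)
  have yp: "pot q (y n) = pot q (u (n + N0))" for n by (simp add: y_def w_def pot_translate)
  have yb: "cmod (box_avg e (y n) 0) \<ge> k0" for n
    using h[of n] by (simp add: y_def box_avg_def)
  obtain r v where r: "strict_mono r" and v: "v \<in> X" and ae: "AE z in lborel. (\<lambda>n. y (r n) z) \<longlonglongrightarrow> v z"
    and wk: "weak_conv (\<lambda>n. y (r n)) v" and df: "(\<lambda>n. dform (y (r n)) v) \<longlonglongrightarrow> dform v v"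
    using X_compactness[of y C, OF yX] lb kb unfolding ym yk by blast
  have vL: "v \<in> L2" by (rule X_L2[OF v])
  \<comment> \<open>The average at the origin is a weakly continuous functional.\<close>
  have "(\<lambda>n. box_avg e (y (r n)) 0) \<longlonglongrightarrow> box_avg e v 0"
    unfolding box_avg_def using e(1)
    by (intro tendsto_intros) (use weak_convD[OF wk pbox_indicator_L2(1)[OF e(1)]] in auto)
  then have "(\<lambda>n. cmod (box_avg e (y (r n)) 0)) \<longlonglongrightarrow> cmod (box_avg e v 0)" by (rule tendsto_norm)
  then have "k0 \<le> cmod (box_avg e v 0)" by (rule LIMSEQ_le_const) (use yb in auto)
  then have "0 < L2norm v / sqrt (e^3)" using box_avg_bound[OF vL e(1), of 0] e(2) by linarith
  then have vpos: "L2sq v > 0" using e(1) by (simp add: zero_less_divide_iff L2norm_def)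
  define g where "g n = (\<lambda>z. y (r n) z - v z)" for n
  have gX: "g n \<in> X" for n unfolding g_def by (intro X_diff yX v)
  have rk: "strict_mono (\<lambda>n. r n + N0)" using r by (simp add: strict_mono_def)
  have sub: "(\<lambda>n. f (r n + N0)) \<longlonglongrightarrow> l" if "f \<longlonglongrightarrow> l" for f :: "nat \<Rightarrow> real" and l
    using LIMSEQ_subseq_LIMSEQ[OF that rk] by (simp add: o_def)
  have yml: "(\<lambda>n. L2sq (y (r n))) \<longlonglongrightarrow> 2 * \<mu>"
    unfolding ym using tendsto_mult_left[OF sub[OF m], of 2] by (simp add: mass_eq)
  have gm: "(\<lambda>n. L2sq (g n)) \<longlonglongrightarrow> 2 * \<mu> - L2sq v"
  proof -
    have "(\<lambda>n. L2sq (y (r n)) + L2sq v - 2 * Re (L2_inner (y (r n)) v)) \<longlonglongrightarrow> 2 * \<mu> + L2sq v - 2 * Re (L2_inner v v)"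
      by (intro tendsto_intros yml weak_convD[OF wk vL])
    then show ?thesis by (simp add: g_def L2sq_diff X_L2 yX vL L2_inner_self)
  qed
  have gk: "(\<lambda>n. kin (y (r n)) - kin v - kin (g n)) \<longlonglongrightarrow> 0"
  proof -
    have "(\<lambda>n. 2 * Re (dform (y (r n)) v) - 2 * kin v) \<longlonglongrightarrow> 2 * Re (dform v v) - 2 * kin v"
      by (intro tendsto_intros df)
    then show ?thesis by (simp add: g_def kin_diff[OF yX v] kin_eq_Re_dform[of v])
  qed
  have gkb: "kin (g n) \<le> 2 * C + 2 * kin v" for n
    using kin_diff_le[OF yX v, of "r n"] kb[of "r n + N0"] by (simp add: g_def yk)
  obtain Cg where Cg: "\<And>n. \<bar>L2sq (g n)\<bar> \<le> Cg" "Cg > 0"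
    using convergent_imp_Bseq[OF convergentI[OF gm]] by (auto simp: Bseq_def)
  have gpb: "pot q (g n) \<le> Cg + tail_const q * (sqrt Cg) powr (4/3) * (2 * C + 2 * kin v)" for n
  proof -
    have "L2norm (g n) \<le> sqrt Cg" "0 < sqrt Cg" using Cg(1)[of n] Cg(2) by (auto simp: L2norm_def)
    from Gagliardo_Nirenberg(2)[OF gX q_range(1,2) this, of 1]
    have "pot q (g n) \<le> L2sq (g n) + tail_const q * (sqrt Cg) powr (4/3) * kin (g n)" by simp
    also have "\<dots> \<le> Cg + tail_const q * (sqrt Cg) powr (4/3) * (2 * C + 2 * kin v)"
      using Cg(1)[of n] gkb[of n] tail_const_pos[OF q_range(2)] by (intro add_mono mult_left_mono) auto
    finally show ?thesis .
  qed
  have BL: "\<forall>\<^sub>F n in sequentially. pot q (y (r n)) \<le> pot q v + pot q (g n) + \<eta>" if "\<eta> > 0" for \<eta>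
    unfolding g_def
    by (rule Brezis_Lieb[OF q_range(3) _ _ _ _ _ _ ae that])
       (use gpb pot_integrable[OF yX] pot_integrable[OF v] pot_integrable[OF gX] L2_measurable[OF X_L2[OF yX]] L2_measurable[OF vL] in \<open>auto simp: g_def\<close>)
  have split: "\<forall>\<^sub>F n in sequentially. energy p v + energy p (g n) \<le> level \<mu> + \<eta>" if \<eta>: "\<eta> > 0" for \<eta>
  proof -
    have "(\<lambda>n. a (r n + N0)) \<longlonglongrightarrow> 0" by (rule sub[OF a])
    from order_tendstoD(2)[OF this, of "\<eta>/3"] have 1: "\<forall>\<^sub>F n in sequentially. a (r n + N0) < \<eta>/3" using \<eta> by simp
    have 2: "\<forall>\<^sub>F n in sequentially. - (\<eta>/3) < kin (y (r n)) - kin v - kin (g n)"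
      using order_tendstoD(1)[OF gk, of "- (\<eta>/3)"] \<eta> by simp
    have 3: "\<forall>\<^sub>F n in sequentially. pot q (y (r n)) \<le> pot q v + pot q (g n) + \<eta>/3" using BL[of "\<eta>/3"] \<eta> by simp
    show ?thesis using 1 2 3
    proof eventually_elim
      case (elim n)
      have "pot q (y (r n)) / q \<le> (pot q v + pot q (g n) + \<eta>/3) / q" using elim(3) q_range by (intro divide_right_mono) auto
      also have "\<dots> = pot q v / q + pot q (g n) / q + (\<eta>/3) / q" by (simp add: add_divide_distrib)
      also have "(\<eta>/3) / q \<le> \<eta>/3" using q_range \<eta> divide_left_mono[of 1 q "\<eta>/3"] by simp
      finally have "pot q (y (r n)) / q \<le> pot q v / q + pot q (g n) / q + \<eta>/3" by simp
      moreover have "kin (y (r n)) / 2 - pot q (y (r n)) / q \<le> level \<mu> + a (r n + N0)"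
        using E[of "r n + N0"] energy_kin_pot[OF u] by (simp add: yk yp)
      ultimately show ?case
        using elim(1,2) \<eta> energy_kin_pot[OF v] energy_kin_pot[OF gX, of n] by (simp add: field_simps)
    qed
  qed
  define \<alpha> where "\<alpha> = mass v"
  have \<alpha>: "\<alpha> > 0" using vpos by (simp add: \<alpha>_def mass_eq)
  have gmass: "(\<lambda>n. mass (g n)) \<longlonglongrightarrow> \<mu> - \<alpha>"
    using tendsto_divide[OF gm tendsto_const[of 2]] by (simp add: mass_eq \<alpha>_def diff_divide_distrib)
  have b0: "\<mu> - \<alpha> \<ge> 0" using gmass by (rule LIMSEQ_le_const) (auto simp: mass_eq)
  \<comment> \<open>Two positive masses contradict strict subadditivity.\<close>
  have \<alpha>\<mu>: "\<alpha> = \<mu>"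
  proof (rule ccontr)
    assume "\<alpha> \<noteq> \<mu>"
    then have b: "\<mu> - \<alpha> > 0" using b0 by simp
    define \<eta> where "\<eta> = (level \<alpha> + level (\<mu> - \<alpha>) - level \<mu>) / 3"
    have \<eta>: "\<eta> > 0" using level_strict[OF \<alpha> b] by (simp add: \<eta>_def)
    have 1: "\<forall>\<^sub>F n in sequentially. mass (g n) > 0" using order_tendstoD(1)[OF gmass b] .
    have 2: "\<forall>\<^sub>F n in sequentially. level (\<mu> - \<alpha>) - \<eta> < level (mass (g n))"
      using order_tendstoD(1)[OF level_tendsto[OF gmass b], of "level (\<mu> - \<alpha>) - \<eta>"] \<eta> by simp
    have "\<forall>\<^sub>F n in sequentially. False" using 1 2 split[OF \<eta>]
    proof eventually_elim
      case (elim n)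
      have "level \<alpha> \<le> energy p v" using level_le_energy[OF v] \<alpha> by (simp add: \<alpha>_def)
      moreover have "3 * \<eta> = level \<alpha> + level (\<mu> - \<alpha>) - level \<mu>" by (simp add: \<eta>_def)
      ultimately show ?case using elim level_le_energy[OF gX elim(1)] \<eta> by linarith
    qed
    then show False by simp
  qed
  \<comment> \<open>With its mass the remainder loses its potential energy. What is left of its energy is
    kinetic, and the minimality of the level leaves no room for it.\<close>
  have gm0: "(\<lambda>n. L2sq (g n)) \<longlonglongrightarrow> 0" using gm \<alpha>\<mu> by (simp add: \<alpha>_def mass_eq)
  have gp0: "(\<lambda>n. pot q (g n)) \<longlonglongrightarrow> 0" by (rule pot_tendsto_0[OF gX gkb gm0])
  have vge: "level \<mu> \<le> energy p v" using level_le_energy[OF v] \<alpha> \<alpha>\<mu> by (simp add: \<alpha>_def)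
  have small: "\<forall>\<^sub>F n in sequentially. energy p v + kin (g n) / 2 \<le> level \<mu> + \<eta>" if \<eta>: "\<eta> > 0" for \<eta>
  proof -
    have "(\<lambda>n. pot q (g n) / q) \<longlonglongrightarrow> 0 / q" by (intro tendsto_intros gp0) (use q_range in auto)
    then have "\<forall>\<^sub>F n in sequentially. pot q (g n) / q < \<eta>/2"
      using order_tendstoD(2)[of "\<lambda>n. pot q (g n) / q" 0 sequentially "\<eta>/2"] \<eta> by simp
    moreover have "\<forall>\<^sub>F n in sequentially. energy p v + energy p (g n) \<le> level \<mu> + \<eta>/2" using split[of "\<eta>/2"] \<eta> by simp
    ultimately show ?thesis by eventually_elim (use energy_kin_pot[OF gX] in \<open>auto simp: field_simps\<close>)
  qed
  have vle: "energy p v \<le> level \<mu>"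
  proof (rule field_le_epsilon)
    fix \<eta> :: real assume "\<eta> > 0"
    from eventually_happens[OF small[OF this]] obtain n where "energy p v + kin (g n) / 2 \<le> level \<mu> + \<eta>" by auto
    then show "energy p v \<le> level \<mu> + \<eta>" using kin_nonneg[of "g n"] by linarith
  qed
  have gk0: "(\<lambda>n. kin (g n)) \<longlonglongrightarrow> 0"
  proof (rule order_tendstoI)
    fix x :: real assume x: "0 < x"
    show "\<forall>\<^sub>F n in sequentially. kin (g n) < x"
      using small[of "x/3"] x vge by (auto elim!: eventually_mono)
  qed (auto intro!: always_eventually less_le_trans[OF _ kin_nonneg])
  have "(\<lambda>n. X_norm (g n)) \<longlonglongrightarrow> sqrt (0 + 0)"
    unfolding X_norm_eq[OF gX] by (intro tendsto_intros gk0 gm0)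
  then have "(\<lambda>n. X_norm (\<lambda>z. u (r n + N0) (z + h (r n)) - v z)) \<longlonglongrightarrow> 0"
    by (simp add: g_def y_def w_def)
  moreover have "v \<in> ground_states p \<mu>"
    using ground_states_iff[OF \<mu>] v vge vle \<alpha>\<mu> by (simp add: \<alpha>_def)
  ultimately show ?thesis
    using that[of v "\<lambda>n. r n + N0" "\<lambda>n. h (r n)"] rk by simp
qed

end

section \<open>Neighbourhoods of the set of ground states\<close>

context subcritical
begin

lemma ground_states_nonempty:
  assumes \<mu>: "\<mu> > 0"
  shows "ground_states p \<mu> \<noteq> {}"
proof -
  have "\<forall>n. \<exists>u. u \<in> X \<and> mass u = \<mu> \<and> energy p u < level \<mu> + 1 / (real n + 1)"
    using level_approx[OF \<mu>] by (metis add_nonneg_pos of_nat_0_le_iff zero_less_divide_1_iff zero_less_one)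
  then obtain u where u: "\<And>n. u n \<in> X" "\<And>n. mass (u n) = \<mu>" "\<And>n. energy p (u n) < level \<mu> + 1 / (real n + 1)"
    by metis
  have l: "(\<lambda>n. 1 / (real n + 1)) \<longlonglongrightarrow> 0"
    using LIMSEQ_inverse_real_of_nat by (simp add: inverse_eq_divide add.commute)
  have m: "(\<lambda>n. mass (u n)) \<longlonglongrightarrow> \<mu>" by (simp add: u(2))
  obtain v h k where "v \<in> ground_states p \<mu>"
    by (rule minimizing_compact[OF \<mu> u(1) m l less_imp_le[OF u(3)]])
  then show ?thesis by blast
qed

lemma X_norm_translate: "u \<in> X \<Longrightarrow> X_norm (\<lambda>z. u (z + h)) = X_norm u"
  using X_translate[of u h] by (simp add: X_norm_eq kin_translate L2sq_translate)

lemma ground_states_translate: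
  assumes "\<mu> > 0" "v \<in> ground_states p \<mu>"
  shows "(\<lambda>z. v (z + h)) \<in> ground_states p \<mu>"
proof -
  have v: "v \<in> X" "energy p v = level \<mu>" "mass v = \<mu>" using assms ground_states_iff by auto
  have "energy p (\<lambda>z. v (z + h)) = energy p v"
    by (simp only: energy_kin_pot[OF X_translate[OF v(1)]] energy_kin_pot[OF v(1)] kin_translate[OF v(1)] pot_translate)
  then show ?thesis using v X_translate[OF v(1)] ground_states_iff[OF assms(1)] by (simp add: mass_eq L2sq_translate)
qed

text \<open>
  Otherwise there would be a minimizing sequence that stays away from the ground states. By
  \<open>minimizing_compact\<close> it has translates that converge to a ground state; translating the limit back
  gives ground states close to the sequence.
\<close>

theorem near_ground_states:
  assumes \<mu>: "\<mu> > 0" and e: "e > 0"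
  shows "\<exists>d>0. \<forall>w\<in>X. \<bar>mass w - \<mu>\<bar> < d \<longrightarrow> energy p w < level \<mu> + d \<longrightarrow>
    (\<exists>v\<in>ground_states p \<mu>. X_norm (\<lambda>z. w z - v z) < e)"
proof (rule ccontr)
  assume neg: "\<not> ?thesis"
  have "\<exists>w. w \<in> X \<and> \<bar>mass w - \<mu>\<bar> < d \<and> energy p w < level \<mu> + d \<and>
      \<not> (\<exists>v\<in>ground_states p \<mu>. X_norm (\<lambda>z. w z - v z) < e)" if "d > 0" for d
    using neg that by blast
  moreover have "1 / (real n + 1) > 0" for n by simp
  ultimately have "\<forall>n. \<exists>w. w \<in> X \<and> \<bar>mass w - \<mu>\<bar> < 1 / (real n + 1) \<and> energy p w < level \<mu> + 1 / (real n + 1) \<and>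
      \<not> (\<exists>v\<in>ground_states p \<mu>. X_norm (\<lambda>z. w z - v z) < e)"
    by blast
  then obtain w where w: "\<And>n. w n \<in> X" "\<And>n. \<bar>mass (w n) - \<mu>\<bar> < 1 / (real n + 1)"
    "\<And>n. energy p (w n) < level \<mu> + 1 / (real n + 1)"
    and far: "\<And>n v. v \<in> ground_states p \<mu> \<Longrightarrow> \<not> X_norm (\<lambda>z. w n z - v z) < e" by metis
  have l: "(\<lambda>n. 1 / (real n + 1)) \<longlonglongrightarrow> 0"
    using LIMSEQ_inverse_real_of_nat by (simp add: inverse_eq_divide add.commute)
  have "(\<lambda>n. mass (w n) - \<mu>) \<longlonglongrightarrow> 0"
    by (rule Lim_null_comparison[OF _ l]) (use w(2) in \<open>auto simp: less_imp_le\<close>)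
  then have m: "(\<lambda>n. mass (w n)) \<longlonglongrightarrow> \<mu>" by (rule LIM_zero_cancel)
  obtain v h k where v: "v \<in> ground_states p \<mu>"
    and lim: "(\<lambda>n. X_norm (\<lambda>z. w (k n) (z + h n) - v z)) \<longlonglongrightarrow> 0"
    by (rule minimizing_compact[OF \<mu> w(1) m l less_imp_le[OF w(3)]])
  from eventually_happens[OF order_tendstoD(2)[OF lim e]] obtain n
    where n: "X_norm (\<lambda>z. w (k n) (z + h n) - v z) < e" by auto
  have vX: "v \<in> X" using v ground_states_iff[OF \<mu>] by simp
  define v' where "v' = (\<lambda>z. v (z + (- h n)))"
  have v': "v' \<in> ground_states p \<mu>" unfolding v'_def by (rule ground_states_translate[OF \<mu> v])
  have "(\<lambda>z. w (k n) z - v' z) \<in> X" unfolding v'_def by (intro X_diff X_translate w vX)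
  from X_norm_translate[OF this, of "h n"] n have "X_norm (\<lambda>z. w (k n) z - v' z) < e" by (simp add: v'_def)
  then show False using far[OF v'] by blast
qed

lemma X_norm_bounds:
  assumes "u \<in> X"
  shows "kin u \<le> (X_norm u)\<^sup>2" "L2norm u \<le> X_norm u"
proof -
  show "kin u \<le> (X_norm u)\<^sup>2" using X_norm_power2[OF assms] by simp
  show "L2norm u \<le> X_norm u" unfolding X_norm_eq[OF assms] L2norm_def by simp
qed

text \<open>
  All ground states of mass \<open>\<mu>\<close> satisfy the same bound on \<open>kin\<close>, so mass and energy vary uniformly
  near them. With \<open>x\<close> the distance in the X-norm, each difference is at most \<open>x * G\<close> plus, for
  the potential energy, an error \<open>\<eta> * P\<close> from \<open>pot_add_le\<close> that is made small first.
\<close>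

theorem data_near_ground_states:
  assumes \<mu>: "\<mu> > 0" and d: "d > 0"
  shows "\<exists>\<delta>>0. \<forall>w\<in>X. \<forall>u\<in>ground_states p \<mu>. X_norm (\<lambda>z. w z - u z) < \<delta> \<longrightarrow>
    \<bar>mass w - \<mu>\<bar> < d \<and> energy p w < level \<mu> + d"
proof -
  define N where "N = sqrt (2 * \<mu>)"
  have N: "N > 0" using \<mu> by (simp add: N_def)
  obtain B where B: "B \<ge> 0" "\<And>u. u \<in> X \<Longrightarrow> L2norm u \<le> N \<Longrightarrow> kin u \<le> 4 * energy p u + B"
    using coercivity[OF N] by blast
  define A where "A = 1 + tail_const q"
  have A: "A > 0" using tail_const_pos[OF q_range(2)] by (simp add: A_def)
  have potb: "pot q u \<le> L2sq u + tail_const q * M powr (4/3) * kin u" if "u \<in> X" "L2norm u \<le> M" "M > 0" for u M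
    using Gagliardo_Nirenberg(2)[OF that(1) q_range(1,2) that(2,3), of 1] by simp
  define M where "M = N + 1"
  define P where "P = M\<^sup>2 + tail_const q * M powr (4/3) * (2 * B + 2) + 1"
  have M: "M > 0" using N by (simp add: M_def)
  have P: "P > 0" using tail_const_pos[OF q_range(2)] M B by (simp add: P_def add_nonneg_pos)
  define \<eta> where "\<eta> = d / (4 * P)"
  have \<eta>: "\<eta> > 0" using d P by (simp add: \<eta>_def)
  obtain K where K: "K \<ge> 0" "\<And>u v. u \<in> borel_measurable borel \<Longrightarrow> v \<in> borel_measurable borel \<Longrightarrow>
    integrable lborel (\<lambda>z. cmod (u z) powr q) \<Longrightarrow> integrable lborel (\<lambda>z. cmod (v z) powr q) \<Longrightarrow>
    pot q (\<lambda>z. u z + v z) \<le> (1 + \<eta>) * pot q u + K * pot q v"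
    using pot_add_le[OF q_range(3) \<eta>] by blast
  define G where "G = 1 + sqrt B + K * A + 2 * N"
  have G: "G > 0" using B K A N by (simp add: G_def add_pos_nonneg add_nonneg_pos)
  define \<delta> where "\<delta> = min 1 (d / (4 * G))"
  have \<delta>: "\<delta> > 0" using d G by (simp add: \<delta>_def)
  have "\<bar>mass w - \<mu>\<bar> < d \<and> energy p w < level \<mu> + d"
    if w: "w \<in> X" and u: "u \<in> ground_states p \<mu>" and near: "X_norm (\<lambda>z. w z - u z) < \<delta>" for w u
  proof -
    have uX: "u \<in> X" "energy p u = level \<mu>" "mass u = \<mu>" using u ground_states_iff[OF \<mu>] by auto
    define g where "g = (\<lambda>z. w z - u z)"
    define x where "x = X_norm g"
    have gX: "g \<in> X" unfolding g_def by (intro X_diff w uX)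
    have x: "0 \<le> x" "x \<le> 1" "x * G \<le> d / 4"
    proof -
      show "0 \<le> x" "x \<le> 1" using near by (auto simp: x_def g_def \<delta>_def)
      have "x \<le> d / (4 * G)" using near by (auto simp: x_def g_def \<delta>_def)
      then have "x * G \<le> d / (4 * G) * G" using G by (intro mult_right_mono) auto
      then show "x * G \<le> d / 4" using G by simp
    qed
    have x2: "x\<^sup>2 \<le> x" using x by (simp add: power2_eq_square mult_left_le)
    have gk: "kin g \<le> x\<^sup>2" and gl: "L2norm g \<le> x" using X_norm_bounds[OF gX] by (auto simp: x_def)
    have gs: "L2sq g \<le> x\<^sup>2" using power_mono[OF gl, of 2] by simp
    have wN: "L2norm u = N" using uX(3) by (simp add: L2norm_def N_def mass_eq)
    have uk: "kin u \<le> B" using B(2)[OF uX(1)] wN uX(2) level_neg[OF \<mu>] by simp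
    have wsum: "w = (\<lambda>z. u z + g z)" by (simp add: g_def)
    have nle: "L2norm w \<le> N + x" "N \<le> L2norm w + x"
      using L2norm_abs_diff[OF X_L2[OF w] X_L2[OF uX(1)]] gl wN unfolding g_def by linarith+
    have mass: "\<bar>mass w - \<mu>\<bar> \<le> x * G"
    proof -
      have "\<bar>L2norm w - N\<bar> \<le> x" "0 \<le> L2norm w" using nle by auto
      have eq: "mass w - \<mu> = (L2norm w - N) * (L2norm w + N) / 2"
      proof -
        have "(L2norm w - N) * (L2norm w + N) = (L2norm w)\<^sup>2 - N\<^sup>2"
          by (simp add: power2_eq_square algebra_simps)
        also have "\<dots> = L2sq w - 2 * \<mu>" using \<mu> by (simp add: N_def)
        finally show ?thesis by (simp add: mass_eq)
      qed
      have "\<bar>L2norm w + N\<bar> = L2norm w + N" using N by (simp add: add_nonneg_nonneg)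
      then have "\<bar>mass w - \<mu>\<bar> = \<bar>L2norm w - N\<bar> * (L2norm w + N) / 2" unfolding eq by (simp add: abs_mult)
      also have "\<dots> \<le> x * (2 * N + 1) / 2"
        using \<open>\<bar>L2norm w - N\<bar> \<le> x\<close> nle x N by (intro divide_right_mono mult_mono) auto
      also have "\<dots> \<le> x * G"
      proof -
        have "(2 * N + 1) / 2 \<le> G" using N B K A by (simp add: G_def add_nonneg_nonneg)
        from mult_left_mono[OF this x(1)] show ?thesis by simp
      qed
      finally show ?thesis .
    qed
    have kinw: "kin w \<le> kin u + x\<^sup>2 + 2 * (sqrt B * x)"
    proof -
      have "Re (dform u g) \<le> sqrt (kin u) * sqrt (kin g)" using kin_dform_bound[OF uX(1) gX] by linarith
      also have "\<dots> \<le> sqrt B * x"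
        using uk gk x B(1) by (intro mult_mono) (auto intro: real_le_lsqrt)
      finally show ?thesis using kin_add[OF uX(1) gX] gk unfolding wsum by linarith
    qed
    have potg: "pot q g \<le> A * x"
    proof -
      have "pot q g \<le> L2sq g + tail_const q * 1 powr (4/3) * kin g"
        by (rule potb[OF gX]) (use gl x in auto)
      also have "\<dots> \<le> x + tail_const q * x"
        using gs gk x2 tail_const_pos[OF q_range(2)] by (intro add_mono) (auto intro!: mult_left_mono)
      finally show ?thesis by (simp add: A_def distrib_right)
    qed
    have potw: "pot q w \<le> P"
    proof -
      have "L2norm w \<le> M" using nle x by (simp add: M_def)
      then have 1: "L2sq w \<le> M\<^sup>2" using power_mono[of "L2norm w" M 2] by simp
      have "kin w \<le> 2 * kin u + 2 * kin g"
        using kin_add[OF uX(1) gX] kin_diff[OF uX(1) gX] kin_nonneg[of "\<lambda>z. u z - g z"] unfolding wsum by linarith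
      then have 2: "kin w \<le> 2 * B + 2" using uk gk x x2 by linarith
      have "pot q w \<le> L2sq w + tail_const q * M powr (4/3) * kin w"
        by (rule potb[OF w \<open>L2norm w \<le> M\<close> M])
      also have "\<dots> \<le> M\<^sup>2 + tail_const q * M powr (4/3) * (2 * B + 2)"
        using 1 2 tail_const_pos[OF q_range(2)] by (intro add_mono mult_left_mono) auto
      finally show ?thesis by (simp add: P_def)
    qed
    have potu: "pot q u \<le> pot q w + (\<eta> * P + K * (A * x))"
    proof -
      note L = X_L2[OF w] X_L2[OF gX]
      have ng: "pot q (\<lambda>z. - g z) = pot q g" by (simp add: pot_def)
      have "pot q (\<lambda>z. w z + (- g z)) \<le> (1 + \<eta>) * pot q w + K * pot q (\<lambda>z. - g z)"
        by (rule K(2)) (use pot_integrable[OF w] pot_integrable[OF gX] L2_measurable[OF L(1)] L2_measurable[OF L(2)] in auto)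
      then have "pot q u \<le> (1 + \<eta>) * pot q w + K * pot q g" unfolding ng by (simp add: g_def)
      moreover have "\<eta> * pot q w \<le> \<eta> * P" using potw \<eta> by (intro mult_left_mono) auto
      moreover have "K * pot q g \<le> K * (A * x)" using potg K by (intro mult_left_mono) auto
      ultimately show ?thesis by (simp add: distrib_right)
    qed
    have "energy p w - energy p u = (kin w - kin u) / 2 + (pot q u - pot q w) / q"
      by (simp only: energy_kin_pot[OF w] energy_kin_pot[OF uX(1)] diff_divide_distrib)
    also have "(pot q u - pot q w) / q \<le> (\<eta> * P + K * (A * x)) / q"
      using potu q_range(3) by (intro divide_right_mono) auto
    also have "\<dots> \<le> (\<eta> * P + K * (A * x)) / 1"
      using \<eta> P K A x q_range(1) by (intro divide_left_mono) auto
    finally have "energy p w - energy p u \<le> (kin w - kin u) / 2 + (\<eta> * P + K * (A * x))" by simp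
    moreover have "\<eta> * P = d / 4" using P by (simp add: \<eta>_def)
    moreover have "(kin w - kin u) / 2 + K * (A * x) \<le> x * G"
    proof -
      define y where "y = sqrt B * x"
      have "kin w \<le> kin u + x\<^sup>2 + 2 * y" using kinw by (simp only: y_def)
      then have "(kin w - kin u) / 2 \<le> x + y" using x2 x(1) by (simp add: field_simps)
      then have "(kin w - kin u) / 2 \<le> x + sqrt B * x" by (simp only: y_def)
      moreover have "x * G = x + sqrt B * x + K * (A * x) + 2 * (x * N)" by (simp add: G_def algebra_simps)
      moreover have "0 \<le> x * N" using x N by simp
      ultimately show ?thesis by linarith
    qed
    ultimately have "energy p w \<le> level \<mu> + d / 2" using uX(2) x(3) by linarith
    then show ?thesis using mass x(3) d by linarith
  qed
  then show ?thesis using \<delta> by blast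
qed

end

section \<open>Solutions and their symmetries\<close>

text \<open>
  The time derivative of \<open>L2_inner (\<psi> t) v\<close> that the equation prescribes when \<open>\<psi> t = u\<close>.
\<close>

definition rhs :: "real \<Rightarrow> (plane \<Rightarrow> complex) \<Rightarrow> (plane \<Rightarrow> complex) \<Rightarrow> complex" where
  "rhs p u v = - \<i> * (dform u v - L2_inner (nonlinearity p u) v)"

lemma solution_on_iff:
  "solution_on p I \<psi> \<longleftrightarrow>
     (\<forall>t\<in>I. \<psi> t \<in> X) \<and>
     (\<forall>t\<in>I. ((\<lambda>s. X_norm (\<lambda>z. \<psi> s z - \<psi> t z)) \<longlongrightarrow> 0) (at t within I)) \<and>
     (\<forall>v\<in>X. \<forall>t\<in>I. ((\<lambda>s. L2_inner (\<psi> s) v) has_vector_derivative rhs p (\<psi> t) v) (at t within I))"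
proof -
  have alg: "\<i> * d - a - b + c = 0 \<longleftrightarrow> d = - \<i> * ((a + b) - c)" for a b c d :: complex
  proof
    assume "\<i> * d - a - b + c = 0"
    then have "\<i> * d = (a + b) - c" by (simp add: algebra_simps)
    then have "- \<i> * (\<i> * d) = - \<i> * ((a + b) - c)" by simp
    then show "d = - \<i> * ((a + b) - c)" by (simp add: mult.assoc[symmetric])
  next
    assume "d = - \<i> * ((a + b) - c)"
    then have "\<i> * d = (\<i> * - \<i>) * ((a + b) - c)" by (simp only: mult.assoc)
    then show "\<i> * d - a - b + c = 0" by simp
  qed
  have "(\<exists>d. ((\<lambda>s. L2_inner (\<psi> s) v) has_vector_derivative d) (at t within I) \<and>
        \<i> * d - L2_inner (dx (\<psi> t)) (dx v) - L2_inner (Dy (1/2) (\<psi> t)) (Dy (1/2) v)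
          + L2_inner (nonlinearity p (\<psi> t)) v = 0) \<longleftrightarrow>
      ((\<lambda>s. L2_inner (\<psi> s) v) has_vector_derivative rhs p (\<psi> t) v) (at t within I)"
    if "\<psi> t \<in> X" "v \<in> X" for t v
    unfolding alg dform_eq[OF that] rhs_def[symmetric] by auto
  then show ?thesis unfolding solution_on_def by blast
qed

lemma solution_on_X: "solution_on p I \<psi> \<Longrightarrow> t \<in> I \<Longrightarrow> \<psi> t \<in> X"
  by (simp add: solution_on_iff)

lemma solution_on_subset: "solution_on p I \<psi> \<Longrightarrow> J \<subseteq> I \<Longrightarrow> solution_on p J \<psi>"
  unfolding solution_on_iff
  by (meson has_vector_derivative_within_subset subsetD tendsto_within_subset)

lemma nonlinearity_measurable [measurable]:
  assumes [measurable]: "u \<in> borel_measurable borel"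
  shows "nonlinearity p u \<in> borel_measurable borel"
  unfolding nonlinearity_def by measurable

lemma rhs_cong_AE:
  assumes "u \<in> X" "u' \<in> X" "v \<in> X" "AE z in lborel. u z = u' z"
  shows "rhs p u v = rhs p u' v"
proof -
  note [measurable] = L2_measurable[OF X_L2[OF assms(1)]] L2_measurable[OF X_L2[OF assms(2)]] L2_measurable[OF X_L2[OF assms(3)]]
  have "dform u v = dform u' v" by (rule dform_cong_AE) (use assms X_L2 in auto)
  moreover have "L2_inner (nonlinearity p u) v = L2_inner (nonlinearity p u') v"
    by (rule L2_inner_cong_AE) (use assms(4) in \<open>auto simp: nonlinearity_def elim: eventually_mono\<close>)
  ultimately show ?thesis by (simp add: rhs_def)
qed

lemma solution_on_cong_AE:
  assumes s: "solution_on p I \<psi>" and X: "\<And>t. t \<in> I \<Longrightarrow> \<phi> t \<in> X" and eq: "\<And>t. t \<in> I \<Longrightarrow> ae_eq (\<psi> t) (\<phi> t)"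
  shows "solution_on p I \<phi>"
proof -
  have sX: "\<psi> t \<in> X" if "t \<in> I" for t using s that by (rule solution_on_X)
  have n: "X_norm (\<lambda>z. \<psi> s z - \<psi> t z) = X_norm (\<lambda>z. \<phi> s z - \<phi> t z)" if "s \<in> I" "t \<in> I" for s t
  proof -
    have D: "(\<lambda>z. \<psi> s z - \<psi> t z) \<in> X" "(\<lambda>z. \<phi> s z - \<phi> t z) \<in> X" using sX X that by (auto intro: X_diff)
    have ae: "AE z in lborel. \<psi> s z - \<psi> t z = \<phi> s z - \<phi> t z"
      using eq[OF that(1)] eq[OF that(2)] unfolding ae_eq_def by eventually_elim simp
    show ?thesis unfolding X_norm_eq[OF D(1)] X_norm_eq[OF D(2)]
      using kin_cong_AE[OF X_L2[OF D(1)] X_L2[OF D(2)] ae]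
        L2sq_cong_AE[OF ae L2_measurable[OF X_L2[OF D(1)]] L2_measurable[OF X_L2[OF D(2)]]] by simp
  qed
  have i: "L2_inner (\<psi> t) v = L2_inner (\<phi> t) v" if "t \<in> I" "v \<in> X" for t v
    by (rule L2_inner_cong_AE) (use eq[OF that(1)] sX[OF that(1)] X[OF that(1)] that(2) in \<open>auto simp: ae_eq_def intro!: L2_measurable X_L2\<close>)
  have r: "rhs p (\<psi> t) v = rhs p (\<phi> t) v" if "t \<in> I" "v \<in> X" for t v
    by (rule rhs_cong_AE) (use eq[OF that(1)] sX X that in \<open>auto simp: ae_eq_def\<close>)
  show ?thesis
    unfolding solution_on_iff
  proof (intro conjI ballI)
    show "\<phi> t \<in> X" if "t \<in> I" for t using X that .
    fix t assume t: "t \<in> I"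
    have "((\<lambda>s. X_norm (\<lambda>z. \<psi> s z - \<psi> t z)) \<longlongrightarrow> 0) (at t within I)" using s t by (auto simp: solution_on_iff)
    then show "((\<lambda>s. X_norm (\<lambda>z. \<phi> s z - \<phi> t z)) \<longlongrightarrow> 0) (at t within I)"
      by (rule Lim_transform_within[where d=1]) (use n t in auto)
  next
    fix v t assume v: "v \<in> X" and t: "t \<in> I"
    have "((\<lambda>s. L2_inner (\<psi> s) v) has_vector_derivative rhs p (\<psi> t) v) (at t within I)"
      using s t v by (auto simp: solution_on_iff)
    then have "((\<lambda>s. L2_inner (\<phi> s) v) has_vector_derivative rhs p (\<psi> t) v) (at t within I)"
      by (rule has_vector_derivative_transform[OF t, rotated]) (use i v in auto)
    then show "((\<lambda>s. L2_inner (\<phi> s) v) has_vector_derivative rhs p (\<phi> t) v) (at t within I)"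
      using r[OF t v] by simp
  qed
qed

lemma solution_on_local:
  assumes "\<And>t. t \<in> I \<Longrightarrow> \<exists>U. open U \<and> t \<in> U \<and> solution_on p (I \<inter> U) \<psi>"
  shows "solution_on p I \<psi>"
  unfolding solution_on_iff
proof (intro conjI ballI)
  have at: "at t within (I \<inter> U) = at t within I" if "open U" "t \<in> U" for t :: real and U
    using that by (intro at_within_nhd[of t U]) auto
  fix t assume t: "t \<in> I"
  then obtain U where U: "open U" "t \<in> U" "solution_on p (I \<inter> U) \<psi>" using assms by blast
  show "\<psi> t \<in> X" using U t by (auto intro: solution_on_X)
  show "((\<lambda>s. X_norm (\<lambda>z. \<psi> s z - \<psi> t z)) \<longlongrightarrow> 0) (at t within I)"
  proof -
    have "((\<lambda>s. X_norm (\<lambda>z. \<psi> s z - \<psi> t z)) \<longlongrightarrow> 0) (at t within (I \<inter> U))"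
      using U(3)[unfolded solution_on_iff] U(2) t by blast
    then show ?thesis unfolding at[OF U(1,2)] .
  qed
next
  have at: "at t within (I \<inter> U) = at t within I" if "open U" "t \<in> U" for t :: real and U
    using that by (intro at_within_nhd[of t U]) auto
  fix v t assume v: "v \<in> X" and t: "t \<in> I"
  then obtain U where U: "open U" "t \<in> U" "solution_on p (I \<inter> U) \<psi>" using assms by blast
  have "((\<lambda>s. L2_inner (\<psi> s) v) has_vector_derivative rhs p (\<psi> t) v) (at t within (I \<inter> U))"
    using U(3)[unfolded solution_on_iff] U(2) t v by blast
  then show "((\<lambda>s. L2_inner (\<psi> s) v) has_vector_derivative rhs p (\<psi> t) v) (at t within I)"
    unfolding at[OF U(1,2)] .
qed

lemma has_vector_derivative_Un:
  assumes "(f has_vector_derivative d) (at x within S)" "(f has_vector_derivative d) (at x within T)"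
  shows "(f has_vector_derivative d) (at x within (S \<union> T))"
  using assms unfolding has_vector_derivative_def has_derivative_within
  by (auto simp: at_within_union intro: filterlim_sup)

text \<open>
  At the junction both one-sided derivatives exist, and they agree because the equation
  determines them from the common value there.
\<close>

lemma solution_on_glue:
  assumes \<psi>: "solution_on p I \<psi>" and \<phi>: "solution_on p J \<phi>" and c: "c \<in> I" "c \<in> J"
    and I: "\<And>t. t \<in> I \<Longrightarrow> t \<le> c" and J: "\<And>t. t \<in> J \<Longrightarrow> c \<le> t" and eq: "ae_eq (\<phi> c) (\<psi> c)"
  shows "solution_on p (I \<union> J) (\<lambda>t. if t \<le> c then \<psi> t else \<phi> t)" (is "solution_on _ _ ?f")
proof -
  have 1: "solution_on p I ?f"
    by (rule solution_on_cong_AE[OF \<psi>]) (use I solution_on_X[OF \<psi>] in \<open>auto simp: ae_eq_def\<close>)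
  have 2: "solution_on p J ?f"
  proof (rule solution_on_cong_AE[OF \<phi>])
    fix t assume t: "t \<in> J"
    show "?f t \<in> X" using t J[OF t] solution_on_X[OF \<phi>] solution_on_X[OF \<psi>] c by (cases "t = c") auto
    show "ae_eq (\<phi> t) (?f t)" using t J[OF t] eq by (cases "t = c") (auto simp: ae_eq_def)
  qed
  have at1: "at t within (I \<union> J) = at t within I" if "t < c" for t
    by (rule at_within_nhd[of t "{..<c}"]) (use that J in force)+
  have at2: "at t within (I \<union> J) = at t within J" if "c < t" for t
    by (rule at_within_nhd[of t "{c<..}"]) (use that I in force)+
  have cases: "t < c \<and> t \<in> I \<or> c < t \<and> t \<in> J \<or> t = c" if "t \<in> I \<union> J" for t
    using that I J by force
  show ?thesis
    unfolding solution_on_iff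
  proof (intro conjI ballI)
    fix t assume t: "t \<in> I \<union> J"
    show "?f t \<in> X" using t solution_on_X[OF 1] solution_on_X[OF 2] by blast
    show "((\<lambda>s. X_norm (\<lambda>z. ?f s z - ?f t z)) \<longlongrightarrow> 0) (at t within I \<union> J)"
      using cases[OF t]
    proof (elim disjE conjE)
      assume a: "t < c" "t \<in> I"
      show ?thesis unfolding at1[OF a(1)] using 1[unfolded solution_on_iff] a(2) by blast
    next
      assume a: "c < t" "t \<in> J"
      show ?thesis unfolding at2[OF a(1)] using 2[unfolded solution_on_iff] a(2) by blast
    next
      assume a: "t = c"
      show ?thesis unfolding at_within_union a
        by (rule filterlim_sup) (use 1[unfolded solution_on_iff] 2[unfolded solution_on_iff] c in blast)+
    qed
  next
    fix v t assume v: "v \<in> X" and t: "t \<in> I \<union> J"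
    show "((\<lambda>s. L2_inner (?f s) v) has_vector_derivative rhs p (?f t) v) (at t within I \<union> J)"
      using cases[OF t]
    proof (elim disjE conjE)
      assume a: "t < c" "t \<in> I"
      show ?thesis unfolding at1[OF a(1)] using 1[unfolded solution_on_iff] a(2) v by blast
    next
      assume a: "c < t" "t \<in> J"
      show ?thesis unfolding at2[OF a(1)] using 2[unfolded solution_on_iff] a(2) v by blast
    next
      assume a: "t = c"
      show ?thesis unfolding a
        by (rule has_vector_derivative_Un) (use 1[unfolded solution_on_iff] 2[unfolded solution_on_iff] c v in blast)+
    qed
  qed
qed

text \<open>
  A symmetry of the equation acts by \<open>S\<close> on functions and by \<open>t \<mapsto> b t + c\<close> on time. Through the adjoint
  \<open>S'\<close> it acts on the pairing with test functions by \<open>F\<close>, which is only real linear for the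
  conjugation. Shifts, time reversal and dilations are instances.
\<close>

lemma solution_on_transform:
  fixes b :: real
  assumes \<psi>: "solution_on p I \<psi>" and b: "b \<noteq> 0" and J: "\<And>t. t \<in> J \<Longrightarrow> b * t + c \<in> I"
    and SX: "\<And>u. u \<in> X \<Longrightarrow> S u \<in> X" and S'X: "\<And>v. v \<in> X \<Longrightarrow> S' v \<in> X"
    and F: "bounded_linear F" and inner: "\<And>u v. u \<in> X \<Longrightarrow> v \<in> X \<Longrightarrow> L2_inner (S u) v = F (L2_inner u (S' v))"
    and r: "\<And>u v. u \<in> X \<Longrightarrow> v \<in> X \<Longrightarrow> rhs p (S u) v = F (b *\<^sub>R rhs p u (S' v))"
    and norm: "\<And>u v. u \<in> X \<Longrightarrow> v \<in> X \<Longrightarrow> X_norm (\<lambda>z. S u z - S v z) \<le> C * X_norm (\<lambda>z. u z - v z)"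
  shows "solution_on p J (\<lambda>t. S (\<psi> (b * t + c)))"
  unfolding solution_on_iff
proof (intro conjI ballI)
  fix t assume t: "t \<in> J"
  show "S (\<psi> (b * t + c)) \<in> X" by (intro SX solution_on_X[OF \<psi>] J t)
  have fl: "filterlim (\<lambda>s. b * s + c) (at (b * t + c) within I) (at t within J)"
    unfolding filterlim_at
  proof
    show "((\<lambda>s. b * s + c) \<longlongrightarrow> b * t + c) (at t within J)" by (intro tendsto_intros)
    show "\<forall>\<^sub>F s in at t within J. b * s + c \<in> I \<and> b * s + c \<noteq> b * t + c"
      unfolding eventually_at_filter using J b by (intro always_eventually) auto
  qed
  have "((\<lambda>s. X_norm (\<lambda>z. \<psi> s z - \<psi> (b * t + c) z)) \<longlongrightarrow> 0) (at (b * t + c) within I)"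
    using \<psi> J[OF t] by (auto simp: solution_on_iff)
  from tendsto_mult_left[OF filterlim_compose[OF this fl], of C]
  have l: "((\<lambda>s. C * X_norm (\<lambda>z. \<psi> (b * s + c) z - \<psi> (b * t + c) z)) \<longlongrightarrow> 0) (at t within J)" by simp
  show "((\<lambda>s. X_norm (\<lambda>z. S (\<psi> (b * s + c)) z - S (\<psi> (b * t + c)) z)) \<longlongrightarrow> 0) (at t within J)"
  proof (rule tendsto_sandwich[OF _ _ tendsto_const l])
    show "\<forall>\<^sub>F s in at t within J. X_norm (\<lambda>z. S (\<psi> (b * s + c)) z - S (\<psi> (b * t + c)) z)
        \<le> C * X_norm (\<lambda>z. \<psi> (b * s + c) z - \<psi> (b * t + c) z)"
      unfolding eventually_at_filter using J t by (intro always_eventually) (auto intro!: norm solution_on_X[OF \<psi>])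
  qed simp
next
  fix v t assume v: "v \<in> X" and t: "t \<in> J"
  have sub: "(\<lambda>s. b * s + c) ` J \<subseteq> I" using J by auto
  have "((\<lambda>s. L2_inner (\<psi> s) (S' v)) has_vector_derivative rhs p (\<psi> (b * t + c)) (S' v)) (at (b * t + c) within I)"
    using \<psi> J[OF t] S'X[OF v] by (auto simp: solution_on_iff)
  then have 1: "((\<lambda>s. L2_inner (\<psi> s) (S' v)) has_vector_derivative rhs p (\<psi> (b * t + c)) (S' v)) (at (b * t + c) within (\<lambda>s. b * s + c) ` J)"
    by (rule has_vector_derivative_within_subset[OF _ sub])
  have 2: "((\<lambda>s. b * s + c) has_vector_derivative b) (at t within J)"
    by (auto intro!: derivative_eq_intros simp flip: has_real_derivative_iff_has_vector_derivative)
  have "((\<lambda>s. L2_inner (\<psi> (b * s + c)) (S' v)) has_vector_derivative b *\<^sub>R rhs p (\<psi> (b * t + c)) (S' v)) (at t within J)"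
    using vector_diff_chain_within[OF 2 1] by (simp add: o_def)
  then have "((\<lambda>s. F (L2_inner (\<psi> (b * s + c)) (S' v))) has_vector_derivative F (b *\<^sub>R rhs p (\<psi> (b * t + c)) (S' v))) (at t within J)"
    by (rule bounded_linear.has_vector_derivative[OF F])
  then have "((\<lambda>s. F (L2_inner (\<psi> (b * s + c)) (S' v))) has_vector_derivative rhs p (S (\<psi> (b * t + c))) v) (at t within J)"
    using r[OF solution_on_X[OF \<psi> J[OF t]] v] by simp
  then show "((\<lambda>s. L2_inner (S (\<psi> (b * s + c))) v) has_vector_derivative rhs p (S (\<psi> (b * t + c))) v) (at t within J)"
    by (rule has_vector_derivative_transform[OF t, rotated]) (use inner v J solution_on_X[OF \<psi>] in auto)
qed

lemma solution_on_shift: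
  assumes "solution_on p I \<psi>" "\<And>t. t \<in> J \<Longrightarrow> t + c \<in> I"
  shows "solution_on p J (\<lambda>t. \<psi> (t + c))"
  using solution_on_transform[OF assms(1), of 1 J c "\<lambda>u. u" "\<lambda>u. u" "\<lambda>x. x" 1] assms(2)
  by (simp add: bounded_linear_ident)

lemma nonlinearity_cnj: "nonlinearity p (\<lambda>z. cnj (u z)) = (\<lambda>z. cnj (nonlinearity p u z))"
  by (simp add: nonlinearity_def)

lemma L2_inner_cnj_left: "L2_inner (\<lambda>z. cnj (u z)) v = cnj (L2_inner u (\<lambda>z. cnj (v z)))"
proof -
  have "cnj (L2_inner u (\<lambda>z. cnj (v z))) = (LINT z|lborel. cnj (u z * cnj (cnj (v z))))"
    unfolding L2_inner_def by (rule Bochner_Integration.integral_cnj[symmetric])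
  then show ?thesis by (simp add: L2_inner_def)
qed

lemma solution_on_reverse:
  assumes "solution_on p I \<psi>" "\<And>t. t \<in> J \<Longrightarrow> - t \<in> I"
  shows "solution_on p J (\<lambda>t z. cnj (\<psi> (- t) z))"
proof -
  have "solution_on p J (\<lambda>t. (\<lambda>u z. cnj (u z)) (\<psi> (-1 * t + 0)))"
  proof (rule solution_on_transform[OF assms(1), where S'="\<lambda>u z. cnj (u z)" and F=cnj and C=1])
    show "rhs p (\<lambda>z. cnj (u z)) v = cnj ((-1) *\<^sub>R rhs p u (\<lambda>z. cnj (v z)))" if "u \<in> X" "v \<in> X" for u v
      by (simp add: rhs_def nonlinearity_cnj dform_cnj[OF that] L2_inner_cnj_left[of "nonlinearity p u" v] algebra_simps)
    show "X_norm (\<lambda>z. cnj (u z) - cnj (v z)) \<le> 1 * X_norm (\<lambda>z. u z - v z)" if "u \<in> X" "v \<in> X" for u v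
    proof -
      have D: "(\<lambda>z. u z - v z) \<in> X" by (rule X_diff[OF that])
      have "X_norm (\<lambda>z. cnj ((\<lambda>z. u z - v z) z)) = X_norm (\<lambda>z. u z - v z)"
        unfolding X_norm_eq[OF D] X_norm_eq[OF X_cnj[OF D]] kin_cnj[OF D] L2sq_cnj ..
      then show ?thesis by simp
    qed
  qed (use assms(2) in \<open>auto intro: X_cnj L2_inner_cnj_left bounded_linear_cnj\<close>)
  then show ?thesis by simp
qed

section \<open>Global solutions and stability\<close>

context subcritical
begin

lemma solution_on_dilate:
  assumes \<psi>: "solution_on p I \<psi>" and l: "l > 0" and J: "\<And>t. t \<in> J \<Longrightarrow> l\<^sup>2 * t \<in> I"
  shows "solution_on p J (\<lambda>t. nls_dil p l (\<psi> (l\<^sup>2 * t)))"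
proof -
  define a where "a = l powr (2 / (p - 1))"
  have a: "a > 0" using l by (simp add: a_def)
  have "2 / (p - 1) * (p - 1) = 2" using p by (simp add: field_simps)
  then have ap: "a powr (p - 1) = l\<^sup>2" unfolding a_def powr_powr using l by (simp only: powr_numeral less_imp_le)
  define S' where "S' v = (\<lambda>z. v (aff (1/l) ((1/l)\<^sup>2) 0 z))" for v :: "plane \<Rightarrow> complex"
  have S'X: "S' v \<in> X" if "v \<in> X" for v unfolding S'_def using that l by (intro X_aff) auto
  have inv: "S' v (aff l (l\<^sup>2) 0 z) = v z" for v z
    using l by (simp add: S'_def aff_def power_divide)
  have nz: "l \<noteq> 0" "l\<^sup>2 \<noteq> 0" using l by auto
  define k where "k = complex_of_real (a / l^3)"
  have inner0: "L2_inner (\<lambda>z. u (aff l (l\<^sup>2) 0 z)) v = complex_of_real (1 / l^3) * L2_inner u (S' v)" for u v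
  proof -
    have "L2_inner (\<lambda>z. u (aff l (l\<^sup>2) 0 z)) v = (LINT z|lborel. (\<lambda>z. u z * cnj (S' v z)) (aff l (l\<^sup>2) 0 z))"
      by (simp add: L2_inner_def inv)
    also have "\<dots> = (1 / \<bar>l * l\<^sup>2\<bar>) *\<^sub>R L2_inner u (S' v)"
      unfolding L2_inner_def by (rule integral_aff[OF nz])
    also have "\<bar>l * l\<^sup>2\<bar> = l^3" using l by (simp add: power2_eq_square power3_eq_cube)
    finally show ?thesis by (simp add: scaleR_conv_of_real)
  qed
  have inner: "L2_inner (nls_dil p l u) v = k * L2_inner u (S' v)" for u v
    unfolding nls_dil_def dil_fun L2_inner_scale_left inner0 by (simp add: k_def a_def)
  have df: "dform (nls_dil p l u) v = k * complex_of_real (l\<^sup>2) * dform u (S' v)" if "u \<in> X" "v \<in> X" for u v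
  proof -
    let ?w = "\<lambda>z. u (aff l (l\<^sup>2) 0 z)"
    have w: "?w \<in> X" using that l by (intro X_aff)
    have "L2_inner (WFT (\<lambda>z. complex_of_real a * ?w z)) (WFT v) = L2_inner (\<lambda>\<zeta>. complex_of_real a * WFT ?w \<zeta>) (WFT v)"
      by (intro L2_inner_cong_AE WFT_scale X_L2 w WFT_measurable L2_scale AE_I2 refl that L2_measurable WFT_L2)
    then have "dform (nls_dil p l u) v = complex_of_real a * dform ?w v"
      unfolding nls_dil_def dil_fun a_def[symmetric] by (simp add: dform_def L2_inner_scale_left)
    also have "v = (\<lambda>z. S' v (aff l (l\<^sup>2) 0 z))" by (simp add: inv)
    also have "dform ?w (\<lambda>z. S' v (aff l (l\<^sup>2) 0 z)) = dform u (S' v) / l"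
      by (rule dform_aff[OF that(1) S'X[OF that(2)] l])
    finally have "dform (nls_dil p l u) v = complex_of_real a * (dform u (S' v) / complex_of_real l)"
      by (simp add: inv)
    then show ?thesis using l by (simp add: k_def power2_eq_square power3_eq_cube)
  qed
  have nl: "L2_inner (nonlinearity p (nls_dil p l u)) v = k * complex_of_real (l\<^sup>2) * L2_inner (nonlinearity p u) (S' v)" for u v
  proof -
    have "nonlinearity p (nls_dil p l u) = (\<lambda>z. complex_of_real (a * l\<^sup>2) * nonlinearity p u (aff l (l\<^sup>2) 0 z))"
      using a by (simp add: nonlinearity_def nls_dil_def dil_fun a_def[symmetric] norm_mult powr_mult ap mult_ac)
    then have "L2_inner (nonlinearity p (nls_dil p l u)) v
        = complex_of_real (a * l\<^sup>2) * (complex_of_real (1 / l^3) * L2_inner (nonlinearity p u) (S' v))"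
      by (simp only: L2_inner_scale_left inner0)
    then show ?thesis by (simp add: k_def)
  qed
  define C where "C = sqrt (l powr (\<sigma> + 2) + l powr \<sigma>)"
  have "solution_on p J (\<lambda>t. nls_dil p l (\<psi> (l\<^sup>2 * t + 0)))"
  proof (rule solution_on_transform[OF \<psi>, where S'=S' and F="\<lambda>x. k * x" and C=C])
    show "rhs p (nls_dil p l u) v = k * (l\<^sup>2 *\<^sub>R rhs p u (S' v))" if "u \<in> X" "v \<in> X" for u v
      unfolding rhs_def df[OF that] nl by (simp add: scaleR_conv_of_real algebra_simps)
    show "X_norm (\<lambda>z. nls_dil p l u z - nls_dil p l v z) \<le> C * X_norm (\<lambda>z. u z - v z)" if "u \<in> X" "v \<in> X" for u v
    proof -
      let ?d = "\<lambda>z. u z - v z"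
      have D: "?d \<in> X" by (rule X_diff[OF that])
      have eq: "(\<lambda>z. nls_dil p l u z - nls_dil p l v z) = nls_dil p l ?d"
        unfolding nls_dil_def by (rule dil_diff[symmetric])
      have "l powr (\<sigma> + 2) * kin ?d + l powr \<sigma> * L2sq ?d \<le> (l powr (\<sigma> + 2) + l powr \<sigma>) * (kin ?d + L2sq ?d)"
        by (simp add: algebra_simps)
      then show ?thesis
        unfolding eq X_norm_eq[OF nls_dil_X[OF D l]] X_norm_eq[OF D] C_def real_sqrt_mult[symmetric]
          kin_nls_dil[OF D l] L2sq_nls_dil[OF l] by simp
    qed
  qed (use l J nls_dil_X S'X inner in \<open>auto intro: bounded_linear_mult_right\<close>)
  then show ?thesis by simp
qed

lemma nls_dil_inverse: "l > 0 \<Longrightarrow> nls_dil p (1/l) (nls_dil p l u) = u"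
  by (simp add: nls_dil_def dil_dil dil_1 flip: powr_mult)

lemma ae_eq_nls_dil:
  assumes "l > 0" "ae_eq u v"
  shows "ae_eq (nls_dil p l u) (nls_dil p l v)"
proof -
  have "AE z in lborel. u (aff l (l\<^sup>2) 0 z) = v (aff l (l\<^sup>2) 0 z)"
    using assms by (intro AE_aff) (auto simp: ae_eq_def)
  then show ?thesis unfolding ae_eq_def nls_dil_def dil_fun by eventually_elim simp
qed

text \<open>
  The square of the norm of the dilated function is
  \<open>l powr (\<sigma> + 2) * kin u + l powr \<sigma> * L2sq u\<close>, which grows continuously from 0 to \<open>\<infinity>\<close>. For
  \<open>l \<le> 1\<close> it is at most \<open>l powr \<sigma> * R\<^sup>2\<close>, so it can reach 1 only if \<open>l\<close> is not too small.
\<close>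

lemma ex_unit_dilation:
  assumes u: "u \<in> X" "L2sq u > 0" "X_norm u \<le> R"
  obtains l where "l > 0" "X_norm (nls_dil p l u) = 1" "l \<ge> min 1 ((1 / R\<^sup>2) powr (1 / \<sigma>))"
proof -
  define f where "f l = l powr (\<sigma> + 2) * kin u + l powr \<sigma> * L2sq u" for l
  have c: "continuous_on {0..L} f" for L
    unfolding f_def using \<sigma>_pos by (intro continuous_intros continuous_on_powr') auto
  define L where "L = (1 / L2sq u) powr (1 / \<sigma>)"
  have L: "L > 0" using u by (simp add: L_def)
  have "L powr \<sigma> = 1 / L2sq u" unfolding L_def powr_powr using \<sigma>_pos u by simp
  then have fL: "f L \<ge> 1" using u by (simp add: f_def)
  have f0: "f 0 = 0" using \<sigma>_pos by (simp add: f_def)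
  obtain l where l: "0 \<le> l" "l \<le> L" "f l = 1" using IVT'[of f 0 1 L] f0 fL L c by auto
  have lp: "l > 0" using l f0 by (cases "l = 0") auto
  have R: "kin u + L2sq u \<le> R\<^sup>2" using power_mono[OF u(3), of 2] X_norm_power2[OF u(1)] by simp
  have R0: "R\<^sup>2 > 0" using R u(2) kin_nonneg[of u] by linarith
  have "l \<ge> (1 / R\<^sup>2) powr (1 / \<sigma>)" if "l \<le> 1"
  proof -
    have "l powr (\<sigma> + 2) \<le> l powr \<sigma>" using lp that by (intro powr_mono') auto
    then have "l powr (\<sigma> + 2) * kin u \<le> l powr \<sigma> * kin u" by (intro mult_right_mono) auto
    then have "1 \<le> l powr \<sigma> * (kin u + L2sq u)" using l(3) by (simp add: f_def distrib_left)
    also have "\<dots> \<le> l powr \<sigma> * R\<^sup>2" using R by (intro mult_left_mono) auto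
    finally have "1 / R\<^sup>2 \<le> l powr \<sigma>" using R0 by (simp add: pos_divide_le_eq)
    then have "(1 / R\<^sup>2) powr (1 / \<sigma>) \<le> (l powr \<sigma>) powr (1 / \<sigma>)" using \<sigma>_pos R0 by (intro powr_mono2) auto
    also have "\<dots> = l" unfolding powr_powr using \<sigma>_pos lp by simp
    finally show ?thesis .
  qed
  then have "l \<ge> min 1 ((1 / R\<^sup>2) powr (1 / \<sigma>))" by linarith
  moreover have "X_norm (nls_dil p l u) = 1"
    unfolding X_norm_eq[OF nls_dil_X[OF u(1) lp]] kin_nls_dil[OF u(1) lp] L2sq_nls_dil[OF lp]
    using l(3) by (simp add: f_def)
  ultimately show ?thesis using that lp by blast
qed

text \<open>
  The lifespan granted by \<open>well_posed\<close> could tend to 0 along a bounded sequence of norms. Dilating every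
  datum to norm 1 uses it only at a single value: a datum with factor \<open>l\<close> lives at least for the time
  \<open>l\<^sup>2 * T 1\<close>.
\<close>

lemma uniform_lifespan:
  assumes wp: "well_posed p" and R: "R > 0"
  obtains \<tau> where "\<tau> > 0" "\<And>u. u \<in> X \<Longrightarrow> L2sq u > 0 \<Longrightarrow> X_norm u \<le> R \<Longrightarrow>
    \<exists>\<psi>. solution_on p {0..<\<tau>} \<psi> \<and> ae_eq (\<psi> 0) u"
proof -
  obtain T :: "real \<Rightarrow> real" where T: "\<And>r. r \<ge> 0 \<Longrightarrow> T r > 0"
    and ex: "\<And>u. u \<in> X \<Longrightarrow> \<exists>\<psi>. solution_on p {0..<T (X_norm u)} \<psi> \<and> ae_eq (\<psi> 0) u"
    using wp unfolding well_posed_def by blast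
  define m where "m = min 1 ((1 / R\<^sup>2) powr (1 / \<sigma>))"
  have m: "m > 0" using R by (simp add: m_def)
  define \<tau> where "\<tau> = m\<^sup>2 * T 1"
  have "\<tau> > 0" using m T[of 1] by (simp add: \<tau>_def)
  moreover have "\<exists>\<psi>. solution_on p {0..<\<tau>} \<psi> \<and> ae_eq (\<psi> 0) u" if u: "u \<in> X" "L2sq u > 0" "X_norm u \<le> R" for u
  proof -
    obtain l where l: "l > 0" "X_norm (nls_dil p l u) = 1" "l \<ge> m"
      using ex_unit_dilation[OF u] unfolding m_def by blast
    obtain \<phi> where \<phi>: "solution_on p {0..<T 1} \<phi>" "ae_eq (\<phi> 0) (nls_dil p l u)"
      using ex[OF nls_dil_X[OF u(1) l(1)]] l(2) by auto
    have "m\<^sup>2 \<le> l\<^sup>2" using l m by (intro power_mono) auto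
    then have \<tau>l: "\<tau> \<le> l\<^sup>2 * T 1" unfolding \<tau>_def using T[of 1] by (intro mult_right_mono) auto
    have "solution_on p {0..<\<tau>} (\<lambda>t. nls_dil p (1/l) (\<phi> ((1/l)\<^sup>2 * t)))"
    proof (rule solution_on_dilate[OF \<phi>(1)])
      fix t assume t: "t \<in> {0..<\<tau>}"
      then have "t < T 1 * l\<^sup>2" using \<tau>l by (simp add: mult.commute)
      then have "t / l\<^sup>2 < T 1" using l by (simp add: pos_divide_less_eq)
      then show "(1/l)\<^sup>2 * t \<in> {0..<T 1}" using t by (simp add: power_divide)
    qed (use l in simp)
    moreover have "ae_eq (nls_dil p (1/l) (\<phi> ((1/l)\<^sup>2 * 0))) u"
      using ae_eq_nls_dil[OF _ \<phi>(2), of "1/l"] l nls_dil_inverse[OF l(1), of u] by simp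
    ultimately show ?thesis by blast
  qed
  ultimately show ?thesis using that by blast
qed

lemma conservation:
  assumes "well_posed p" "u \<in> X" "S > 0" "solution_on p {0..<S} \<psi>" "ae_eq (\<psi> 0) u" "t \<in> {0..<S}"
  shows "energy p (\<psi> t) = energy p u" "mass (\<psi> t) = mass u"
  using assms unfolding well_posed_def by blast+

text \<open>
  Conservation and coercivity bound the norm by \<open>R\<close> at all times, so \<open>uniform_lifespan\<close> allows steps of a
  fixed length. A step advances by \<open>h\<close>, half of the lifespan \<open>\<tau>\<close>: the junction is then an interior
  point of the previous interval, where conservation applies.
\<close>

lemma global_forward:
  assumes wp: "well_posed p" and u: "u \<in> X" "L2sq u > 0"
  obtains \<psi> where "solution_on p {0..} \<psi>" "ae_eq (\<psi> 0) u"
proof -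
  define N where "N = L2norm u"
  have N: "N > 0" using u by (simp add: N_def L2norm_def)
  obtain B where B: "B \<ge> 0" "\<And>w. w \<in> X \<Longrightarrow> L2norm w \<le> N \<Longrightarrow> kin w \<le> 4 * energy p w + B"
    using coercivity[OF N] by blast
  define R where "R = sqrt (4 * energy p u + B + L2sq u) + 1"
  have R: "R > 0"
  proof -
    have "0 \<le> 4 * energy p u + B" by (rule order_trans[OF kin_nonneg B(2)[OF u(1)]]) (simp add: N_def)
    then show ?thesis using u by (simp add: R_def add_nonneg_pos)
  qed
  obtain \<tau> where \<tau>: "\<tau> > 0" and life: "\<And>u. u \<in> X \<Longrightarrow> L2sq u > 0 \<Longrightarrow> X_norm u \<le> R \<Longrightarrow>
    \<exists>\<psi>. solution_on p {0..<\<tau>} \<psi> \<and> ae_eq (\<psi> 0) u"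
    using uniform_lifespan[OF wp R] by blast
  define h where "h = \<tau> / 2"
  have h: "h > 0" using \<tau> by (simp add: h_def)
  have ap: "L2sq w > 0 \<and> X_norm w \<le> R" if w: "w \<in> X" "energy p w = energy p u" "mass w = mass u" for w
  proof -
    have l: "L2sq w = L2sq u" using w(3) by (simp add: mass_eq)
    then have "kin w \<le> 4 * energy p u + B" using B(2)[OF w(1)] w(2) by (simp add: N_def L2norm_def)
    then have "X_norm w \<le> sqrt (4 * energy p u + B + L2sq u)" unfolding X_norm_eq[OF w(1)] l by simp
    then show ?thesis using l u by (simp add: R_def)
  qed
  define P where "P n \<psi> \<longleftrightarrow> solution_on p {0..<(real n + 2) * h} \<psi> \<and> ae_eq (\<psi> 0) u" for n :: nat and \<psi>
  define Q where "Q n \<psi> \<phi> \<longleftrightarrow> (\<forall>t\<le>(real n + 1) * h. \<phi> t = \<psi> t)" for n :: nat and \<psi> \<phi> :: "real \<Rightarrow> plane \<Rightarrow> complex"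
  have base: "\<exists>\<psi>. P 0 \<psi>"
    using life[OF u(1)] ap[OF u(1)] by (simp add: P_def h_def)
  have step: "\<exists>\<phi>. P (Suc n) \<phi> \<and> Q n \<psi> \<phi>" if P: "P n \<psi>" for n \<psi>
  proof -
    define c where "c = (real n + 1) * h"
    have c: "c > 0" "c < (real n + 2) * h" using h by (auto simp: c_def)
    have S: "solution_on p {0..<(real n + 2) * h} \<psi>" "ae_eq (\<psi> 0) u" using P by (auto simp: P_def)
    have cS: "c \<in> {0..<(real n + 2) * h}" "(real n + 2) * h > 0" using c by auto
    note cons = conservation[OF wp u(1) cS(2) S cS(1)]
    have cX: "\<psi> c \<in> X" using solution_on_X[OF S(1) cS(1)] .
    obtain \<phi> where \<phi>: "solution_on p {0..<\<tau>} \<phi>" "ae_eq (\<phi> 0) (\<psi> c)" using life[OF cX] ap[OF cX cons] by blast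
    have 1: "solution_on p {0..c} \<psi>" by (rule solution_on_subset[OF S(1)]) (use c in auto)
    have 2: "solution_on p {c..<c + \<tau>} (\<lambda>t. \<phi> (t + - c))" by (rule solution_on_shift[OF \<phi>(1)]) auto
    have "solution_on p ({0..c} \<union> {c..<c + \<tau>}) (\<lambda>t. if t \<le> c then \<psi> t else \<phi> (t + - c))"
      by (rule solution_on_glue[OF 1 2]) (use c \<tau> \<phi>(2) in auto)
    moreover have "{0..c} \<union> {c..<c + \<tau>} = {0..<(real (Suc n) + 2) * h}"
    proof -
      have "c + \<tau> = (real (Suc n) + 2) * h" by (simp add: c_def h_def field_simps)
      moreover have "{0..c} \<union> {c..<c + \<tau>} = {0..<c + \<tau>}" using c \<tau> by auto
      ultimately show ?thesis by simp
    qed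
    ultimately show ?thesis
      unfolding P_def Q_def using S(2) c by (intro exI[of _ "\<lambda>t. if t \<le> c then \<psi> t else \<phi> (t + - c)"]) (auto simp: c_def)
  qed
  obtain f where f: "\<And>n. P n (f n)" "\<And>n. Q n (f n) (f (Suc n))"
    using dependent_nat_choice[of P Q] base step by metis
  have agree: "f (n + k) t = f n t" if "t \<le> (real n + 1) * h" for n k t
  proof (induction k)
    case (Suc k)
    have "(real n + 1) * h \<le> (real (n + k) + 1) * h" using h by (intro mult_right_mono) auto
    then show ?case using f(2)[of "n + k"] that Suc by (auto simp: Q_def)
  qed simp
  define g where "g t = f (nat \<lfloor>t / h\<rfloor>) t" for t
  have geq: "g t = f n t" if "0 \<le> t" "t < (real n + 1) * h" for t n
  proof -
    define m where "m = nat \<lfloor>t / h\<rfloor>"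
    have "t / h < real n + 1" using that h by (simp add: pos_divide_less_eq)
    then have "m \<le> n" unfolding m_def by linarith
    then obtain k where k: "n = m + k" using le_Suc_ex by blast
    have "t / h \<le> real m + 1" unfolding m_def using that h by linarith
    then have "t \<le> (real m + 1) * h" using h by (simp add: pos_divide_le_eq)
    from agree[OF this, of k] show ?thesis by (simp add: g_def k flip: m_def)
  qed
  have "solution_on p {0..} g"
  proof (rule solution_on_local)
    fix t :: real assume t: "t \<in> {0..}"
    obtain n :: nat where n: "t / h < real n" using reals_Archimedean2 by blast
    define U where "U = {..<(real n + 1) * h}"
    have "t < real n * h" using n h by (simp add: pos_divide_less_eq)
    also have "\<dots> \<le> (real n + 1) * h" using h by (intro mult_right_mono) auto
    finally have tU: "t \<in> U" by (simp add: U_def)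
    have "{0..} \<inter> U \<subseteq> {0..<(real n + 2) * h}"
    proof
      fix s assume s: "s \<in> {0..} \<inter> U"
      have "(real n + 1) * h \<le> (real n + 2) * h" using h by (intro mult_right_mono) auto
      then show "s \<in> {0..<(real n + 2) * h}" using s by (auto simp: U_def)
    qed
    then have "solution_on p ({0..} \<inter> U) (f n)"
      using f(1)[of n] by (auto simp: P_def intro: solution_on_subset)
    then have "solution_on p ({0..} \<inter> U) g"
      by (rule solution_on_cong_AE) (use geq[of _ n] f(1)[of n] \<open>{0..} \<inter> U \<subseteq> _\<close> in
        \<open>auto simp: U_def ae_eq_def P_def intro: solution_on_X\<close>)
    moreover have "open U" by (simp add: U_def)
    ultimately show "\<exists>U. open U \<and> t \<in> U \<and> solution_on p ({0..} \<inter> U) g"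
      using tU by (intro exI[of _ U] conjI)
  qed
  moreover have "ae_eq (g 0) u" using geq[of 0 0] f(1)[of 0] h by (simp add: P_def)
  ultimately show ?thesis by (rule that)
qed

lemma mass_cnj: "mass (\<lambda>z. cnj (u z)) = mass u"
  by (simp add: mass_eq L2sq_cnj)

lemma energy_cnj: "u \<in> X \<Longrightarrow> energy p (\<lambda>z. cnj (u z)) = energy p u"
proof -
  assume u: "u \<in> X"
  have "pot q (\<lambda>z. cnj (u z)) = pot q u" by (simp add: pot_def)
  then show ?thesis by (simp only: energy_kin_pot[OF u] energy_kin_pot[OF X_cnj[OF u]] kin_cnj[OF u])
qed

text \<open>
  For negative times take the forward solution for the conjugate datum and reverse it.
\<close>

lemma global_solution:
  assumes wp: "well_posed p" and u: "u \<in> X" "L2sq u > 0"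
  obtains \<psi> where "solution_on p UNIV \<psi>" "ae_eq (\<psi> 0) u"
proof -
  obtain \<psi> where \<psi>: "solution_on p {0..} \<psi>" "ae_eq (\<psi> 0) u" using global_forward[OF wp u] .
  have "L2sq (\<lambda>z. cnj (u z)) > 0" using u(2) by (simp add: L2sq_cnj)
  then obtain \<phi> where \<phi>: "solution_on p {0..} \<phi>" "ae_eq (\<phi> 0) (\<lambda>z. cnj (u z))"
    using global_forward[OF wp X_cnj[OF u(1)]] by blast
  have r: "solution_on p {..0} (\<lambda>t z. cnj (\<phi> (- t) z))" by (rule solution_on_reverse[OF \<phi>(1)]) auto
  have e: "ae_eq (\<lambda>z. cnj (\<phi> (- 0) z)) u"
    using \<phi>(2) unfolding ae_eq_def by (auto elim: eventually_mono)
  have "ae_eq (\<psi> 0) (\<lambda>z. cnj (\<phi> (- 0) z))"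
    using \<psi>(2) e unfolding ae_eq_def by eventually_elim simp
  then have "solution_on p ({..0} \<union> {0..}) (\<lambda>t. if t \<le> 0 then (\<lambda>z. cnj (\<phi> (- t) z)) else \<psi> t)"
    by (intro solution_on_glue[OF r \<psi>(1)]) auto
  moreover have "{..0} \<union> {0..} = (UNIV :: real set)" by auto
  ultimately have "solution_on p UNIV (\<lambda>t. if t \<le> 0 then (\<lambda>z. cnj (\<phi> (- t) z)) else \<psi> t)" by simp
  then show ?thesis by (rule that) (use e in simp)
qed

lemma global_conservation:
  assumes wp: "well_posed p" and u: "u \<in> X" and s: "solution_on p UNIV \<psi>" "ae_eq (\<psi> 0) u"
  shows "energy p (\<psi> t) = energy p u" "mass (\<psi> t) = mass u"
proof -
  have X: "\<psi> t \<in> X" for t using s(1) by (rule solution_on_X) simp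
  have "energy p (\<psi> t) = energy p u \<and> mass (\<psi> t) = mass u"
  proof (cases "t \<ge> 0")
    case True
    have "solution_on p {0..<t + 1} \<psi>" by (rule solution_on_subset[OF s(1)]) simp
    from conservation[OF wp u _ this s(2), of t] True show ?thesis by simp
  next
    case False
    have r: "solution_on p {0..<- t + 1} (\<lambda>t z. cnj (\<psi> (- t) z))" by (rule solution_on_reverse[OF s(1)]) simp
    have e: "ae_eq (\<lambda>z. cnj (\<psi> (- 0) z)) (\<lambda>z. cnj (u z))"
      using s(2) unfolding ae_eq_def by (auto elim: eventually_mono)
    from conservation[OF wp X_cnj[OF u] _ r e, of "- t"] False show ?thesis
      by (simp add: energy_cnj[OF X] energy_cnj[OF u] mass_cnj)
  qed
  then show "energy p (\<psi> t) = energy p u" "mass (\<psi> t) = mass u" by auto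
qed

text \<open>
  A datum near a ground state has nearly the same mass and energy; both are conserved, so the solution
  stays in the region where \<open>near_ground_states\<close> applies.
\<close>

theorem ground_states_stable:
  assumes wp: "well_posed p" and \<mu>: "\<mu> > 0"
  shows "flow_stable p (ground_states p \<mu>)"
  unfolding flow_stable_def
proof (intro allI impI)
  fix \<epsilon> :: real assume \<epsilon>: "\<epsilon> > 0"
  obtain d where d: "d > 0" and near: "\<And>w. w \<in> X \<Longrightarrow> \<bar>mass w - \<mu>\<bar> < d \<Longrightarrow> energy p w < level \<mu> + d \<Longrightarrow>
    \<exists>v\<in>ground_states p \<mu>. X_norm (\<lambda>z. w z - v z) < \<epsilon> / 2"
    using near_ground_states[OF \<mu>, of "\<epsilon> / 2"] \<epsilon> by auto
  obtain \<delta> where \<delta>: "\<delta> > 0" and data: "\<And>w u. w \<in> X \<Longrightarrow> u \<in> ground_states p \<mu> \<Longrightarrow> X_norm (\<lambda>z. w z - u z) < \<delta> \<Longrightarrow>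
    \<bar>mass w - \<mu>\<bar> < min d \<mu> \<and> energy p w < level \<mu> + min d \<mu>"
    using data_near_ground_states[OF \<mu>, of "min d \<mu>"] d \<mu> by auto
  have "(\<exists>\<psi>. solution_on p UNIV \<psi> \<and> ae_eq (\<psi> 0) w) \<and>
        (\<forall>\<psi>. solution_on p UNIV \<psi> \<and> ae_eq (\<psi> 0) w \<longrightarrow> (SUP t. X_infdist (\<psi> t) (ground_states p \<mu>)) < ennreal \<epsilon>)"
    if w: "w \<in> X" and dist: "X_infdist w (ground_states p \<mu>) < ennreal \<delta>" for w
  proof -
    obtain u where u: "u \<in> ground_states p \<mu>" "X_norm (\<lambda>z. w z - u z) < \<delta>"
      using dist \<delta> unfolding X_infdist_def by (auto simp: INF_less_iff ennreal_less_iff)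
    note D = data[OF w u]
    have pos: "L2sq w > 0" using D by (auto simp: mass_eq)
    have "(SUP t. X_infdist (\<psi> t) (ground_states p \<mu>)) < ennreal \<epsilon>"
      if s: "solution_on p UNIV \<psi>" "ae_eq (\<psi> 0) w" for \<psi>
    proof -
      have "X_infdist (\<psi> t) (ground_states p \<mu>) \<le> ennreal (\<epsilon> / 2)" for t
      proof -
        note c = global_conservation[OF wp w s, of t]
        have "\<psi> t \<in> X" using s(1) by (rule solution_on_X) simp
        from near[OF this] obtain v where v: "v \<in> ground_states p \<mu>" "X_norm (\<lambda>z. \<psi> t z - v z) < \<epsilon> / 2"
          using D unfolding c by fastforce
        show ?thesis unfolding X_infdist_def by (rule INF_lower2[OF v(1)]) (use v(2) in \<open>simp add: ennreal_leI\<close>)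
      qed
      then have "(SUP t. X_infdist (\<psi> t) (ground_states p \<mu>)) \<le> ennreal (\<epsilon> / 2)" by (intro SUP_least)
      also have "\<dots> < ennreal \<epsilon>" using \<epsilon> by (simp add: ennreal_less_iff)
      finally show ?thesis .
    qed
    moreover have "\<exists>\<psi>. solution_on p UNIV \<psi> \<and> ae_eq (\<psi> 0) w" using global_solution[OF wp w pos] by blast
    ultimately show ?thesis by blast
  qed
  then show "\<exists>\<delta>>0. \<forall>\<psi>0\<in>X. X_infdist \<psi>0 (ground_states p \<mu>) < ennreal \<delta> \<longrightarrow>
          (\<exists>\<psi>. solution_on p UNIV \<psi> \<and> ae_eq (\<psi> 0) \<psi>0) \<and>
          (\<forall>\<psi>. solution_on p UNIV \<psi> \<and> ae_eq (\<psi> 0) \<psi>0 \<longrightarrow> (SUP t. X_infdist (\<psi> t) (ground_states p \<mu>)) < ennreal \<epsilon>)"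
    using \<delta> by blast
qed

end

theorem theorem1p2:
  fixes p :: real
  assumes "1 < p" and "p < 7 / 3"
    and "well_posed p"
  shows "\<forall>\<mu>::real. \<mu> > 0 \<longrightarrow> ground_states p \<mu> \<noteq> {} \<and> flow_stable p (ground_states p \<mu>)"
proof -
  interpret subcritical p using assms(1,2) by unfold_locales
  show ?thesis using ground_states_nonempty ground_states_stable[OF assms(3)] by blast
qed

end
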